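(* Let $T:\mathcal{M}_d(\mathbb{C})\to\mathcal{M}_d(\mathbb{C})$ be a trace-preserving Schwarz map and let $\mathcal{X}_T:=\mathrm{span}\{X\in\mathcal{M}_d(\mathbb{C}):\exists\varphi\in\mathbb{R},\ T(X)=e^{i\varphi}X\}$. (1) There exist an orthogonal direct sum decomposition $\mathbb{C}^d=\mathcal{H}_0\oplus\bigoplus_{k=1}^K\mathcal{H}_k$ with $\mathcal{H}_k=\mathcal{H}_{k,1}\otimes\mathcal{H}_{k,2}$ (where $\dim\mathcal{H}_0=0$ and $\dim\mathcal{H}_{k,i}=1$ are allowed), and positive definite density matrices $\rho_k$ on $\mathcal{H}_{k,2}$, such that $$\mathcal{X}_T=\Big\{0\oplus\bigoplus_{k=1}^K x_k\otimes\rho_k:\ x_k\in\mathcal{B}(\mathcal{H}_{k,1})\Big\},$$ i.e. $\mathcal{X}_T=0\oplus\bigoplus_k\mathcal{M}_{d_k}\otimes\rho_k$ with $d_k=\dim\mathcal{H}_{k,1}$. (2) There exist unitaries $U_k\in\mathcal{B}(\mathcal{H}_{k,1})$ and a permutation $\pi$ of $\{1,\dots,K\}$ satisfying $d_{\pi(k)}=d_k$ for all $k$, such that for every $X=0\oplus\bigoplus_kx_k\otimes\rho_k\in\mathcal{X}_T$, $$T(X)=0\oplus\bigoplus_{k=1}^KU_kx_{\pi(k)}U_k^\dagger\otimes\rho_k.$$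
   Context: A positive trace-preserving linear map $T$ on $\mathcal{M}_d(\mathbb{C})$ is a Schwarz map if its adjoint $T^*$ (defined by $\mathrm{tr}[AT^*(B)]=\mathrm{tr}[T(A)B]$) satisfies $T^*(A^\dagger A)\ge T^*(A^\dagger)T^*(A)$ for all $A\in\mathcal{M}_d(\mathbb{C})$; every completely positive trace-preserving map is a Schwarz map. Positive: maps positive semidefinite matrices to positive semidefinite matrices; trace-preserving: $\mathrm{tr}[T(X)]=\mathrm{tr}[X]$. $\mathcal{B}(\mathcal{H})$ denotes all linear operators on $\mathcal{H}$; the direct sum is orthogonal but need not be a block structure in the computational basis. *)

theory Defs
  imports Complex_Main "Jordan_Normal_Form.Schur_Decomposition"
begin

definition mtrace :: "complex mat \<Rightarrow> complex" where
  "mtrace A = (\<Sum>i<dim_row A. A $$ (i, i))"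

definition hermitian_mat :: "nat \<Rightarrow> complex mat \<Rightarrow> bool" where
  "hermitian_mat n A \<longleftrightarrow> A \<in> carrier_mat n n \<and> mat_adjoint A = A"

definition psd_mat :: "nat \<Rightarrow> complex mat \<Rightarrow> bool" where
  "psd_mat n A \<longleftrightarrow> hermitian_mat n A \<and>
     (\<forall>v \<in> carrier_vec n. Re ((A *\<^sub>v v) \<bullet>c v) \<ge> 0)"

definition pd_mat :: "nat \<Rightarrow> complex mat \<Rightarrow> bool" where
  "pd_mat n A \<longleftrightarrow> hermitian_mat n A \<and>
     (\<forall>v \<in> carrier_vec n. v \<noteq> 0\<^sub>v n \<longrightarrow> Re ((A *\<^sub>v v) \<bullet>c v) > 0)"

definition pd_density :: "nat \<Rightarrow> complex mat \<Rightarrow> bool" where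
  "pd_density n A \<longleftrightarrow> pd_mat n A \<and> mtrace A = 1"

definition loewner_ge :: "nat \<Rightarrow> complex mat \<Rightarrow> complex mat \<Rightarrow> bool" where
  "loewner_ge n A B \<longleftrightarrow> A \<in> carrier_mat n n \<and> B \<in> carrier_mat n n \<and> psd_mat n (A - B)"

definition unitary_mat :: "nat \<Rightarrow> complex mat \<Rightarrow> bool" where
  "unitary_mat n U \<longleftrightarrow> U \<in> carrier_mat n n \<and> mat_adjoint U * U = 1\<^sub>m n \<and> U * mat_adjoint U = 1\<^sub>m n"

definition linear_map_mat :: "nat \<Rightarrow> (complex mat \<Rightarrow> complex mat) \<Rightarrow> bool" where
  "linear_map_mat d T \<longleftrightarrow>
     (\<forall>A \<in> carrier_mat d d. T A \<in> carrier_mat d d) \<and>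
     (\<forall>A \<in> carrier_mat d d. \<forall>B \<in> carrier_mat d d. T (A + B) = T A + T B) \<and>
     (\<forall>A \<in> carrier_mat d d. \<forall>c. T (c \<cdot>\<^sub>m A) = c \<cdot>\<^sub>m T A)"

definition positive_map :: "nat \<Rightarrow> (complex mat \<Rightarrow> complex mat) \<Rightarrow> bool" where
  "positive_map d T \<longleftrightarrow> (\<forall>A. psd_mat d A \<longrightarrow> psd_mat d (T A))"

definition trace_preserving :: "nat \<Rightarrow> (complex mat \<Rightarrow> complex mat) \<Rightarrow> bool" where
  "trace_preserving d T \<longleftrightarrow> (\<forall>A \<in> carrier_mat d d. mtrace (T A) = mtrace A)"

definition is_adjoint_map :: "nat \<Rightarrow> (complex mat \<Rightarrow> complex mat) \<Rightarrow> (complex mat \<Rightarrow> complex mat) \<Rightarrow> bool" where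
  "is_adjoint_map d T S \<longleftrightarrow>
     (\<forall>B \<in> carrier_mat d d. S B \<in> carrier_mat d d) \<and>
     (\<forall>A \<in> carrier_mat d d. \<forall>B \<in> carrier_mat d d. mtrace (A * S B) = mtrace (T A * B))"

definition schwarz_map :: "nat \<Rightarrow> (complex mat \<Rightarrow> complex mat) \<Rightarrow> bool" where
  "schwarz_map d T \<longleftrightarrow> linear_map_mat d T \<and> positive_map d T \<and> trace_preserving d T \<and>
     (\<exists>S. is_adjoint_map d T S \<and>
        (\<forall>A \<in> carrier_mat d d.
           loewner_ge d (S (mat_adjoint A * A)) (S (mat_adjoint A) * S A)))"

fun lincomb_mat :: "nat \<Rightarrow> (complex \<times> complex mat) list \<Rightarrow> complex mat" where
  "lincomb_mat d [] = 0\<^sub>m d d"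
| "lincomb_mat d ((c, X) # rest) = c \<cdot>\<^sub>m X + lincomb_mat d rest"

definition span_mat :: "nat \<Rightarrow> complex mat set \<Rightarrow> complex mat set" where
  "span_mat d S = {lincomb_mat d l | l. \<forall>p \<in> set l. snd p \<in> S}"

definition peripheral_space :: "nat \<Rightarrow> (complex mat \<Rightarrow> complex mat) \<Rightarrow> complex mat set" where
  "peripheral_space d T = span_mat d
     {X \<in> carrier_mat d d. \<exists>\<phi>::real. T X = exp (\<i> * complex_of_real \<phi>) \<cdot>\<^sub>m X}"

definition kron_mat :: "complex mat \<Rightarrow> complex mat \<Rightarrow> complex mat" where
  "kron_mat A B = mat (dim_row A * dim_row B) (dim_col A * dim_col B)
     (\<lambda>(i, j). A $$ (i div dim_row B, j div dim_col B) * B $$ (i mod dim_row B, j mod dim_col B))"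

fun block_diag :: "complex mat list \<Rightarrow> complex mat" where
  "block_diag [] = 0\<^sub>m 0 0"
| "block_diag (A # As) = (let B = block_diag As in
     four_block_mat A (0\<^sub>m (dim_row A) (dim_col B)) (0\<^sub>m (dim_row B) (dim_col A)) B)"

text \<open>The matrix W (0 \<oplus> \<Oplus>_k x_k \<otimes> \<rho>_k) W^\<dagger>, where W is a unitary identifying
  C^d with H_0 \<oplus> \<Oplus>_k (H_k1 \<otimes> H_k2), dim H_0 = d0.\<close>
definition decomp_embed :: "complex mat \<Rightarrow> nat \<Rightarrow> nat \<Rightarrow> (nat \<Rightarrow> complex mat) \<Rightarrow> (nat \<Rightarrow> complex mat) \<Rightarrow> complex mat" where
  "decomp_embed W d0 K \<rho> x =
     W * block_diag (0\<^sub>m d0 d0 # map (\<lambda>k. kron_mat (x k) (\<rho> k)) [0..<K]) * mat_adjoint W"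

end

theory Submission
  imports Defs
begin

text \<open>Let \<open>S\<close> be the adjoint of \<open>T\<close>, a unital Schwarz map. Its powers are bounded, and a compactness argument
  gives powers of \<open>S\<close> converging to an idempotent unital Schwarz map \<open>Q\<close> that commutes with \<open>S\<close> and on whose range
  \<open>S\<close> is invertible, with a Schwarz inverse. The adjoint \<open>P\<close> of \<open>Q\<close> is a projection with range \<open>\<X>\<^sub>T\<close>: it fixes
  peripheral eigenvectors, and on its range \<open>T\<close> cannot have Jordan blocks or eigenvalues off the unit circle,
  because powers of \<open>T\<close> converge to the identity there. Let \<open>e\<close> be the support projection of \<open>P 1\<close>. Since \<open>P 1\<close> is
  a faithful invariant state, the Schwarz inequality for \<open>R x = e Q(x) e\<close> is an equality on the fixed points of
  \<open>R\<close>; hence these form a *-algebra \<open>A\<close> with unit \<open>e\<close>, and \<open>R\<close> and \<open>P\<close> are \<open>A\<close>-bimodule maps. Choose matrix units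
  \<open>v\<^sub>k\<^sub>i v\<^sub>k\<^sub>j\<^sup>*\<close> of \<open>A\<close> over minimal projections \<open>p\<^sub>k\<close>. By the bimodule property \<open>P\<close> is determined by its values on
  \<open>p\<^sub>k x p\<^sub>k\<close>, which are multiples of \<open>P p\<^sub>k\<close> because \<open>p\<^sub>k A p\<^sub>k\<close> is one-dimensional; so \<open>\<X>\<^sub>T\<close> is spanned by the elements
  \<open>v\<^sub>k\<^sub>i \<rho>\<^sub>k v\<^sub>k\<^sub>j\<^sup>*\<close> with \<open>\<rho>\<^sub>k\<close> proportional to \<open>P p\<^sub>k\<close>. Finally \<open>a \<mapsto> e S(a) e\<close> and its inverse are both Schwarz maps of
  \<open>A\<close>, hence *-automorphisms; these permute the blocks and act by unitaries, and \<open>T\<close> acts on \<open>\<X>\<^sub>T\<close> dually.\<close>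

section \<open>Finitely supported matrices\<close>

text \<open>Complete positivity is not assumed, so there is no Kraus or Stinespring form to start
  from; the only multiplicative tool is the equality case of the Schwarz inequality,
  \<open>schw_mult\<close>. Equality is forced by a faithful invariant functional, and
  \<open>P 1\<close> is faithful only on the corner cut out by \<open>e\<close>. This is why
  \<open>Q\<close> is compressed to \<open>R\<close> and why the algebra has unit \<open>e\<close>
  instead of the identity; the complement of \<open>e\<close> becomes the zero summand. Limits of
  powers are preferred to the Jordan form of \<open>T\<close> because unital Schwarz maps are closed
  under composition and limits, so \<open>Q\<close> and the inverse \<open>N\<close> inherit the
  Schwarz property at once. The property is needed for both: transposition is a positive unital
  bijection with positive inverse, yet it reverses products, so positivity alone would not produce
  an automorphism. Trace duality carries everything back to \<open>T\<close>: an element of the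
  range is recovered from its traces against the matrix units, and the unitaries of the automorphism
  reappear as their adjoints.\<close>

text \<open>Matrices of all sizes are elements of one type of finitely supported matrices, a ring without unit. The
  \<open>d \<times> d\<close> matrices form its corner cut out by the projection \<open>idm d\<close>; vectors are matrices \<open>f\<close> with
  \<open>f * eu 0 0 = f\<close>, so that \<open>adj f * g\<close> is the inner product times \<open>eu 0 0\<close>.\<close>

typedef fmat = "{f :: nat \<Rightarrow> nat \<Rightarrow> complex. \<exists>N. \<forall>i j. i \<ge> N \<or> j \<ge> N \<longrightarrow> f i j = 0}"
  morphisms ent Abs_fmat
  by (rule exI[of _ "\<lambda>_ _. 0"]) auto

setup_lifting type_definition_fmat

lemma fmat_eqI: "(\<And>i j. ent x i j = ent y i j) \<Longrightarrow> x = y"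
  by (metis ent_inject ext)

lemma ent_bound:
  obtains N where "\<And>i j. i \<ge> N \<or> j \<ge> N \<Longrightarrow> ent x i j = 0"
  using ent[of x] by auto

lemma ent_bound2:
  obtains N where "\<And>i j. i \<ge> N \<or> j \<ge> N \<Longrightarrow> ent x i j = 0"
    "\<And>i j. i \<ge> N \<or> j \<ge> N \<Longrightarrow> ent y i j = 0"
proof -
  obtain N where N: "\<And>i j. i \<ge> N \<or> j \<ge> N \<Longrightarrow> ent x i j = 0" using ent_bound by blast
  obtain M where M: "\<And>i j. i \<ge> M \<or> j \<ge> M \<Longrightarrow> ent y i j = 0" using ent_bound by blast
  show ?thesis by (rule that[of "max N M"]; rule N M; auto)
qed

instantiation fmat :: ab_group_add
begin
lift_definition zero_fmat :: fmat is "\<lambda>_ _. 0" by auto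
lift_definition plus_fmat :: "fmat \<Rightarrow> fmat \<Rightarrow> fmat" is "\<lambda>f g i j. f i j + g i j"
proof -
  fix f g :: "nat \<Rightarrow> nat \<Rightarrow> complex"
  assume "\<exists>N. \<forall>i j. N \<le> i \<or> N \<le> j \<longrightarrow> f i j = 0" "\<exists>N. \<forall>i j. N \<le> i \<or> N \<le> j \<longrightarrow> g i j = 0"
  then obtain N M where "\<forall>i j. N \<le> i \<or> N \<le> j \<longrightarrow> f i j = 0" "\<forall>i j. M \<le> i \<or> M \<le> j \<longrightarrow> g i j = 0"
    by blast
  then show "\<exists>N. \<forall>i j. N \<le> i \<or> N \<le> j \<longrightarrow> f i j + g i j = 0"
    by (intro exI[of _ "max N M"]) auto
qed
lift_definition uminus_fmat :: "fmat \<Rightarrow> fmat" is "\<lambda>f i j. - f i j" by auto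
definition minus_fmat :: "fmat \<Rightarrow> fmat \<Rightarrow> fmat" where "minus_fmat x y = x + - y"
lemma ent_zero [simp]: "ent 0 i j = 0" by transfer simp
lemma ent_plus [simp]: "ent (x + y) i j = ent x i j + ent y i j" by transfer simp
lemma ent_uminus [simp]: "ent (- x) i j = - ent x i j" by transfer simp
lemma ent_minus [simp]: "ent (x - y) i j = ent x i j - ent y i j" by (simp add: minus_fmat_def)
instance
  by standard (auto intro!: fmat_eqI)
end

lemma ent_sum [simp]: "ent (sum f A) i j = (\<Sum>a\<in>A. ent (f a) i j)"
  by (induction A rule: infinite_finite_induct) auto

instantiation fmat :: ring
begin
text \<open>The sum runs over the support of row \<open>i\<close>, which is finite, so no size has
  to be chosen; \<open>ent_times\<close> replaces it by a sum up to any sufficient bound.\<close>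

lift_definition times_fmat :: "fmat \<Rightarrow> fmat \<Rightarrow> fmat" is
  "\<lambda>f g i j. \<Sum>k | f i k \<noteq> 0. f i k * g k j"
proof -
  fix f g :: "nat \<Rightarrow> nat \<Rightarrow> complex"
  assume "\<exists>N. \<forall>i j. N \<le> i \<or> N \<le> j \<longrightarrow> f i j = 0" "\<exists>N. \<forall>i j. N \<le> i \<or> N \<le> j \<longrightarrow> g i j = 0"
  then obtain N M where "\<forall>i j. N \<le> i \<or> N \<le> j \<longrightarrow> f i j = 0" "\<forall>i j. M \<le> i \<or> M \<le> j \<longrightarrow> g i j = 0"
    by blast
  then show "\<exists>N. \<forall>i j. N \<le> i \<or> N \<le> j \<longrightarrow> (\<Sum>k | f i k \<noteq> 0. f i k * g k j) = 0"
    by (intro exI[of _ "max N M"]) (auto intro!: sum.neutral)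
qed

lemma ent_times:
  assumes "\<And>k. k \<ge> N \<Longrightarrow> ent x i k = 0"
  shows "ent (x * y) i j = (\<Sum>k<N. ent x i k * ent y k j)"
proof -
  have "ent (x * y) i j = (\<Sum>k | ent x i k \<noteq> 0. ent x i k * ent y k j)" by transfer simp
  also have "\<dots> = (\<Sum>k<N. ent x i k * ent y k j)"
    by (rule sum.mono_neutral_left) (use assms in \<open>auto simp: not_le[symmetric]\<close>)
  finally show ?thesis .
qed

instance
proof
  fix x y z :: fmat
  obtain N where N: "\<And>i j. i \<ge> N \<or> j \<ge> N \<Longrightarrow> ent x i j = 0" "\<And>i j. i \<ge> N \<or> j \<ge> N \<Longrightarrow> ent y i j = 0"
    using ent_bound2[of x y] by blast
  note e = ent_times[of N]
  have xy: "ent (x * y) i j = (\<Sum>k<N. ent x i k * ent y k j)" for y i j by (rule e) (simp add: N)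
  have yz: "ent (y * z) i j = (\<Sum>k<N. ent y i k * ent z k j)" for z i j by (rule e) (simp add: N)
  have xyz: "ent (x * y * z) i j = (\<Sum>k<N. ent (x * y) i k * ent z k j)" for z i j
    by (rule e) (simp add: N xy)
  have s: "ent ((x + y) * z) i j = (\<Sum>k<N. ent (x + y) i k * ent z k j)" for i j
    by (rule e) (simp add: N)
  show "x * y * z = x * (y * z)"
    by (rule fmat_eqI) (auto simp: xyz xy yz sum_distrib_left sum_distrib_right mult.assoc intro: sum.swap)
  show "(x + y) * z = x * z + y * z"
    by (rule fmat_eqI) (auto simp: s xy yz sum.distrib algebra_simps)
  show "x * (y + z) = x * y + x * z"
    by (rule fmat_eqI) (auto simp: xy sum.distrib algebra_simps)
qed
end

section \<open>Scalars, adjoint, trace and elementary matrices\<close>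

lift_definition csc :: "complex \<Rightarrow> fmat \<Rightarrow> fmat" (infixr "\<star>" 75) is "\<lambda>c f i j. c * f i j" by auto
lift_definition adj :: "fmat \<Rightarrow> fmat" is "\<lambda>f i j. cnj (f j i)" by auto
lift_definition tr :: "fmat \<Rightarrow> complex" is "\<lambda>f. \<Sum>i | f i i \<noteq> 0. f i i" .
lift_definition eu :: "nat \<Rightarrow> nat \<Rightarrow> fmat" is "\<lambda>a b i j. if i = a \<and> j = b then 1 else 0"
  by (metis max.bounded_iff not_less_eq_eq nle_le)
lift_definition idm :: "nat \<Rightarrow> fmat" is "\<lambda>d i j. if i = j \<and> i < d then 1 else 0"
  by (metis not_le)

lemma ent_csc [simp]: "ent (c \<star> x) i j = c * ent x i j" by transfer simp
lemma ent_adj [simp]: "ent (adj x) i j = cnj (ent x j i)" by transfer simp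
lemma ent_eu: "ent (eu a b) i j = (if i = a \<and> j = b then 1 else 0)" by transfer simp
lemma ent_idm: "ent (idm d) i j = (if i = j \<and> i < d then 1 else 0)" by transfer simp

lemma tr_eq:
  assumes "\<And>k. k \<ge> N \<Longrightarrow> ent x k k = 0"
  shows "tr x = (\<Sum>k<N. ent x k k)"
proof -
  have "tr x = (\<Sum>k | ent x k k \<noteq> 0. ent x k k)" by transfer simp
  also have "\<dots> = (\<Sum>k<N. ent x k k)"
    by (rule sum.mono_neutral_left) (use assms in \<open>auto simp: not_le[symmetric]\<close>)
  finally show ?thesis .
qed

global_interpretation fmat: vector_space csc
  by standard (auto intro!: fmat_eqI simp: algebra_simps)

lemma csc_mult [simp]: "(c \<star> x) * y = c \<star> (x * y)" "x * (c \<star> y) = c \<star> (x * y)"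
proof -
  obtain N where N: "\<And>i j. i \<ge> N \<or> j \<ge> N \<Longrightarrow> ent x i j = 0" using ent_bound by blast
  have 1: "ent (x * y) i j = (\<Sum>k<N. ent x i k * ent y k j)" for y i j by (rule ent_times) (simp add: N)
  have 2: "ent ((c \<star> x) * y) i j = (\<Sum>k<N. ent (c \<star> x) i k * ent y k j)" for y i j by (rule ent_times) (simp add: N)
  show "(c \<star> x) * y = c \<star> (x * y)" "x * (c \<star> y) = c \<star> (x * y)"
    by (auto intro!: fmat_eqI simp: 1 2 sum_distrib_left mult_ac)
qed

lemma adj_simps [simp]:
  "adj (adj x) = x" "adj (x + y) = adj x + adj y" "adj (x - y) = adj x - adj y" "adj (- x) = - adj x"
  "adj 0 = 0" "adj (c \<star> x) = cnj c \<star> adj x" "adj (sum f A) = (\<Sum>a\<in>A. adj (f a))"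
  "adj (eu a b) = eu b a" "adj (idm d) = idm d"
  by (auto intro!: fmat_eqI simp: ent_eu ent_idm)

lemma adj_mult [simp]: "adj (x * y) = adj y * adj x"
proof -
  obtain N where N: "\<And>i j. i \<ge> N \<or> j \<ge> N \<Longrightarrow> ent x i j = 0" "\<And>i j. i \<ge> N \<or> j \<ge> N \<Longrightarrow> ent y i j = 0"
    using ent_bound2[of x y] by blast
  have 1: "ent (x * y) i j = (\<Sum>k<N. ent x i k * ent y k j)" for i j by (rule ent_times) (simp add: N)
  have 2: "ent (adj y * adj x) i j = (\<Sum>k<N. ent (adj y) i k * ent (adj x) k j)" for i j by (rule ent_times) (simp add: N)
  show ?thesis
    by (auto intro!: fmat_eqI simp: 1 2 mult.commute)
qed

lemma tr_simps [simp]: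
  "tr (x + y) = tr x + tr y" "tr (x - y) = tr x - tr y" "tr 0 = 0" "tr (- x) = - tr x"
  "tr (c \<star> x) = c * tr x" "tr (adj x) = cnj (tr x)"
proof -
  obtain N where N: "\<And>i j. i \<ge> N \<or> j \<ge> N \<Longrightarrow> ent x i j = 0" "\<And>i j. i \<ge> N \<or> j \<ge> N \<Longrightarrow> ent y i j = 0"
    using ent_bound2[of x y] by blast
  note t = tr_eq[of N]
  show "tr (x + y) = tr x + tr y" "tr (x - y) = tr x - tr y" "tr 0 = 0" "tr (- x) = - tr x"
  "tr (c \<star> x) = c * tr x" "tr (adj x) = cnj (tr x)"
    by (subst t; simp add: N sum.distrib sum_subtractf sum_distrib_left sum_negf)+
qed

lemma tr_sum [simp]: "tr (sum f A) = (\<Sum>a\<in>A. tr (f a))"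
  by (induction A rule: infinite_finite_induct) auto

lemma tr_commute: "tr (x * y) = tr (y * x)"
proof -
  obtain N where N: "\<And>i j. i \<ge> N \<or> j \<ge> N \<Longrightarrow> ent x i j = 0" "\<And>i j. i \<ge> N \<or> j \<ge> N \<Longrightarrow> ent y i j = 0"
    using ent_bound2[of x y] by blast
  have 1: "ent (x * y) i j = (\<Sum>k<N. ent x i k * ent y k j)" for i j by (rule ent_times) (simp add: N)
  have 2: "ent (y * x) i j = (\<Sum>k<N. ent y i k * ent x k j)" for i j by (rule ent_times) (simp add: N)
  have "tr (x * y) = (\<Sum>i<N. \<Sum>k<N. ent x i k * ent y k i)"
    by (subst tr_eq[of N]) (simp_all add: 1 N)
  also have "\<dots> = (\<Sum>k<N. \<Sum>i<N. ent y k i * ent x i k)"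
    by (subst sum.swap) (simp add: mult.commute)
  also have "\<dots> = tr (y * x)"
    by (subst tr_eq[of N]) (simp_all add: 2 N)
  finally show ?thesis .
qed

lemma tr_rotate: "tr (x * y * z) = tr (y * z * x)" "tr (x * (y * z)) = tr (y * (z * x))"
  by (metis mult.assoc tr_commute)+

lemma eu_mult: "eu i j * eu k l = (if j = k then eu i l else 0)"
  by (rule fmat_eqI) (subst ent_times[of "Suc j"], auto simp: ent_eu)

lemma tr_eu [simp]: "tr (eu i j) = (if i = j then 1 else 0)"
  by (subst tr_eq[of "Suc i"]) (auto simp: ent_eu)

lemma sum_delta2:
  fixes c :: "'a :: comm_monoid_add"
  shows "(\<Sum>k<N. \<Sum>l<(M::nat). if l = i \<and> k = j then c else 0) = (if i < M \<and> j < (N::nat) then c else 0)"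
proof -
  have "(\<Sum>l<M. if l = i \<and> k = j then c else 0) = (if k = j then (if i < M then c else 0) else 0)" for k
    by simp
  then show ?thesis by (simp only: sum.delta finite_lessThan lessThan_iff if_if_eq_conj) auto
qed

lemma tr_times_eu: "tr (x * eu i j) = ent x j i"
proof -
  obtain N where N: "\<And>i j. i \<ge> N \<or> j \<ge> N \<Longrightarrow> ent x i j = 0" using ent_bound[of x] by blast
  have 1: "ent (x * y) i j = (\<Sum>k<N. ent x i k * ent y k j)" for y i j by (rule ent_times) (simp add: N)
  show ?thesis
    by (subst tr_eq[of N]) (use N in \<open>auto simp: 1 ent_eu sum_delta2 not_le[symmetric] if_distrib if_distribR cong: if_cong\<close>)
qed

lemma tr_eu_times: "tr (eu i j * x) = ent x j i"
  by (subst tr_commute) (rule tr_times_eu)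

lemma tr_nondeg: "(\<And>y. tr (x * y) = tr (x' * y)) \<Longrightarrow> x = x'"
  by (rule fmat_eqI) (metis tr_times_eu)

text \<open>The trace is the squared Frobenius norm of \<open>x\<close>.\<close>

lemma tr_adj_times: "Re (tr (adj x * x)) \<ge> 0" "tr (adj x * x) = of_real (Re (tr (adj x * x)))"
  "tr (adj x * x) = 0 \<longleftrightarrow> x = 0" "Re (tr (adj x * x)) = 0 \<longleftrightarrow> x = 0"
proof -
  obtain N where N: "\<And>i j. i \<ge> N \<or> j \<ge> N \<Longrightarrow> ent x i j = 0" using ent_bound[of x] by blast
  have 1: "ent (adj x * y) i j = (\<Sum>k<N. ent (adj x) i k * ent y k j)" for y i j by (rule ent_times) (simp add: N)
  have 2: "tr (adj x * x) = of_real (\<Sum>i<N. \<Sum>k<N. (cmod (ent x k i))\<^sup>2)"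
    by (subst tr_eq[of N]) (auto simp: 1 N complex_norm_square[unfolded of_real_power] mult.commute)
  show "Re (tr (adj x * x)) \<ge> 0" unfolding 2 by (auto intro!: sum_nonneg)
  show "tr (adj x * x) = of_real (Re (tr (adj x * x)))" unfolding 2 by simp
  have 3: "Re (tr (adj x * x)) = 0 \<longleftrightarrow> x = 0"
  proof
    assume "Re (tr (adj x * x)) = 0"
    then have "\<forall>i<N. \<forall>k<N. (cmod (ent x k i))\<^sup>2 = 0"
      unfolding 2 by (simp add: sum_nonneg_eq_0_iff sum_nonneg del: zero_eq_power2)
    then show "x = 0" using N by (intro fmat_eqI) (metis ent_zero linorder_not_less norm_eq_zero zero_eq_power2)
  qed auto
  then show "Re (tr (adj x * x)) = 0 \<longleftrightarrow> x = 0" .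
  show "tr (adj x * x) = 0 \<longleftrightarrow> x = 0"
    using 3 by (metis \<open>tr (adj x * x) = complex_of_real (Re (tr (adj x * x)))\<close> of_real_0 zero_complex.simps(1))
qed

lemma adj_times_eq_0: "adj x * x = 0 \<longleftrightarrow> x = 0"
  using tr_adj_times(3)[of x] by auto

lemma times_adj_eq_0: "x * adj x = 0 \<longleftrightarrow> x = 0"
  using adj_times_eq_0[of "adj x"] by (metis adj_simps(1) adj_simps(5))

definition corner :: "fmat \<Rightarrow> fmat set" where
  "corner s = {x. s * x = x \<and> x * s = x}"

definition proj :: "fmat \<Rightarrow> bool" where
  "proj p \<longleftrightarrow> adj p = p \<and> p * p = p"

lemma ent_idm_times: "ent (idm d * x) i j = (if i < d then ent x i j else 0)"
proof (cases "i < d")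
  case True
  then have "ent (idm d * x) i j = (\<Sum>k<d. if i = k then ent x k j else 0)"
    by (subst ent_times[of d]) (simp_all add: ent_idm if_distrib[of "\<lambda>u. u * _"] cong: if_cong)
  with True show ?thesis by simp
qed (subst ent_times[of 0], auto simp: ent_idm)

lemma ent_times_idm: "ent (x * idm d) i j = (if j < d then ent x i j else 0)"
proof -
  have "ent (x * idm d) i j = cnj (ent (idm d * adj x) j i)"
    by (metis adj_mult adj_simps(1) adj_simps(9) ent_adj)
  then show ?thesis by (simp add: ent_idm_times)
qed

lemma corner_idm: "x \<in> corner (idm d) \<longleftrightarrow> (\<forall>i j. i \<ge> d \<or> j \<ge> d \<longrightarrow> ent x i j = 0)"
proof
  assume "x \<in> corner (idm d)"
  then have "ent (idm d * x) i j = ent x i j" "ent (x * idm d) i j = ent x i j" for i j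
    by (auto simp: corner_def)
  then show "\<forall>i j. i \<ge> d \<or> j \<ge> d \<longrightarrow> ent x i j = 0"
    unfolding ent_idm_times ent_times_idm by (metis linorder_not_less)
qed (auto simp: corner_def not_le[symmetric] intro!: fmat_eqI simp: ent_idm_times ent_times_idm)

lemma ex_corner_idm: "\<exists>d. x \<in> corner (idm d)"
  unfolding corner_idm by (metis ent_bound)

lemma idm_eq: "idm d = (\<Sum>i<d. eu i i)"
  by (rule fmat_eqI) (auto simp: ent_idm ent_eu if_distrib if_distribR cong: if_cong)

lemma proj_idm [simp]: "proj (idm d)"
  unfolding proj_def by (auto intro!: fmat_eqI simp: ent_idm ent_idm_times)

lemma eu_expand:
  assumes "x \<in> corner (idm d)"
  shows "x = (\<Sum>i<d. \<Sum>j<d. ent x i j \<star> eu i j)"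
proof (rule fmat_eqI)
  fix a b
  have "ent (\<Sum>i<d. \<Sum>j<d. ent x i j \<star> eu i j) a b
    = (\<Sum>i<d. \<Sum>j<d. if j = b \<and> i = a then ent x a b else 0)"
    unfolding ent_sum by (intro sum.cong) (auto simp: ent_eu)
  then show "ent x a b = ent (\<Sum>i<d. \<Sum>j<d. ent x i j \<star> eu i j) a b"
    using assms by (auto simp: sum_delta2 corner_idm)
qed

lemma eu_corner: "i < d \<Longrightarrow> j < d \<Longrightarrow> eu i j \<in> corner (idm d)"
  by (auto simp: corner_idm ent_eu)

section \<open>Positive elements and projections\<close>

text \<open>The test elements \<open>v\<close> are matrices; the trace adds up the quadratic forms
  of the columns of \<open>v\<close>, so this is ordinary positive semidefiniteness.\<close>

definition pos :: "fmat \<Rightarrow> bool" where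
  "pos x \<longleftrightarrow> adj x = x \<and> (\<forall>v. 0 \<le> Re (tr (adj v * x * v)))"

lemma pos_adj_times: "pos (adj c * c)"
proof -
  have "0 \<le> Re (tr (adj v * (adj c * c) * v))" for v
    using tr_adj_times(1)[of "c * v"] by (simp add: mult.assoc)
  then show ?thesis by (simp add: pos_def)
qed

lemma pos_0 [simp]: "pos 0" by (simp add: pos_def)

lemma pos_add: "pos x \<Longrightarrow> pos y \<Longrightarrow> pos (x + y)"
  by (simp add: pos_def algebra_simps)

lemma pos_conj: "pos x \<Longrightarrow> pos (adj c * x * c)"
  unfolding pos_def
proof (intro conjI allI)
  fix v assume x: "adj x = x \<and> (\<forall>v. 0 \<le> Re (tr (adj v * x * v)))"
  then show "adj (adj c * x * c) = adj c * x * c" by (simp add: mult.assoc)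
  have "0 \<le> Re (tr (adj (c * v) * x * (c * v)))" using x by blast
  then show "0 \<le> Re (tr (adj v * (adj c * x * c) * v))" by (simp add: mult.assoc)
qed

text \<open>Moving from \<open>v\<close> against the direction \<open>w = x * v\<close> changes the
  form by \<open>- 2 * t * a + t^2 * b\<close>, where \<open>a\<close> is the squared norm of
  \<open>w\<close>. This stays nonnegative for small positive \<open>t\<close> only if
  \<open>a = 0\<close>.\<close>

lemma pos_null:
  assumes "pos x" "Re (tr (adj v * x * v)) = 0"
  shows "x * v = 0"
proof -
  define w where "w = x * v"
  have h: "adj x = x" and p: "\<And>v. 0 \<le> Re (tr (adj v * x * v))" using assms(1) by (auto simp: pos_def)
  define a where "a = Re (tr (adj w * w))"
  define b where "b = Re (tr (adj w * x * w))"
  have b: "b \<ge> 0" using p[of w] by (simp add: b_def)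
  have a: "a \<ge> 0" unfolding a_def by (rule tr_adj_times)
  have 1: "tr (adj w * x * v) = tr (adj w * w)" by (simp add: w_def mult.assoc)
  have 2: "tr (adj v * x * w) = cnj (tr (adj w * x * v))"
    by (subst tr_simps(6)[symmetric]) (simp add: h mult.assoc)
  have "0 \<le> - 2 * t * a + t\<^sup>2 * b" for t :: real
  proof -
    let ?u = "v - complex_of_real t \<star> w"
    have "tr (adj ?u * x * ?u) = tr (adj v * x * v) - of_real t * tr (adj v * x * w) - of_real t * tr (adj w * x * v) + of_real t * of_real t * tr (adj w * x * w)"
      by (simp add: algebra_simps)
    then have "Re (tr (adj ?u * x * ?u)) = - 2 * t * a + t\<^sup>2 * b"
      using assms(2) by (simp add: 2 1 a_def b_def power2_eq_square)
    then show ?thesis using p[of ?u] by simp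
  qed
  \<comment> \<open>The minimiser would be \<open>a / b\<close>; the added 1 covers
    \<open>b = 0\<close> and still leaves a value of at most \<open>- a^2 / (b + 1)\<close>.\<close>
  from this[of "a / (b + 1)"] have "0 \<le> - 2 * a\<^sup>2 / (b+1) + a\<^sup>2 * b / (b+1)\<^sup>2"
    by (simp add: power_divide power2_eq_square)
  moreover have "a\<^sup>2 * b / (b+1)\<^sup>2 \<le> a\<^sup>2 / (b+1)"
    using b by (simp add: divide_simps power2_eq_square mult_left_mono)
  ultimately have "a\<^sup>2 / (b+1) \<le> 0" by (simp add: field_simps)
  then have "a = 0" using b by (simp add: divide_le_0_iff)
  then show ?thesis using tr_adj_times(4)[of w] by (simp add: a_def w_def)
qed

lemma pos_tr:
  assumes "pos x" shows "0 \<le> Re (tr x)" "Re (tr x) = 0 \<Longrightarrow> x = 0"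
proof -
  obtain d where d: "x \<in> corner (idm d)" using ex_corner_idm by blast
  then have e: "adj (idm d) * x * idm d = x" by (simp add: corner_def)
  show "0 \<le> Re (tr x)" using assms e by (metis pos_def)
  assume "Re (tr x) = 0"
  then have "x * idm d = 0" using pos_null[OF assms, of "idm d"] e by simp
  then show "x = 0" using d by (simp add: corner_def)
qed

lemma pos_antisym: "pos x \<Longrightarrow> pos (- x) \<Longrightarrow> x = 0"
  using pos_tr[of x] pos_tr[of "-x"] by fastforce

section \<open>Projections, rank and orthonormal bases\<close>

lemma proj_pos: "proj p \<Longrightarrow> pos p"
  using pos_adj_times[of p] by (simp add: proj_def)

lemma proj_tr: "proj p \<Longrightarrow> tr p = of_real (Re (tr p))" "proj p \<Longrightarrow> 0 \<le> Re (tr p)"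
  "proj p \<Longrightarrow> tr p = 0 \<longleftrightarrow> p = 0"
  using tr_adj_times[of p] by (simp_all add: proj_def)

lemma proj_diff:
  assumes "proj p" "proj q" "p * q = q"
  shows "proj (p - q)" "q * p = q"
proof -
  show 1: "q * p = q" using assms by (metis adj_mult proj_def)
  show "proj (p - q)" using assms 1 by (simp add: proj_def algebra_simps)
qed

lemma corner_diff_trans:
  assumes "q \<in> corner p" "x \<in> corner q" shows "x \<in> corner p"
  using assms unfolding corner_def by simp (metis mult.assoc)

text \<open>Comparing traces shows that \<open>c\<close> is a positive real, so dividing
  \<open>v\<close> by \<open>sqrt c\<close> gives a partial isometry with initial projection
  \<open>p\<close>.\<close>

lemma normalize_isometry:
  assumes "adj v * v = c \<star> p" "v \<noteq> 0" "proj p"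
  shows "\<exists>s. s \<noteq> 0 \<and> adj (s \<star> v) * (s \<star> v) = p" "p \<noteq> 0"
proof -
  show pn: "p \<noteq> 0" using assms adj_times_eq_0[of v] by auto
  have "complex_of_real (Re (tr (adj v * v))) = c * of_real (Re (tr p))"
    using tr_adj_times(2)[of v] proj_tr(1)[OF assms(3)] assms(1) by (metis tr_simps(5))
  moreover have "Re (tr p) > 0" using pn proj_tr[OF assms(3)] by (metis less_eq_real_def of_real_0)
  moreover have "Re (tr (adj v * v)) > 0" using assms(2) tr_adj_times[of v] by (simp add: less_le)
  ultimately have c: "c = of_real (Re (tr (adj v * v)) / Re (tr p))"
    "Re (tr (adj v * v)) / Re (tr p) > 0" by (auto simp: field_simps)
  define r where "r = Re (tr (adj v * v)) / Re (tr p)"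
  have r: "c = of_real r" "r > 0" using c by (auto simp: r_def)
  have "complex_of_real (1 / sqrt r) * complex_of_real (1 / sqrt r) * c = 1"
    unfolding r of_real_mult[symmetric] using r by (simp add: field_simps)
  then have "adj (complex_of_real (1 / sqrt r) \<star> v) * (complex_of_real (1 / sqrt r) \<star> v) = p"
    using assms(1) by (simp add: mult.assoc)
  then show "\<exists>s. s \<noteq> 0 \<and> adj (s \<star> v) * (s \<star> v) = p"
    using r by (intro exI[of _ "complex_of_real (1 / sqrt r)"]) simp
qed

lemma eu00_sandwich: "eu 0 0 * x * eu 0 0 = ent x 0 0 \<star> eu 0 0"
proof -
  have "ent (x * eu 0 0) i j = (if j = 0 then ent x i 0 else 0)" for i j x
  proof -
    obtain N where N: "\<And>i j. i \<ge> N \<or> j \<ge> N \<Longrightarrow> ent x i j = 0" using ent_bound[of x] by blast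
    have 1: "ent (x * y) i j = (\<Sum>k<N. ent x i k * ent y k j)" for y i j by (rule ent_times) (simp add: N)
    show ?thesis using N[of i 0] by (auto simp: 1 ent_eu if_distrib cong: if_cong)
  qed
  note e = this
  have "ent (eu 0 0 * x) i j = (if i = 0 then ent x 0 j else 0)" for i j
    using e[of "adj x" j i] by (metis adj_mult adj_simps(1) adj_simps(8) complex_cnj_cancel_iff complex_cnj_zero ent_adj)
  then show ?thesis by (intro fmat_eqI) (auto simp: e ent_eu)
qed

lemma proj_eu00: "proj (eu 0 0)" by (simp add: proj_def eu_mult)

lemma proj_range_vec:
  assumes "proj p" "p \<noteq> 0"
  obtains f where "p * f = f" "f * eu 0 0 = f" "adj f * f = eu 0 0"
proof -
  obtain i j where ij: "ent p i j \<noteq> 0" using assms(2) fmat_eqI[of p 0] by auto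
  \<comment> \<open>Column \<open>j\<close> of \<open>p\<close>, moved to column 0; its entry in row
    \<open>i\<close> is nonzero.\<close>
  define v where "v = p * eu j 0"
  have "ent (p * eu j 0) i 0 = tr (p * eu j 0 * eu 0 i)" by (simp add: tr_times_eu)
  also have "\<dots> = ent p i j" by (simp add: mult.assoc eu_mult tr_times_eu)
  finally have v: "v \<noteq> 0" using ij by (auto simp: v_def)
  have "adj v * v = eu 0 0 * (adj v * v) * eu 0 0"
    by (simp add: v_def mult.assoc eu_mult) (simp add: mult.assoc[symmetric] eu_mult)
  also have "\<dots> = ent (adj v * v) 0 0 \<star> eu 0 0" by (rule eu00_sandwich)
  finally obtain s where s: "adj (s \<star> v) * (s \<star> v) = eu 0 0"
    using normalize_isometry[OF _ v proj_eu00] by metis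
  have "p * v = v" "v * eu 0 0 = v" using assms(1)
    by (simp_all add: v_def proj_def mult.assoc[symmetric]) (simp add: mult.assoc eu_mult)
  with s show ?thesis by (intro that[of "s \<star> v"]) auto
qed

text \<open>The norm of \<open>f - f * p\<close> expands to zero, so \<open>f * p = f\<close>;
  idempotence of \<open>f * adj f\<close> follows.\<close>

lemma proj_vec:
  assumes "adj f * f = p" "proj p"
  shows "proj (f * adj f)" "f * p = f"
proof -
  have pp: "p * p = p" "adj p = p" using assms by (auto simp: proj_def)
  have "adj (f - f * p) * (f - f * p) = 0"
    using assms(1) pp by (simp add: algebra_simps mult.assoc[symmetric])
  then show fp: "f * p = f" using adj_times_eq_0[of "f - f * p"] by simp
  have "f * adj f * (f * adj f) = f * p * adj f" using assms(1) by (simp add: mult.assoc[symmetric]) (simp add: mult.assoc)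
  then show "proj (f * adj f)" using fp by (simp add: proj_def)
qed

lemma proj_tr_ge_1:
  assumes "proj p" "p \<noteq> 0" shows "Re (tr p) \<ge> 1"
proof -
  obtain f where f: "p * f = f" "f * eu 0 0 = f" "adj f * f = eu 0 0" using proj_range_vec[OF assms] by blast
  have q: "proj (f * adj f)" using proj_vec[OF f(3) proj_eu00] by simp
  have "proj (p - f * adj f)" by (rule proj_diff) (use assms q f in \<open>simp_all add: mult.assoc[symmetric]\<close>)
  from proj_tr(2)[OF this] have "Re (tr (f * adj f)) \<le> Re (tr p)" by simp
  moreover have "tr (f * adj f) = 1" by (subst tr_commute) (simp add: f)
  ultimately show ?thesis by simp
qed

definition rk :: "fmat \<Rightarrow> nat" where "rk p = nat \<lfloor>Re (tr p)\<rfloor>"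

lemma rk_less:
  assumes "proj p" "proj q" "p * q = q" "q \<noteq> 0"
  shows "rk (p - q) < rk p"
proof -
  have "Re (tr q) \<ge> 1" by (rule proj_tr_ge_1) fact+
  moreover have "Re (tr (p - q)) \<ge> 0" using proj_diff[OF assms(1-3)] proj_tr by blast
  ultimately show ?thesis unfolding rk_def by simp linarith
qed

definition onb :: "fmat \<Rightarrow> nat \<Rightarrow> (nat \<Rightarrow> fmat) \<Rightarrow> bool" where
  "onb p n f \<longleftrightarrow> (\<forall>i<n. p * f i = f i \<and> f i * eu 0 0 = f i) \<and>
     (\<forall>i<n. \<forall>j<n. adj (f i) * f j = (if i = j then eu 0 0 else 0)) \<and> (\<Sum>i<n. f i * adj (f i)) = p"

lemma onbD:
  assumes "onb p n f"
  shows "i < n \<Longrightarrow> p * f i = f i" "i < n \<Longrightarrow> f i * eu 0 0 = f i"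
    "i < n \<Longrightarrow> j < n \<Longrightarrow> adj (f i) * f j = (if i = j then eu 0 0 else 0)" "(\<Sum>i<n. f i * adj (f i)) = p"
  using assms by (auto simp: onb_def)

text \<open>Split off the rank-one projection onto a unit vector of the range and recurse on the
  difference.\<close>

lemma orthonormal_basis:
  assumes "proj p"
  shows "\<exists>n f. onb p n f"
  using assms
proof (induction "rk p" arbitrary: p rule: less_induct)
  case less
  show ?case
  proof (cases "p = 0")
    case True
    then show ?thesis by (intro exI[of _ 0]) (auto simp: onb_def)
  next
    case False
    obtain g where g: "p * g = g" "g * eu 0 0 = g" "adj g * g = eu 0 0" using proj_range_vec[OF less(2) False] by blast
    define q where "q = g * adj g"
    have q: "proj q" unfolding q_def using proj_vec[OF g(3) proj_eu00] by simp
    have pq: "p * q = q" by (simp add: q_def mult.assoc[symmetric] g)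
    have q0: "q \<noteq> 0" using g by (metis adj_simps(8) eu_mult mult.assoc mult_zero_left mult_zero_right q_def tr_eu tr_simps(3) zero_neq_one)
    have r: "rk (p - q) < rk p" by (rule rk_less) (use less q pq q0 in auto)
    have pd: "proj (p - q)" "q * p = q" using proj_diff[OF less(2) q pq] by auto
    from less(1)[OF r pd(1)] obtain n f where nf: "onb (p - q) n f" by blast
    note f = onbD[OF nf]
    have qg: "q * g = g" "adj g * q = adj g" using g by (simp_all add: q_def mult.assoc)
       (metis adj_mult adj_simps(8) mult.assoc)
    have "p * (p - q) = p - q" "q * (p - q) = 0" using less(2) q pq pd(2) by (auto simp: proj_def algebra_simps)
    then have pf: "p * f i = f i" "q * f i = 0" if "i < n" for i using f(1)[OF that] by (metis mult.assoc, metis mult.assoc mult_zero_left)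
    have gf: "adj g * f i = 0" "adj (f i) * g = 0" if "i < n" for i
    proof -
      show "adj g * f i = 0" using pf(2)[OF that] qg(2) by (metis mult.assoc mult_zero_right)
      then show "adj (f i) * g = 0" by (metis adj_mult adj_simps(1) adj_simps(5))
    qed
    let ?f = "\<lambda>i. if i = n then g else f i"
    have s: "(\<Sum>i<n. ?f i * adj (?f i)) = (\<Sum>i<n. f i * adj (f i))" by (intro sum.cong) auto
    have "onb p (Suc n) ?f" unfolding onb_def
    proof (intro conjI)
      show "\<forall>i<Suc n. p * ?f i = ?f i \<and> ?f i * eu 0 0 = ?f i" using f(2) pf g by (auto simp: less_Suc_eq)
      show "\<forall>i<Suc n. \<forall>j<Suc n. adj (?f i) * ?f j = (if i = j then eu 0 0 else 0)"
        using f(3) gf g by (auto simp: less_Suc_eq)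
      show "(\<Sum>i<Suc n. ?f i * adj (?f i)) = p" using f(4) s by (simp add: q_def)
    qed
    then show ?thesis by blast
  qed
qed

section \<open>Linear maps and annihilating polynomials\<close>

definition lin :: "(fmat \<Rightarrow> fmat) \<Rightarrow> bool" where
  "lin F \<longleftrightarrow> (\<forall>x y. F (x + y) = F x + F y) \<and> (\<forall>c x. F (c \<star> x) = c \<star> F x)"

lemma lin_simps:
  assumes "lin F"
  shows "F (x + y) = F x + F y" "F (c \<star> x) = c \<star> F x" "F 0 = 0" "F (- x) = - F x" "F (x - y) = F x - F y"
    "F (sum g A) = (\<Sum>a\<in>A. F (g a))"
proof -
  show a: "F (x + y) = F x + F y" and c: "F (c \<star> x) = c \<star> F x" for x y c using assms by (auto simp: lin_def)
  show z: "F 0 = 0" using c[of 0 0] by simp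
  show m: "F (- x) = - F x" for x using a[of x "- x"] z by (simp add: minus_unique)
  show "F (x - y) = F x - F y" using a[of x "- y"] m by simp
  show "F (sum g A) = (\<Sum>a\<in>A. F (g a))" by (induction A rule: infinite_finite_induct) (auto simp: z a)
qed

lemma lin_comp: "lin F \<Longrightarrow> lin G \<Longrightarrow> lin (\<lambda>x. F (G x))" by (simp add: lin_def)
lemma lin_funpow: "lin F \<Longrightarrow> lin (F ^^ n)" by (induction n) (auto simp: lin_def)
lemma lin_sandwich: "lin F \<Longrightarrow> lin (\<lambda>x. e * F x * e)" by (simp add: lin_def algebra_simps)
lemma lin_times: "lin (\<lambda>x. a * x)" by (simp add: lin_def algebra_simps)

text \<open>A split polynomial in \<open>L\<close>, given by the list of its roots and applied to
  \<open>v\<close>.\<close>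

fun killp :: "(fmat \<Rightarrow> fmat) \<Rightarrow> complex list \<Rightarrow> fmat \<Rightarrow> fmat" where
  "killp L [] v = v"
| "killp L (l # ls) v = killp L ls (L v - l \<star> v)"

lemma killp_lin: "lin L \<Longrightarrow> lin (killp L ls)"
proof (induction ls)
  case (Cons l ls)
  have "lin (\<lambda>v. L v - l \<star> v)"
    using Cons(2) by (simp add: lin_def fmat.scale_right_diff_distrib fmat.scale_right_distrib fmat.scale_left_commute)
  from lin_comp[OF Cons(1)[OF Cons(2)] this] show ?case by simp
qed (auto simp: lin_def)

lemma killp_comm: "lin L \<Longrightarrow> killp L ls (L v) = L (killp L ls v)"
  by (induction ls arbitrary: v) (auto simp: lin_simps(2,5)[symmetric])

text \<open>The factors commute, so the first one can be moved to the outside; when the whole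
  product vanishes this reads as an eigenvector equation for the shorter product.\<close>

lemma killp_Cons: "lin L \<Longrightarrow> killp L (l # ls) v = L (killp L ls v) - l \<star> killp L ls v"
  by (simp add: lin_simps[OF killp_lin] killp_comm)

definition poly_op :: "(fmat \<Rightarrow> fmat) \<Rightarrow> complex poly \<Rightarrow> fmat \<Rightarrow> fmat" where
  "poly_op L p v = (\<Sum>i\<le>degree p. coeff p i \<star> (L ^^ i) v)"

lemma poly_op_bound: "degree p \<le> n \<Longrightarrow> poly_op L p v = (\<Sum>i\<le>n. coeff p i \<star> (L ^^ i) v)"
  unfolding poly_op_def by (rule sum.mono_neutral_left) (auto simp: coeff_eq_0)

lemma poly_op_linear_factor:
  assumes "lin L"
  shows "poly_op L ([:- l, 1:] * p) v = poly_op L p (L v - l \<star> v)"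
proof -
  let ?n = "Suc (degree p)"
  have deg: "degree ([:- l, 1:] * p) \<le> ?n"
    using degree_mult_le[of "[:- l, 1:]" p] by simp
  note LL = lin_simps[OF lin_funpow[OF assms]]
  have e: "[:- l, 1:] * p = pCons 0 p - smult l p" by (simp add: )
  have "poly_op L ([:- l, 1:] * p) v = (\<Sum>i\<le>?n. coeff (pCons 0 p) i \<star> (L ^^ i) v) - (\<Sum>i\<le>?n. l \<star> coeff p i \<star> (L ^^ i) v)"
    by (subst poly_op_bound[OF deg], unfold e) (simp only: coeff_diff coeff_smult fmat.scale_left_diff_distrib fmat.scale_scale sum_subtractf)
  also have "(\<Sum>i\<le>?n. coeff (pCons 0 p) i \<star> (L ^^ i) v) = (\<Sum>i\<le>degree p. coeff p i \<star> (L ^^ i) (L v))"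
    by (subst sum.atMost_Suc_shift) (simp add: funpow_swap1)
  also have "(\<Sum>i\<le>?n. l \<star> coeff p i \<star> (L ^^ i) v) = (\<Sum>i\<le>degree p. l \<star> coeff p i \<star> (L ^^ i) v)"
    by (simp add: coeff_eq_0)
  also have "(\<Sum>i\<le>degree p. coeff p i \<star> (L ^^ i) (L v)) - \<dots> = poly_op L p (L v - l \<star> v)"
    unfolding poly_op_def LL sum_subtractf[symmetric]
    by (intro sum.cong) (auto simp: fmat.scale_right_diff_distrib fmat.scale_left_commute)
  finally show ?thesis .
qed

lemma poly_op_smult: "poly_op L (smult c p) v = c \<star> poly_op L p v"
  by (subst poly_op_bound[of _ "degree p"]) (simp_all add: degree_smult_le poly_op_def fmat.scale_sum_right)

lemma poly_op_factors: "lin L \<Longrightarrow> poly_op L (\<Prod>l\<leftarrow>ls. [:- l, 1:]) v = killp L ls v"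
proof (induction ls arbitrary: v)
  case Nil
  then show ?case by (simp add: poly_op_def)
next
  case (Cons l ls)
  then show ?case by (simp only: list.map prod_list.Cons poly_op_linear_factor killp.simps)
qed

lemma finite_dim_dependent:
  assumes "\<And>n. x n \<in> corner (idm d)"
  shows "\<exists>c. (\<exists>n\<le>d*d. c n \<noteq> 0) \<and> (\<Sum>n\<le>d*d. c n \<star> x n) = 0"
proof -
  define N where "N = Suc (d * d)"
  \<comment> \<open>The \<open>d * d + 1\<close> matrices become columns by row-major flattening.
    The zero row added at the bottom makes \<open>M\<close> square and forces a kernel vector, whose
    entries are the coefficients of the dependence.\<close>
  define M where "M = mat N N (\<lambda>(i,n). if i < d * d then ent (x n) (i div d) (i mod d) else 0)"
  have M: "M \<in> carrier_mat N N" by (simp add: M_def)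
  have "row M (d * d) = 0\<^sub>v N" by (rule eq_vecI) (auto simp: M_def N_def)
  moreover have "M = mat\<^sub>r N N (\<lambda>k. if k = d*d then 0\<^sub>v N else row M k)"
    by (rule eq_matI) (auto simp: M_def N_def)
  moreover have "det (mat\<^sub>r N N (\<lambda>k. if k = d*d then 0\<^sub>v N else row M k)) = 0"
    by (rule det_row_0) (use M in \<open>auto simp: N_def\<close>)
  ultimately have "det M = 0" by metis
  then obtain v where v: "v \<in> carrier_vec N" "v \<noteq> 0\<^sub>v N" "M *\<^sub>v v = 0\<^sub>v N"
    using det_0_iff_vec_prod_zero[OF M] by blast
  have "\<exists>n\<le>d*d. v $ n \<noteq> 0"
  proof (rule ccontr)
    assume "\<not> ?thesis"
    then have "v = 0\<^sub>v N" using v(1) by (intro eq_vecI) (auto simp: N_def)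
    then show False using v by simp
  qed
  moreover have "(\<Sum>n\<le>d*d. v $ n \<star> x n) = 0"
  proof (rule fmat_eqI)
    fix i j
    show "ent (\<Sum>n\<le>d * d. v $ n \<star> x n) i j = ent 0 i j"
    proof (cases "i < d \<and> j < d")
      case True
      define k where "k = i * d + j"
      have "i * d + j < Suc i * d" "Suc i * d \<le> d * d" using True by (simp, intro mult_le_mono1) simp
      then have k: "k div d = i" "k mod d = j" "k < d * d"
        using True by (auto simp: k_def)
      then have Mk: "M $$ (k, n) = ent (x n) i j" if "n < N" for n
        using k that by (simp add: M_def N_def)
      have "0 = (M *\<^sub>v v) $ k" using v(3) k by (simp add: N_def)
      also have "\<dots> = (\<Sum>n = 0..<N. M $$ (k,n) * v $ n)" using k v(1) M
        by (simp add: N_def scalar_prod_def)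
      also have "\<dots> = (\<Sum>n\<le>d*d. v $ n * ent (x n) i j)"
        by (rule sum.cong) (auto simp: Mk N_def less_Suc_eq_le)
      finally show ?thesis by simp
    qed (use assms in \<open>auto simp: corner_idm\<close>)
  qed
  ultimately show ?thesis by blast
qed

text \<open>The iterates of \<open>v\<close> up to exponent \<open>d * d\<close> are linearly
  dependent; the relation is a nonzero polynomial in \<open>L\<close>, and it splits over the
  complex numbers.\<close>

lemma annihilate:
  assumes "lin L" "\<And>n. (L ^^ n) v \<in> corner (idm d)"
  shows "\<exists>ls. killp L ls v = 0"
proof -
  obtain c k where c: "k \<le> d*d" "c k \<noteq> 0" "(\<Sum>n\<le>d*d. c n \<star> (L ^^ n) v) = 0"
    using finite_dim_dependent[of "\<lambda>n. (L ^^ n) v" d] assms(2) by blast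
  define p where "p = (\<Sum>n\<le>d*d. monom (c n) n)"
  have co: "coeff p n = (if n \<le> d * d then c n else 0)" for n
    by (simp add: p_def coeff_sum coeff_monom)
  have "degree p \<le> d * d" by (rule degree_le) (simp add: co)
  then have "poly_op L p v = 0" using c(3) by (simp add: poly_op_bound co)
  moreover have p0: "p \<noteq> 0" using c(1,2) co by (metis coeff_0)
  obtain ls where "smult (lead_coeff p) (\<Prod>l\<leftarrow>ls. [:- l, 1:]) = p"
    using fundamental_theorem_algebra_factorized[of p] by blast
  ultimately have "lead_coeff p \<star> killp L ls v = 0"
    by (metis poly_op_smult poly_op_factors assms(1))
  then show ?thesis using p0 by auto
qed

lemma killp_times_commute:
  assumes "x * v = v * x" "x * a = a * x"
  shows "x * killp (\<lambda>y. a * y) ls v = killp (\<lambda>y. a * y) ls v * x"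
  using assms
proof (induction ls arbitrary: v)
  case (Cons l ls)
  have "x * (a * v - l \<star> v) = (a * v - l \<star> v) * x"
    using Cons(2,3) by (simp add: algebra_simps) (metis mult.assoc)
  from Cons(1)[OF this Cons(3)] show ?case by simp
qed simp

text \<open>Each factor acts on \<open>b\<close> as a scalar \<open>l - m\<close>. When
  \<open>b\<close> is itself such a product, this makes \<open>b * b\<close> a multiple of
  \<open>b\<close>.\<close>

lemma killp_eigen:
  assumes "a * b = l \<star> b" "v * b = c \<star> b"
  shows "\<exists>g. killp (\<lambda>y. a * y) ls v * b = (c * g) \<star> b"
  using assms(2)
proof (induction ls arbitrary: v c)
  case Nil
  then show ?case by (intro exI[of _ 1]) simp
next
  case (Cons m ls)
  have "(a * v - m \<star> v) * b = (c * (l - m)) \<star> b"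
    using Cons(2) assms(1) by (simp add: algebra_simps mult.assoc fmat.scale_left_diff_distrib)
  from Cons(1)[OF this] show ?case by (auto simp: mult.assoc)
qed

section \<open>Star-algebras and spectral decomposition\<close>

definition star_alg :: "fmat set \<Rightarrow> bool" where
  "star_alg A \<longleftrightarrow> 0 \<in> A \<and> (\<forall>x\<in>A. \<forall>y\<in>A. x + y \<in> A \<and> x * y \<in> A) \<and> (\<forall>x\<in>A. adj x \<in> A \<and> (\<forall>c. c \<star> x \<in> A))"

lemma star_alg_simps:
  assumes "star_alg A"
  shows "0 \<in> A" "x \<in> A \<Longrightarrow> y \<in> A \<Longrightarrow> x + y \<in> A" "x \<in> A \<Longrightarrow> y \<in> A \<Longrightarrow> x * y \<in> A" "x \<in> A \<Longrightarrow> adj x \<in> A"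
    "x \<in> A \<Longrightarrow> c \<star> x \<in> A" "x \<in> A \<Longrightarrow> - x \<in> A" "x \<in> A \<Longrightarrow> y \<in> A \<Longrightarrow> x - y \<in> A"
    "(\<And>i. i \<in> I \<Longrightarrow> g i \<in> A) \<Longrightarrow> sum g I \<in> A"
proof -
  show 0: "0 \<in> A" and a: "x \<in> A \<Longrightarrow> y \<in> A \<Longrightarrow> x + y \<in> A" and "x \<in> A \<Longrightarrow> y \<in> A \<Longrightarrow> x * y \<in> A" "x \<in> A \<Longrightarrow> adj x \<in> A"
    and c: "x \<in> A \<Longrightarrow> c \<star> x \<in> A" for x y c using assms by (auto simp: star_alg_def)
  show m: "x \<in> A \<Longrightarrow> - x \<in> A" for x using c[of x "-1"] by simp
  show "x \<in> A \<Longrightarrow> y \<in> A \<Longrightarrow> x - y \<in> A" using a[of x "- y"] m by simp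
  show "(\<And>i. i \<in> I \<Longrightarrow> g i \<in> A) \<Longrightarrow> sum g I \<in> A"
    by (induction I rule: infinite_finite_induct) (auto simp: 0 a)
qed

lemma killp_star_alg: "star_alg A \<Longrightarrow> a \<in> A \<Longrightarrow> v \<in> A \<Longrightarrow> killp (\<lambda>y. a * y) ls v \<in> A"
  by (induction ls arbitrary: v) (auto simp: star_alg_simps)

lemma corner_times: "x \<in> corner s \<Longrightarrow> y \<in> corner s \<Longrightarrow> x * y \<in> corner s"
  by (simp add: corner_def mult.assoc) (simp add: mult.assoc[symmetric])

lemma funpow_times_corner: "a \<in> corner s \<Longrightarrow> v \<in> corner s \<Longrightarrow> ((\<lambda>y. a * y) ^^ n) v \<in> corner s"
  by (induction n) (auto simp: corner_times)

text \<open>With \<open>(a - l\<^sub>1)\<cdots>(a - l\<^sub>n)a = 0\<close> and \<open>n\<close> minimal, the product without its first factor is a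
  nonzero element \<open>b\<close> with \<open>ab = l\<^sub>1b\<close>; being normal, it is a multiple of the spectral projection.\<close>

lemma spectral_projection:
  assumes A: "star_alg A" "a \<in> A" and a: "adj a = a" "a \<noteq> 0" "a \<in> corner (idm d)"
  obtains q and l :: real where "proj q" "q \<in> A" "q \<noteq> 0" "l \<noteq> 0" "a * q = complex_of_real l \<star> q"
    "q * a = complex_of_real l \<star> q"
proof -
  let ?L = "\<lambda>y. a * y"
  have "\<exists>ls. killp ?L ls a = 0" by (rule annihilate[OF lin_times]) (rule funpow_times_corner[OF a(3) a(3)])
  then obtain ls where ls: "killp ?L ls a = 0" and min: "\<And>ms. killp ?L ms a = 0 \<Longrightarrow> length ls \<le> length ms"
    using ex_has_least_nat[of "\<lambda>ls. killp ?L ls a = 0" _ length] by blast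
  have "ls \<noteq> []" using ls a by auto
  then obtain m ms where ms: "ls = m # ms" by (cases ls) auto
  define b where "b = killp ?L ms a"
  have b0: "b \<noteq> 0" using min[of ms] by (auto simp: ms b_def)
  have ab: "a * b = m \<star> b" using ls killp_Cons[OF lin_times, of a m ms a] by (simp add: ms b_def)
  have bA: "b \<in> A" unfolding b_def by (rule killp_star_alg) fact+
  have ba: "a * b = b * a" unfolding b_def by (rule killp_times_commute) auto
  have "adj b * a = a * adj b" using arg_cong[OF ba, of adj] by (simp add: a)
  then have n: "adj b * b = b * adj b" unfolding b_def by (intro killp_times_commute) (auto simp: b_def)
  obtain g where g: "b * b = (m * g) \<star> b" unfolding b_def using killp_eigen[OF ab ab, of ms] by (auto simp: b_def)
  \<comment> \<open>Otherwise \<open>b * b = 0\<close>, and normality turns the square of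
    \<open>adj b * b\<close> into a product containing \<open>b * b\<close>; hence \<open>b\<close>
    would vanish.\<close>
  have g0: "m * g \<noteq> 0"
  proof
    assume "m * g = 0"
    then have bb: "b * b = 0" using g by simp
    have "adj (adj b * b) * (adj b * b) = adj b * (b * adj b) * b" by (simp add: mult.assoc)
    also have "\<dots> = adj b * adj b * (b * b)" by (simp add: n[symmetric] mult.assoc)
    finally have "adj b * b = 0" using bb adj_times_eq_0[of "adj b * b"] by simp
    then show False using adj_times_eq_0 b0 by blast
  qed
  define q where "q = (1 / (m * g)) \<star> b"
  have qq: "q * q = q" unfolding q_def using g g0 by simp
  have q0: "q \<noteq> 0" unfolding q_def using b0 g0 by simp
  have nq: "adj q * q = q * adj q" unfolding q_def by (simp add: n mult.commute)
  have aq: "a * q = m \<star> q" "q * a = m \<star> q" unfolding q_def using ab ba by (simp_all add: fmat.scale_left_commute)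
  \<comment> \<open>A normal idempotent is selfadjoint: the norm of \<open>h\<close> cancels to
    zero, so \<open>q = adj q * q\<close>.\<close>
  define h where "h = q - adj q * q"
  have qq': "adj q * adj q = adj q" using arg_cong[OF qq, of adj] by simp
  have "adj h * h = adj q * q - adj q * (adj q * q) - adj q * q * q + adj q * q * (adj q * q)"
    by (simp add: h_def algebra_simps)
  also have "adj q * (adj q * q) = adj q * q" by (simp add: qq' mult.assoc[symmetric])
  also have "adj q * q * q = adj q * q" by (simp add: qq mult.assoc)
  also have "adj q * q * (adj q * q) = adj q * (q * adj q) * q" by (simp add: mult.assoc)
  also have "\<dots> = adj q * adj q * (q * q)" by (simp add: nq[symmetric] mult.assoc)
  also have "\<dots> = adj q * q" by (simp add: qq qq')
  finally have "h = 0" using adj_times_eq_0[of h] by simp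
  then have "q = adj q * q" by (simp add: h_def)
  then have q: "adj q = q" by (metis adj_mult adj_simps(1))
  have "cnj m \<star> q = adj (m \<star> q)" by (simp add: q)
  also have "\<dots> = m \<star> q" using aq by (metis a(1) adj_mult q)
  finally have "cnj m = m" using q0 by simp
  then have "complex_of_real (Re m) = m" by (simp add: complex_eq_iff)
  moreover have "q \<in> A" unfolding q_def using bA by (simp add: star_alg_simps[OF A(1)])
  moreover have "m \<noteq> 0" using g0 by auto
  ultimately show ?thesis using aq q qq q0 by (intro that[of q "Re m"]) (auto simp: proj_def)
qed

lemma star_alg_UNIV: "star_alg UNIV" by (simp add: star_alg_def)

lemma pos_spectral_projection:
  assumes "pos b" "b \<noteq> 0"
  obtains q and l :: real where "proj q" "q \<noteq> 0" "l > 0" "b * q = complex_of_real l \<star> q"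
    "q * b = complex_of_real l \<star> q" "pos (b - complex_of_real l \<star> q)"
proof -
  obtain d where d: "b \<in> corner (idm d)" using ex_corner_idm by blast
  obtain q and l :: real where q: "proj q" "q \<noteq> 0" "l \<noteq> 0" "b * q = complex_of_real l \<star> q"
    "q * b = complex_of_real l \<star> q"
    using spectral_projection[OF star_alg_UNIV, of b d] assms d by (auto simp: pos_def)
  have qq: "adj q = q" "q * q = q" using q by (auto simp: proj_def)
  have "0 \<le> Re (tr (adj q * b * q))" using assms by (simp add: pos_def)
  then have "0 \<le> l * Re (tr q)" by (simp add: q qq)
  moreover have "Re (tr q) > 0" using proj_tr_ge_1[OF q(1,2)] by simp
  ultimately have l: "l > 0" using q(3) by (simp add: zero_le_mult_iff)
  \<comment> \<open>\<open>idm D\<close> serves as a unit for both \<open>b\<close> and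
    \<open>q\<close>; conjugating \<open>b\<close> by \<open>idm D - q\<close> then removes exactly
    the spectral part of \<open>b\<close> under \<open>q\<close>.\<close>
  obtain D where D: "b \<in> corner (idm D)" "q \<in> corner (idm D)"
  proof -
    obtain N where "\<And>i j. i \<ge> N \<or> j \<ge> N \<Longrightarrow> ent b i j = 0" "\<And>i j. i \<ge> N \<or> j \<ge> N \<Longrightarrow> ent q i j = 0"
      using ent_bound2[of b q] by blast
    then show ?thesis by (intro that[of N]) (auto simp: corner_idm)
  qed
  have "adj (idm D - q) * b * (idm D - q) = b - complex_of_real l \<star> q"
    using D by (simp add: algebra_simps qq corner_def q)
  then have "pos (b - complex_of_real l \<star> q)" using pos_conj[OF assms(1), of "idm D - q"] by simp
  with q l show ?thesis using that by blast
qed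

text \<open>Split off a spectral part \<open>l \<star> q\<close>, take a root \<open>c\<close> of
  the rest inside the corner of \<open>s - q\<close>, and add \<open>sqrt l\<close> times
  \<open>q\<close>; the mixed terms vanish because \<open>q * c = 0\<close>. Keeping the root in the
  corner allows its use for maps whose Schwarz inequality is so far known only on \<open>d\<close>
  by \<open>d\<close> matrices.\<close>

lemma pos_sqrt_corner:
  assumes "pos b" "b \<in> corner s" "proj s"
  shows "\<exists>c\<in>corner s. b = adj c * c"
  using assms
proof (induction "rk s" arbitrary: s b rule: less_induct)
  case less
  show ?case
  proof (cases "b = 0")
    case True
    then show ?thesis by (intro bexI[of _ 0]) (auto simp: corner_def)
  next
    case False
    obtain q and l :: real where q: "proj q" "q \<noteq> 0" "l > 0" "b * q = complex_of_real l \<star> q"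
    "q * b = complex_of_real l \<star> q" "pos (b - complex_of_real l \<star> q)"
      using pos_spectral_projection[OF less(2) False] by blast
    have qq: "adj q = q" "q * q = q" using q by (auto simp: proj_def)
    have "complex_of_real l \<star> (s * q) = complex_of_real l \<star> q"
      using less(3) q(4) by (metis (mono_tags, lifting) corner_def csc_mult(2) mem_Collect_eq mult.assoc)
    then have sq: "s * q = q" using q(3) by simp
    note pd = proj_diff[OF less(4) q(1) sq]
    let ?b = "b - complex_of_real l \<star> q"
    have "?b \<in> corner (s - q)" using less(3) q qq sq pd by (auto simp: corner_def algebra_simps)
    from less(1)[OF rk_less[OF less(4) q(1) sq q(2)] q(6) this pd(1)]
    obtain c where c: "c \<in> corner (s - q)" "?b = adj c * c" by blast
    have "q * (s - q) = 0" using pd qq by (simp add: algebra_simps)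
    moreover have "(s - q) * c = c" using c by (simp add: corner_def)
    ultimately have qc: "q * c = 0" by (metis mult.assoc mult_zero_left)
    have cq: "adj c * q = 0" using arg_cong[OF qc, of adj] by (simp add: qq)
    have "complex_of_real (sqrt l) * complex_of_real (sqrt l) = complex_of_real l" using q(3) unfolding of_real_mult[symmetric] by simp
    then have "b = adj (complex_of_real (sqrt l) \<star> q + c) * (complex_of_real (sqrt l) \<star> q + c)"
      using c(2) by (simp add: algebra_simps qq qc cq)
    moreover have "s - q \<in> corner s" using less(4) sq pd by (simp add: corner_def proj_def algebra_simps)
    then have "c \<in> corner s" using c(1) corner_diff_trans by blast
    then have "complex_of_real (sqrt l) \<star> q + c \<in> corner s" using sq pd by (simp add: corner_def algebra_simps)
    ultimately show ?thesis by blast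
  qed
qed

lemma pos_sqrt: "pos b \<Longrightarrow> \<exists>c. b = adj c * c"
  using pos_sqrt_corner proj_idm ex_corner_idm by metis

section \<open>Matrix units\<close>

text \<open>The partial isometries \<open>v k i\<close> have initial projection \<open>p k\<close>, minimal in \<open>A\<close>; the elements
  \<open>v k i * adj (v k j)\<close> are the matrix units of the \<open>k\<close>-th block.\<close>

definition mat_units :: "fmat set \<Rightarrow> fmat \<Rightarrow> nat \<Rightarrow> (nat \<Rightarrow> nat) \<Rightarrow> (nat \<Rightarrow> fmat) \<Rightarrow> (nat \<Rightarrow> nat \<Rightarrow> fmat) \<Rightarrow> bool" where
  "mat_units A s K n p v \<longleftrightarrow>
     (\<forall>k<K. n k \<ge> 1 \<and> p k \<in> A \<and> proj (p k) \<and> p k \<noteq> 0 \<and> (\<forall>i<n k. v k i \<in> A)) \<and>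
     (\<forall>k<K. \<forall>l<K. \<forall>i<n k. \<forall>j<n l. adj (v k i) * v l j = (if k = l \<and> i = j then p k else 0)) \<and>
     (\<forall>k<K. \<forall>l<K. \<forall>a\<in>A. \<exists>c. p k * a * p l = (if k = l then c \<star> p k else 0)) \<and>
     (\<Sum>k<K. \<Sum>i<n k. v k i * adj (v k i)) = s"

definition min_proj :: "fmat set \<Rightarrow> fmat \<Rightarrow> bool" where
  "min_proj A q \<longleftrightarrow> q \<in> A \<and> proj q \<and> q \<noteq> 0 \<and> (\<forall>a\<in>A. \<exists>c. q * a * q = c \<star> q)"

text \<open>If all selfadjoint elements compress to scalars under \<open>s\<close>, so do all
  elements, by real and imaginary parts, and \<open>s\<close> is minimal. Otherwise some
  \<open>s * a * s\<close> is not scalar, and its spectral projection lies strictly below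
  \<open>s\<close>.\<close>

lemma min_proj_exists:
  assumes A: "star_alg A" "A \<subseteq> corner (idm d)" and s: "proj s" "s \<in> A" "s \<noteq> 0"
  shows "\<exists>q. min_proj A q \<and> s * q = q"
  using s
proof (induction "rk s" arbitrary: s rule: less_induct)
  case less
  have ss: "s * s = s" "adj s = s" using less by (auto simp: proj_def)
  show ?case
  proof (cases "\<forall>a\<in>A. adj a = a \<longrightarrow> (\<exists>c. s * a * s = c \<star> s)")
    case True
    have "\<exists>c. s * a * s = c \<star> s" if "a \<in> A" for a
    proof -
      have 1: "a + adj a \<in> A" "\<i> \<star> (a - adj a) \<in> A" using that by (simp_all add: star_alg_simps[OF A(1)])
      have 2: "adj (a + adj a) = a + adj a" "adj (\<i> \<star> (a - adj a)) = \<i> \<star> (a - adj a)"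
        by (auto intro!: fmat_eqI simp: algebra_simps)
      obtain c c' where c: "s * (a + adj a) * s = c \<star> s" "s * (\<i> \<star> (a - adj a)) * s = c' \<star> s"
        using True 1 2 by metis
      have "(1/2) \<star> (a + adj a) - (\<i>/2) \<star> (\<i> \<star> (a - adj a)) = a" by (rule fmat_eqI) (simp add: algebra_simps)
      then have a: "a = (1/2) \<star> (a + adj a) - (\<i>/2) \<star> (\<i> \<star> (a - adj a))" by (rule sym)
      have "s * a * s = (1/2) \<star> (s * (a + adj a) * s) - (\<i>/2) \<star> (s * (\<i> \<star> (a - adj a)) * s)"
        by (subst a) (simp only: csc_mult right_diff_distrib left_diff_distrib)
      also have "\<dots> = (1/2 * c - \<i>/2 * c') \<star> s" unfolding c by (simp add: fmat.scale_left_diff_distrib)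
      finally show ?thesis by blast
    qed
    then show ?thesis using less ss by (intro exI[of _ s]) (auto simp: min_proj_def)
  next
    case False
    then obtain a where a: "a \<in> A" "adj a = a" "\<And>c. s * a * s \<noteq> c \<star> s" by blast
    define b where "b = s * a * s"
    have b: "b \<in> A" "adj b = b" "b \<noteq> 0" using a(3)[of 0]
      by (auto simp: b_def star_alg_simps[OF A(1)] a less ss mult.assoc)
    obtain q and l :: real where q: "proj q" "q \<in> A" "q \<noteq> 0" "l \<noteq> 0" "b * q = complex_of_real l \<star> q"
      using spectral_projection[OF A(1) b] A(2) b(1) by blast
    have "s * b = b" by (simp add: b_def ss mult.assoc[symmetric])
    then have "complex_of_real l \<star> (s * q) = complex_of_real l \<star> q"
      using q(5) by (metis csc_mult(2) mult.assoc)
    then have sq: "s * q = q" using q(4) by simp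
    note pd = proj_diff[OF less(2) q(1) sq]
    have "s \<noteq> q"
    proof
      assume "s = q"
      then have "b = complex_of_real l \<star> s" using q(1,5) by (simp add: b_def ss mult.assoc proj_def)
      then show False using a(3) by (simp add: b_def)
    qed
    then have sq0: "s - q \<noteq> 0" by simp
    have "s * (s - q) = s - q" using ss sq by (simp add: algebra_simps)
    from rk_less[OF less(2) pd(1) this sq0] have "rk q < rk s" by simp
    from less(1)[OF this q(1-3)] obtain r where "min_proj A r" "q * r = r" by blast
    then show ?thesis using sq by (metis mult.assoc)
  qed
qed

text \<open>\<open>w * adj w\<close> is a nonzero projection, which forces \<open>c * c = c\<close>
  and thus \<open>c = 1\<close>.\<close>

lemma isometry_final_projection:
  assumes "adj w * w = p" "proj p" "p \<noteq> 0" "w * adj w = c \<star> q" "proj q"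
  shows "w * adj w = q"
proof -
  have w: "w \<noteq> 0" using assms(1,3) by auto
  have "q \<noteq> 0" using assms(4) w times_adj_eq_0[of w] by auto
  moreover have "(c * c) \<star> q = c \<star> q" using proj_vec(1)[OF assms(1,2)] assms(4,5) by (simp add: proj_def)
  moreover have "c \<noteq> 0" using assms(4) w times_adj_eq_0[of w] by auto
  ultimately have "c = 1" by simp
  with assms(4) show ?thesis by simp
qed

text \<open>Split off a minimal projection \<open>q\<close> and take matrix units for
  \<open>s - q\<close>. Then \<open>q\<close> either is equivalent to some \<open>p m\<close>, which
  enlarges block \<open>m\<close> by one index, or is disconnected from all blocks and opens a new
  one.\<close>

lemma mat_units_exist:
  assumes A: "star_alg A" "A \<subseteq> corner (idm d)" and s: "proj s" "s \<in> A"
  shows "\<exists>K n p v. mat_units A s K n p v"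
  using s
proof (induction "rk s" arbitrary: s rule: less_induct)
  case less
  show ?case
  proof (cases "s = 0")
    case True
    then have "mat_units A s 0 n p v" for n p v by (simp add: mat_units_def)
    then show ?thesis by blast
  next
    case False
    have ss: "s * s = s" "adj s = s" using less by (auto simp: proj_def)
    obtain q where mq: "min_proj A q" and sq: "s * q = q" using min_proj_exists[OF A less(2,3) False] by blast
    have q: "q \<in> A" "proj q" "q \<noteq> 0" "q * q = q" "adj q = q" using mq by (auto simp: min_proj_def proj_def)
    note pd = proj_diff[OF less(2) q(2) sq]
    have "s - q \<in> A" using less q by (simp add: star_alg_simps[OF A(1)])
    from less(1)[OF rk_less[OF less(2) q(2) sq q(3)] pd(1) this] obtain K n p v where mu: "mat_units A (s - q) K n p v" by blast
    have v: "\<And>k. k < K \<Longrightarrow> n k \<ge> 1" "\<And>k. k < K \<Longrightarrow> p k \<in> A"  "\<And>k. k < K \<Longrightarrow> proj (p k)" "\<And>k. k < K \<Longrightarrow> p k \<noteq> 0"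
      "\<And>k i. k < K \<Longrightarrow> i < n k \<Longrightarrow> v k i \<in> A"
      "\<And>k l i j. k < K \<Longrightarrow> l < K \<Longrightarrow> i < n k \<Longrightarrow> j < n l \<Longrightarrow> adj (v k i) * v l j = (if k = l \<and> i = j then p k else 0)"
      and v3: "\<And>k l a. k < K \<Longrightarrow> l < K \<Longrightarrow> a \<in> A \<Longrightarrow> \<exists>c. p k * a * p l = (if k = l then c \<star> p k else 0)"
      and v4: "(\<Sum>k<K. \<Sum>i<n k. v k i * adj (v k i)) = s - q"
      using mu unfolding mat_units_def by blast+
    have vp: "v k i * p k = v k i" if "k < K" "i < n k" for k i
      using proj_vec(2)[OF v(6)[OF that(1,1) that(2,2)]] v(3)[OF that(1)] by simp
    have sv: "(s - q) * v k i = v k i" if ki: "k < K" "i < n k" for k i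
    proof -
      have "(s - q) * v k i = (\<Sum>l<K. \<Sum>j<n l. v l j * (adj (v l j) * v k i))"
        unfolding v4[symmetric] by (simp add: sum_distrib_right mult.assoc)
      also have "\<dots> = (\<Sum>l<K. \<Sum>j<n l. if l = k \<and> j = i then v k i else 0)"
        using ki vp by (intro sum.cong) (auto simp: v(6))
      also have "\<dots> = (\<Sum>l<K. if l = k then (\<Sum>j<n l. if j = i then v k i else 0) else 0)"
        by (intro sum.cong) auto
      also have "\<dots> = v k i" using ki by simp
      finally show ?thesis .
    qed
    have "q * (s - q) = 0" using pd q by (simp add: algebra_simps)
    then have qv: "q * v k i = 0" if "k < K" "i < n k" for k i
      using sv[OF that] by (metis mult.assoc mult_zero_left)
    show ?thesis
    proof (cases "\<exists>k<K. \<exists>a\<in>A. q * a * p k \<noteq> 0")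
      case True
      then obtain m a where m: "m < K" "a \<in> A" "q * a * p m \<noteq> 0" by blast
      \<comment> \<open>A nonzero element between \<open>q\<close> and \<open>p m\<close>:
        minimality on both sides makes it, after scaling, a partial isometry from \<open>p m\<close>
        onto \<open>q\<close>.\<close>
      define w where "w = q * a * p m"
      have wA: "w \<in> A" using m q v by (auto simp: w_def star_alg_simps[OF A(1)])
      obtain c where "p m * (adj a * q * a) * p m = c \<star> p m"
        using v3[of m m "adj a * q * a"] m q by (auto simp: star_alg_simps[OF A(1)])
      then have "adj w * w = c \<star> p m" using v(3)[OF m(1)] q by (simp add: w_def mult.assoc proj_def)
         (metis mult.assoc q(4))
      from normalize_isometry(1)[OF this _ v(3)[OF m(1)]] m(3) obtain t where t: "t \<noteq> 0" "adj (t \<star> w) * (t \<star> w) = p m"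
        by (auto simp: w_def)
      define u where "u = t \<star> w"
      have u: "u \<in> A" "adj u * u = p m" "q * u = u" using t wA q
        by (auto simp: u_def star_alg_simps[OF A(1)] w_def mult.assoc[symmetric])
      obtain c where "q * (u * adj u) * q = c \<star> q" using mq u by (metis min_proj_def star_alg_simps(3,4)[OF A(1)])
      moreover have "adj u * q = adj u" using u(3) q by (metis adj_mult)
      ultimately have uc: "u * adj u = c \<star> q" using u(3) by (metis mult.assoc)
      have uu: "u * adj u = q" by (rule isometry_final_projection[OF u(2) v(3,4)[OF m(1)] uc q(2)])
      have uv: "adj u * v k i = 0" "adj (v k i) * u = 0" if "k < K" "i < n k" for k i
      proof -
        show "adj u * v k i = 0" using qv[OF that] \<open>adj u * q = adj u\<close> by (metis mult.assoc mult_zero_right)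
        then show "adj (v k i) * u = 0" by (metis adj_mult adj_simps(1) adj_simps(5))
      qed
      define n' where "n' = n (m := Suc (n m))"
      define v' where "v' = (\<lambda>k i. if k = m \<and> i = n m then u else v k i)"
      have lt: "k < K \<Longrightarrow> i < n' k \<longleftrightarrow> (i < n k \<or> (k = m \<and> i = n m))" for k i by (auto simp: n'_def)
      have "(\<Sum>k<K. \<Sum>i<n' k. v' k i * adj (v' k i)) = (\<Sum>k<K. (\<Sum>i<n k. v k i * adj (v k i)) + (if k = m then q else 0))"
        by (intro sum.cong) (auto simp: n'_def v'_def uu)
      also have "\<dots> = s" using m(1) by (simp add: sum.distrib v4)
      finally have sum: "(\<Sum>k<K. \<Sum>i<n' k. v' k i * adj (v' k i)) = s" .
      have "mat_units A s K n' p v'"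
        unfolding mat_units_def
      proof (intro conjI sum)
        show "\<forall>k<K. 1 \<le> n' k \<and> p k \<in> A \<and> proj (p k) \<and> p k \<noteq> 0 \<and> (\<forall>i<n' k. v' k i \<in> A)"
          using v u lt by (auto simp: v'_def) (auto simp: n'_def)
        show "\<forall>k<K. \<forall>l<K. \<forall>i<n' k. \<forall>j<n' l. adj (v' k i) * v' l j = (if k = l \<and> i = j then p k else 0)"
          using v(6) uv u(2) m(1) by (auto simp: v'_def lt)
        show "\<forall>k<K. \<forall>l<K. \<forall>a\<in>A. \<exists>c. p k * a * p l = (if k = l then c \<star> p k else 0)"
          using v3 by blast
      qed
      then show ?thesis by blast
    next
      case False
      \<comment> \<open>No element of \<open>A\<close> links \<open>q\<close> to an existing block,
        so \<open>q\<close> becomes a block of size 1 with itself as partial isometry.\<close>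
      then have f: "q * a * p k = 0" if "k < K" "a \<in> A" for k a using that by blast
      have f': "p k * a * q = 0" if "k < K" "a \<in> A" for k a
      proof -
        have "adj (q * adj a * p k) = 0" using f[OF that(1), of "adj a"] that star_alg_simps(4)[OF A(1)] by simp
        then show ?thesis using q v(3)[OF that(1)] by (simp add: proj_def mult.assoc)
      qed
      have vq: "adj (v k i) * q = 0" if "k < K" "i < n k" for k i
        using arg_cong[OF qv[OF that], of adj] q by simp
      define n' where "n' = n (K := 1)"
      define p' where "p' = p (K := q)"
      define v' where "v' = (\<lambda>k i. if k = K then q else v k i)"
      have lt: "k < Suc K \<Longrightarrow> i < n' k \<longleftrightarrow> (k < K \<and> i < n k \<or> (k = K \<and> i = 0))" for k i by (auto simp: n'_def)
      have "(\<Sum>k<K. \<Sum>i<n' k. v' k i * adj (v' k i)) = (\<Sum>k<K. (\<Sum>i<n k. v k i * adj (v k i)))"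
        by (intro sum.cong) (auto simp: n'_def v'_def)
      then have sum: "(\<Sum>k<Suc K. \<Sum>i<n' k. v' k i * adj (v' k i)) = s"
        by (simp add: v4 n'_def v'_def q)
      have "mat_units A s (Suc K) n' p' v'"
        unfolding mat_units_def
      proof (intro conjI sum)
        show "\<forall>k<Suc K. 1 \<le> n' k \<and> p' k \<in> A \<and> proj (p' k) \<and> p' k \<noteq> 0 \<and> (\<forall>i<n' k. v' k i \<in> A)"
          using v q by (auto simp: v'_def n'_def p'_def less_Suc_eq)
        show "\<forall>k<Suc K. \<forall>l<Suc K. \<forall>i<n' k. \<forall>j<n' l. adj (v' k i) * v' l j = (if k = l \<and> i = j then p' k else 0)"
          using v(6) qv vq q by (auto simp: v'_def lt p'_def less_Suc_eq n'_def)
        have "\<exists>c. q * a * q = c \<star> q" if "a \<in> A" for a using mq that by (auto simp: min_proj_def)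
        moreover have "\<exists>c. p k * a * p k = c \<star> p k" if "k < K" "a \<in> A" for k a using v3[OF that(1,1,2)] by simp
        moreover have "p k * a * p l = 0" if "k < K" "l < K" "a \<in> A" "k \<noteq> l" for k l a using v3[OF that(1-3)] that(4) by simp
        ultimately show "\<forall>k<Suc K. \<forall>l<Suc K. \<forall>a\<in>A. \<exists>c. p' k * a * p' l = (if k = l then c \<star> p' k else 0)"
          using f f' by (auto simp: p'_def less_Suc_eq)
      qed
      then show ?thesis by blast
    qed
  qed
qed

section \<open>Automorphisms in terms of matrix units\<close>

definition unitary_coeffs :: "nat \<Rightarrow> (nat \<Rightarrow> nat \<Rightarrow> complex) \<Rightarrow> bool" where
  "unitary_coeffs n U \<longleftrightarrow> (\<forall>i<n. \<forall>j<n. (\<Sum>a<n. cnj (U a i) * U a j) = (if i = j then 1 else 0)) \<and>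
     (\<forall>i<n. \<forall>j<n. (\<Sum>a<n. U i a * cnj (U j a)) = (if i = j then 1 else 0))"

locale matrix_units =
  fixes A :: "fmat set" and e :: fmat and K :: nat and n :: "nat \<Rightarrow> nat" and p :: "nat \<Rightarrow> fmat" and v :: "nat \<Rightarrow> nat \<Rightarrow> fmat"
  assumes A: "star_alg A" and unit: "a \<in> A \<Longrightarrow> e * a = a" "a \<in> A \<Longrightarrow> a * e = a"
    and e: "proj e" "e \<in> A"
    and units: "mat_units A e K n p v"
begin

lemma units_simps:
  shows "k < K \<Longrightarrow> n k \<ge> 1" "k < K \<Longrightarrow> p k \<in> A" "k < K \<Longrightarrow> proj (p k)" "k < K \<Longrightarrow> p k \<noteq> 0"
    "k < K \<Longrightarrow> i < n k \<Longrightarrow> v k i \<in> A"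
    "k < K \<Longrightarrow> l < K \<Longrightarrow> i < n k \<Longrightarrow> j < n l \<Longrightarrow> adj (v k i) * v l j = (if k = l \<and> i = j then p k else 0)"
    "(\<Sum>k<K. \<Sum>i<n k. v k i * adj (v k i)) = e"
  and p_A_p: "k < K \<Longrightarrow> a \<in> A \<Longrightarrow> \<exists>c. p k * a * p k = c \<star> p k"
    "k < K \<Longrightarrow> l < K \<Longrightarrow> a \<in> A \<Longrightarrow> k \<noteq> l \<Longrightarrow> p k * a * p l = 0"
proof -
  note u = units[unfolded mat_units_def]
  note u1 = conjunct1[OF u] and u2 = conjunct1[OF conjunct2[OF u]]
    and u3 = conjunct1[OF conjunct2[OF conjunct2[OF u]]]
  show "k < K \<Longrightarrow> n k \<ge> 1" "k < K \<Longrightarrow> p k \<in> A" "k < K \<Longrightarrow> proj (p k)" "k < K \<Longrightarrow> p k \<noteq> 0"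
    "k < K \<Longrightarrow> i < n k \<Longrightarrow> v k i \<in> A" using u1 by simp_all
  show "k < K \<Longrightarrow> l < K \<Longrightarrow> i < n k \<Longrightarrow> j < n l \<Longrightarrow> adj (v k i) * v l j = (if k = l \<and> i = j then p k else 0)"
    using u2 by simp
  show "(\<Sum>k<K. \<Sum>i<n k. v k i * adj (v k i)) = e" using u by simp
  show "k < K \<Longrightarrow> a \<in> A \<Longrightarrow> \<exists>c. p k * a * p k = c \<star> p k" using u3[rule_format, of k k a] by simp
  show "k < K \<Longrightarrow> l < K \<Longrightarrow> a \<in> A \<Longrightarrow> k \<noteq> l \<Longrightarrow> p k * a * p l = 0" using u3[rule_format, of k l a] by simp
qed

lemma p_idem: "k < K \<Longrightarrow> p k * p k = p k" "k < K \<Longrightarrow> adj (p k) = p k"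
  using units_simps(3) by (auto simp: proj_def)

lemma v_p: "k < K \<Longrightarrow> i < n k \<Longrightarrow> v k i * p k = v k i"
  "k < K \<Longrightarrow> i < n k \<Longrightarrow> p k * adj (v k i) = adj (v k i)"
proof -
  assume k: "k < K" "i < n k"
  show 1: "v k i * p k = v k i" by (rule proj_vec(2)) (use k units_simps in auto)
  show "p k * adj (v k i) = adj (v k i)" using arg_cong[OF 1, of adj] p_idem[OF k(1)] by simp
qed

lemma coeff_exists:
  assumes "k < K" "i < n k" "j < n k" "a \<in> A"
  shows "\<exists>c. adj (v k i) * a * v k j = c \<star> p k"
proof -
  have "adj (v k i) * a * v k j = p k * (adj (v k i) * a * v k j) * p k"
    using assms by (simp add: mult.assoc v_p) (simp add: mult.assoc[symmetric] v_p)
  moreover have "adj (v k i) * a * v k j \<in> A" using assms units_simps by (simp add: star_alg_simps[OF A])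
  ultimately show ?thesis using p_A_p(1)[OF assms(1)] by metis
qed

lemma expand_left:
  assumes "e * x = x" shows "x = (\<Sum>k<K. \<Sum>i<n k. v k i * (adj (v k i) * x))"
  by (subst assms[symmetric], subst units_simps(7)[symmetric]) (simp add: sum_distrib_right mult.assoc)

text \<open>The right support \<open>p m\<close> confines \<open>x\<close> to block
  \<open>m\<close>, because elements of \<open>A\<close> between different blocks vanish.\<close>

lemma expand_block:
  assumes "x \<in> A" "m < K" "x * p m = x"
  shows "x = (\<Sum>i<n m. v m i * (adj (v m i) * x))"
proof -
  have "(\<Sum>i<n k. v k i * (adj (v k i) * x)) = 0" if "k < K" "k \<noteq> m" for k
  proof (intro sum.neutral ballI)
    fix i assume i: "i \<in> {..<n k}"
    have "adj (v k i) * x = p k * (adj (v k i) * x) * p m"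
      using assms i that by (simp add: mult.assoc) (simp add: mult.assoc[symmetric] v_p)
    also have "\<dots> = 0" using p_A_p(2)[of k m "adj (v k i) * x"] assms i that units_simps by (simp add: star_alg_simps[OF A])
    finally show "v k i * (adj (v k i) * x) = 0" by simp
  qed
  then have "(\<Sum>k<K. \<Sum>i<n k. v k i * (adj (v k i) * x)) = (\<Sum>k<K. if k = m then (\<Sum>i<n m. v m i * (adj (v m i) * x)) else 0)"
    by (intro sum.cong) auto
  then show ?thesis using expand_left[of x] unit(1)[OF assms(1)] assms(2) by simp
qed

text \<open>The images \<open>q k\<close> of the minimal projections are again minimal, so each is
  equivalent to one \<open>p (\<tau> k)\<close> through a partial isometry \<open>w k\<close>.
  Correcting \<open>\<alpha> (v k i)\<close> by \<open>w k\<close> gives a second system of partial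
  isometries with initial projection \<open>p (\<tau> k)\<close>; its expansion in the
  \<open>v (\<tau> k) j\<close> supplies the unitary.\<close>

lemma automorphism_form:
  assumes al: "lin \<alpha>" "\<And>a. a \<in> A \<Longrightarrow> \<alpha> a \<in> A" "\<And>a b. a \<in> A \<Longrightarrow> b \<in> A \<Longrightarrow> \<alpha> (a * b) = \<alpha> a * \<alpha> b"
    "\<And>a. a \<in> A \<Longrightarrow> \<alpha> (adj a) = adj (\<alpha> a)" "\<alpha> e = e" "\<And>a. a \<in> A \<Longrightarrow> \<alpha> a = 0 \<Longrightarrow> a = 0" "\<And>b. b \<in> A \<Longrightarrow> \<exists>a\<in>A. b = \<alpha> a"
  shows "\<exists>\<tau> U. \<tau> permutes {..<K} \<and> (\<forall>k<K. n (\<tau> k) = n k \<and> unitary_coeffs (n k) (U k) \<and>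
      (\<forall>i<n k. \<forall>j<n k. \<alpha> (v k i * adj (v k j)) = (\<Sum>a<n k. \<Sum>b<n k. (U k a i * cnj (U k b j)) \<star> (v (\<tau> k) a * adj (v (\<tau> k) b)))))"
proof -
  note us = units_simps and sA = star_alg_simps[OF A]
  define q where "q = (\<lambda>k. \<alpha> (p k))"
  have qk: "\<alpha> (p k) = q k" for k by (simp add: q_def)
  have q: "q k \<in> A" "proj (q k)" "q k \<noteq> 0" "q k * q k = q k" "adj (q k) = q k" if "k < K" for k
  proof -
    show "q k \<in> A" "q k \<noteq> 0" unfolding q_def using us(2,4)[OF that] al by auto
    show "q k * q k = q k" "adj (q k) = q k" unfolding q_def
      using us(2)[OF that] p_idem[OF that] by (metis al(3), metis al(4))
    then show "proj (q k)" by (simp add: proj_def)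
  qed
  have qAq: "\<exists>c. q k * a * q k = c \<star> q k" if "k < K" "a \<in> A" for k a
  proof -
    from al(7)[OF that(2)] obtain b where b: "b \<in> A" "a = \<alpha> b" by blast
    from p_A_p(1)[OF that(1) b(1)] obtain c where c: "p k * b * p k = c \<star> p k" by blast
    have "q k * a * q k = \<alpha> (p k * b * p k)" using b us(2)[OF that(1)] by (simp add: q_def al(3) sA)
    then show ?thesis using c lin_simps(2)[OF al(1)] by (auto simp: q_def)
  qed
  have qAq0: "q k * a * q l = 0" if "k < K" "l < K" "a \<in> A" "k \<noteq> l" for k l a
  proof -
    from al(7)[OF that(3)] obtain b where b: "b \<in> A" "a = \<alpha> b" by blast
    have "q k * a * q l = \<alpha> (p k * b * p l)" using b us(2)[OF that(1)] us(2)[OF that(2)] by (simp add: q_def al(3) sA)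
    then show ?thesis using p_A_p(2)[OF that(1,2) b(1) that(4)] lin_simps(3)[OF al(1)] by simp
  qed
  have "\<exists>l w. l < K \<and> w \<in> A \<and> adj w * w = p l \<and> w * adj w = q k" if k: "k < K" for k
  proof -
    \<comment> \<open>The final projections of the \<open>v l j\<close> add up to the unit
      \<open>e\<close>, so they cannot all be killed by \<open>q k\<close>.\<close>
    have "\<exists>l<K. \<exists>j<n l. q k * v l j \<noteq> 0"
    proof (rule ccontr)
      assume "\<not> ?thesis"
      then have "q k * e = 0"
        by (subst us(7)[symmetric]) (auto simp: sum_distrib_left mult.assoc[symmetric] intro!: sum.neutral)
      then show False using unit(2)[OF q(1)] q(3) k by simp
    qed
    then obtain l j where l: "l < K" "j < n l" "q k * v l j \<noteq> 0" by blast
    obtain c where "adj (v l j) * q k * v l j = c \<star> p l" using coeff_exists[OF l(1,2,2) q(1)[OF k]] by blast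
    then have "adj (q k * v l j) * (q k * v l j) = c \<star> p l" using q(4,5)[OF k] by (simp add: mult.assoc) (metis mult.assoc)
    from normalize_isometry(1)[OF this l(3) us(3)[OF l(1)]] obtain s where
      s: "adj (s \<star> (q k * v l j)) * (s \<star> (q k * v l j)) = p l" by blast
    define w where "w = s \<star> (q k * v l j)"
    have w: "w \<in> A" "adj w * w = p l" "q k * w = w"
      using s q(1,4)[OF k] us(5)[OF l(1,2)] by (auto simp: w_def sA mult.assoc[symmetric])
    obtain c where c: "q k * (w * adj w) * q k = c \<star> q k" using qAq[OF k] w by (metis sA(3,4))
    have "adj w * q k = adj w" using arg_cong[OF w(3), of adj] q(5)[OF k] by simp
    then have "w * adj w = c \<star> q k" using c w(3) by (metis mult.assoc)
    then have "w * adj w = q k" by (rule isometry_final_projection[OF w(2) us(3,4)[OF l(1)] _ q(2)[OF k]])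
    then show ?thesis using l w by blast
  qed
  then obtain t w where tw: "\<And>k. k < K \<Longrightarrow> t k < K" "\<And>k. k < K \<Longrightarrow> w k \<in> A" "\<And>k. k < K \<Longrightarrow> adj (w k) * w k = p (t k)"
     "\<And>k. k < K \<Longrightarrow> w k * adj (w k) = q k" by metis
  have wp: "w k * p (t k) = w k" if "k < K" for k by (rule proj_vec(2)[OF tw(3)[OF that] us(3)[OF tw(1)[OF that]]])
  have qw: "q k * w k = w k" "adj (w k) * q k = adj (w k)" if "k < K" for k
  proof -
    show 1: "q k * w k = w k" using wp[OF that] tw(3,4)[OF that] by (metis mult.assoc)
    show "adj (w k) * q k = adj (w k)" using arg_cong[OF 1, of adj] q[OF that] by simp
  qed
  \<comment> \<open>If \<open>t k = t l\<close>, then \<open>w k * adj (w l)\<close> is a nonzero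
    element between \<open>q k\<close> and \<open>q l\<close>, which for \<open>k \<noteq> l\<close>
    do not communicate.\<close>
  have t_inj: "k = l" if "k < K" "l < K" "t k = t l" for k l
  proof (rule ccontr)
    assume kl: "k \<noteq> l"
    have "w k * adj (w l) = q k * (w k * adj (w l)) * q l" using qw that by (metis mult.assoc)
    also have "\<dots> = 0" using qAq0[OF that(1,2) _ kl] tw(2) that by (simp add: sA)
    finally have "adj (w k) * (w k * adj (w l)) * w l = 0" by simp
    then have "p (t k) * p (t k) = 0" using tw(3)[OF that(1)] tw(3)[OF that(2)] that(3) by (metis mult.assoc)
    then show False using p_idem us(4) tw(1)[OF that(1)] by simp
  qed
  define \<tau> where "\<tau> = (\<lambda>k. if k < K then t k else k)"
  have \<tau>K: "\<tau> k < K" if "k < K" for k using tw(1) that by (simp add: \<tau>_def)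
  have \<tau>t: "\<tau> k = t k" if "k < K" for k using that by (simp add: \<tau>_def)
  have "inj_on \<tau> {..<K}" "\<tau> ` {..<K} \<subseteq> {..<K}" using t_inj tw(1) by (auto simp: inj_on_def \<tau>_def)
  then have "bij_betw \<tau> {..<K} {..<K}" by (simp add: bij_betw_def endo_inj_surj)
  then have perm: "\<tau> permutes {..<K}" by (rule bij_imp_permutes) (simp add: \<tau>_def)
  \<comment> \<open>Multiplying by \<open>w k\<close> changes the initial projection from
    \<open>q k\<close> to \<open>p (\<tau> k)\<close> without changing the products
    \<open>u k i * adj (u k j)\<close>, which remain the images of the matrix units.\<close>
  define u where "u = (\<lambda>k i. \<alpha> (v k i) * w k)"
  have uA: "u k i \<in> A" if "k < K" "i < n k" for k i using that us(5) tw(2) al(2) by (simp add: u_def sA)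
  have up: "u k i * p (\<tau> k) = u k i" if "k < K" for k i using wp[OF that] that by (simp add: u_def \<tau>_def mult.assoc)
  have uu: "adj (u k i) * u k j = (if i = j then p (\<tau> k) else 0)" if "k < K" "i < n k" "j < n k" for k i j
  proof -
    have "adj (u k i) * u k j = adj (w k) * \<alpha> (adj (v k i) * v k j) * w k"
      using that us(5) by (simp add: u_def mult.assoc al(3,4) sA)
    then show ?thesis using qw(2)[OF that(1)] tw(3)[OF that(1)] that
      by (simp add: us(6) qk lin_simps(3)[OF al(1)] \<tau>_def)
  qed
  have uu': "u k i * adj (u k j) = \<alpha> (v k i * adj (v k j))" if "k < K" "i < n k" "j < n k" for k i j
  proof -
    have "u k i * adj (u k j) = \<alpha> (v k i) * (w k * adj (w k)) * adj (\<alpha> (v k j))" by (simp add: u_def mult.assoc)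
    also have "\<dots> = \<alpha> (v k i * p k * adj (v k j))"
      using that us(2,5) tw(4) by (simp add: q_def al(3) sA al(4)[symmetric])
    finally show ?thesis using v_p that by simp
  qed
  have "\<exists>c. adj (v (\<tau> k) j) * u k i = c \<star> p (\<tau> k)" if "k < K" "i < n k" "j < n (\<tau> k)" for k j i
  proof -
    have "adj (v (\<tau> k) j) * u k i \<in> A" using that uA us \<tau>K by (simp add: sA)
    from p_A_p(1)[OF \<tau>K[OF that(1)] this]
    obtain c where "p (\<tau> k) * (adj (v (\<tau> k) j) * u k i) * p (\<tau> k) = c \<star> p (\<tau> k)" by blast
    then show ?thesis using up[OF that(1)] v_p(2)[OF \<tau>K[OF that(1)] that(3)] by (metis mult.assoc)
  qed
  note U_ex = this
  define U where "U = (\<lambda>k j i. SOME c. adj (v (\<tau> k) j) * u k i = c \<star> p (\<tau> k))"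
  have U: "adj (v (\<tau> k) j) * u k i = U k j i \<star> p (\<tau> k)" if "k < K" "i < n k" "j < n (\<tau> k)" for k i j
    unfolding U_def by (rule someI_ex[OF U_ex[OF that]])
  have u_exp: "u k i = (\<Sum>j<n (\<tau> k). U k j i \<star> v (\<tau> k) j)" if "k < K" "i < n k" for k i
  proof -
    have "u k i = (\<Sum>j<n (\<tau> k). v (\<tau> k) j * (adj (v (\<tau> k) j) * u k i))"
      by (rule expand_block[OF uA[OF that] \<tau>K[OF that(1)] up[OF that(1)]])
    also have "\<dots> = (\<Sum>j<n (\<tau> k). U k j i \<star> v (\<tau> k) j)"
      using that \<tau>K by (intro sum.cong) (auto simp: U v_p)
    finally show ?thesis .
  qed
  have ucol: "(\<Sum>a<n (\<tau> k). cnj (U k a i) * U k a j) = (if i = j then 1 else 0)" if "k < K" "i < n k" "j < n k" for k i j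
  proof -
    have "adj (u k i) * u k j = (\<Sum>a<n (\<tau> k). cnj (U k a i) \<star> (adj (v (\<tau> k) a) * u k j))"
      by (subst u_exp[OF that(1,2)]) (simp add: sum_distrib_right)
    also have "\<dots> = (\<Sum>a<n (\<tau> k). (cnj (U k a i) * U k a j) \<star> p (\<tau> k))"
      using that by (intro sum.cong) (auto simp: U)
    finally have "(\<Sum>a<n (\<tau> k). (cnj (U k a i) * U k a j)) \<star> p (\<tau> k) = (if i = j then 1 else 0) \<star> p (\<tau> k)"
      using uu[OF that] by (cases "i = j") (simp_all add: fmat.scale_sum_left)
    then show ?thesis using us(4)[OF \<tau>K[OF that(1)]] fmat.scale_right_imp_eq by blast
  qed
  \<comment> \<open>Since \<open>\<alpha> e = e\<close>, the final projections of all
    \<open>u l i\<close> add up to \<open>e\<close>, and only those with \<open>l = k\<close> meet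
    block \<open>\<tau> k\<close>. So the expansion can be inverted, which gives the row
    relations.\<close>
  have v_exp: "v (\<tau> k) j = (\<Sum>i<n k. cnj (U k j i) \<star> u k i)" if k: "k < K" "j < n (\<tau> k)" for k j
  proof -
    let ?x = "v (\<tau> k) j"
    have "\<alpha> (\<Sum>l<K. \<Sum>i<n l. v l i * adj (v l i)) = (\<Sum>l<K. \<Sum>i<n l. u l i * adj (u l i))"
      by (simp add: lin_simps(6)[OF al(1)] uu')
    then have "e = (\<Sum>l<K. \<Sum>i<n l. u l i * adj (u l i))" unfolding us(7) al(5) .
    then have "?x = (\<Sum>l<K. \<Sum>i<n l. u l i * adj (u l i)) * ?x" using unit(1)[OF us(5)[OF \<tau>K[OF k(1)] k(2)]] by simp
    also have "\<dots> = (\<Sum>l<K. if l = k then (\<Sum>i<n k. u k i * adj (u k i) * ?x) else 0)"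
      unfolding sum_distrib_right
    proof (intro sum.cong refl, simp, intro impI sum.neutral ballI)
      fix l i assume l: "l < K" "l \<noteq> k" "i \<in> {..<n l}"
      have x: "?x \<in> A" "?x * p (\<tau> k) = ?x" using us(5) v_p \<tau>K k by auto
      have ax: "adj (u l i) * ?x \<in> A" using x uA l by (simp add: sA)
      have "p (\<tau> l) * adj (u l i) = adj (u l i)" using arg_cong[OF up[OF l(1), of i], of adj] p_idem \<tau>K l by simp
      then have "adj (u l i) * ?x = p (\<tau> l) * (adj (u l i) * ?x) * p (\<tau> k)" using x(2) by (metis mult.assoc)
      also have "\<dots> = 0" using l k t_inj by (intro p_A_p(2)[OF \<tau>K \<tau>K ax]) (auto simp: \<tau>_def)
      finally show "u l i * adj (u l i) * ?x = 0" by (simp add: mult.assoc)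
    qed
    also have "\<dots> = (\<Sum>i<n k. u k i * adj (u k i) * ?x)" using k by simp
    also have "\<dots> = (\<Sum>i<n k. cnj (U k j i) \<star> u k i)"
    proof (intro sum.cong refl)
      fix i assume i: "i \<in> {..<n k}"
      have "adj (u k i) * ?x = adj (adj ?x * u k i)" by simp
      also have "\<dots> = cnj (U k j i) \<star> p (\<tau> k)" using U i k p_idem \<tau>K by simp
      finally show "u k i * adj (u k i) * ?x = cnj (U k j i) \<star> u k i" using up k by (simp add: mult.assoc)
    qed
    finally show ?thesis .
  qed
  have urow: "(\<Sum>a<n k. U k i a * cnj (U k j a)) = (if i = j then 1 else 0)" if "k < K" "i < n (\<tau> k)" "j < n (\<tau> k)" for k i j
  proof -
    have "adj (v (\<tau> k) i) * v (\<tau> k) j = (\<Sum>a<n k. cnj (U k j a) \<star> (adj (v (\<tau> k) i) * u k a))"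
      by (subst v_exp[OF that(1,3)]) (simp add: sum_distrib_left)
    also have "\<dots> = (\<Sum>a<n k. (U k i a * cnj (U k j a)) \<star> p (\<tau> k))"
      using that by (intro sum.cong) (auto simp: U mult.commute)
    finally have "(\<Sum>a<n k. (U k i a * cnj (U k j a))) \<star> p (\<tau> k) = (if i = j then 1 else 0) \<star> p (\<tau> k)"
      using us(6)[OF \<tau>K[OF that(1)] \<tau>K[OF that(1)] that(2,3)] by (cases "i = j") (simp_all add: fmat.scale_sum_left)
    then show ?thesis using us(4)[OF \<tau>K[OF that(1)]] fmat.scale_right_imp_eq by blast
  qed
  \<comment> \<open>The sum of the squared moduli of the entries of \<open>U k\<close>, computed by
    columns and by rows.\<close>
  have dim: "n (\<tau> k) = n k" if "k < K" for k
  proof -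
    have "of_nat (n k) = (\<Sum>i<n k. \<Sum>a<n (\<tau> k). cnj (U k a i) * U k a i)" using ucol that by simp
    also have "\<dots> = (\<Sum>a<n (\<tau> k). \<Sum>i<n k. U k a i * cnj (U k a i))" by (subst sum.swap) (simp add: mult.commute)
    also have "\<dots> = (of_nat (n (\<tau> k)) :: complex)" using urow that by simp
    finally show ?thesis by (metis of_nat_eq_iff)
  qed
  have fin: "\<alpha> (v k i * adj (v k j)) = (\<Sum>a<n k. \<Sum>b<n k. (U k a i * cnj (U k b j)) \<star> (v (\<tau> k) a * adj (v (\<tau> k) b)))"
    if "k < K" "i < n k" "j < n k" for k i j
    unfolding uu'[OF that, symmetric] u_exp[OF that(1,2)] u_exp[OF that(1,3)]
    by (simp add: sum_distrib_left sum_distrib_right dim that fmat.scale_sum_right mult.commute) (rule sum.swap)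
  show ?thesis
    by (intro exI[of _ \<tau>] exI[of _ U] conjI perm allI impI dim fin) (use ucol urow dim in \<open>auto simp: unitary_coeffs_def\<close>)
qed

end

section \<open>Schwarz maps\<close>

definition schw :: "(fmat \<Rightarrow> fmat) \<Rightarrow> bool" where
  "schw F \<longleftrightarrow> lin F \<and> (\<forall>x. F (adj x) = adj (F x)) \<and> (\<forall>x. pos (F (adj x * x) - adj (F x) * F x))"

lemma schwD: "schw F \<Longrightarrow> lin F" "schw F \<Longrightarrow> F (adj x) = adj (F x)" "schw F \<Longrightarrow> pos (F (adj x * x) - adj (F x) * F x)"
  by (auto simp: schw_def)

lemma schw_pos: assumes "schw F" "pos x" shows "pos (F x)"
proof -
  obtain c where c: "x = adj c * c" using pos_sqrt[OF assms(2)] by blast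
  from pos_add[OF schwD(3)[OF assms(1), of c] pos_adj_times[of "F c"]] show ?thesis by (simp add: c)
qed

lemma schw_comp: assumes "schw F" "schw G" shows "schw (\<lambda>x. F (G x))"
  unfolding schw_def
proof (intro conjI allI)
  show "lin (\<lambda>x. F (G x))" by (rule lin_comp[OF schwD(1)[OF assms(1)] schwD(1)[OF assms(2)]])
  fix x
  show "F (G (adj x)) = adj (F (G x))" using assms by (simp add: schwD(2))
  have "pos (F (G (adj x * x) - adj (G x) * G x))" by (rule schw_pos[OF assms(1) schwD(3)[OF assms(2)]])
  from pos_add[OF this schwD(3)[OF assms(1), of "G x"]]
  show "pos (F (G (adj x * x)) - adj (F (G x)) * F (G x))" by (simp add: lin_simps[OF schwD(1)[OF assms(1)]])
qed

lemma schw_compress: assumes "schw F" "proj e" shows "schw (\<lambda>x. e * F x * e)"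
  unfolding schw_def
proof (intro conjI allI)
  show "lin (\<lambda>x. e * F x * e)" by (rule lin_sandwich[OF schwD(1)[OF assms(1)]])
  fix x
  have e: "adj e = e" "e * e = e" using assms by (auto simp: proj_def)
  show "e * F (adj x) * e = adj (e * F x * e)" using assms e by (simp add: schwD(2) mult.assoc)
  let ?y = "F x * e"
  have 1: "pos (adj e * (F (adj x * x) - adj (F x) * F x) * e)" by (rule pos_conj[OF schwD(3)[OF assms(1)]])
  have ee: "e * (e * z) = e * z" for z using e by (metis mult.assoc)
  \<comment> \<open>The loss caused by compression is itself a square, that of the part of
    \<open>F x * e\<close> lying outside the range of \<open>e\<close>.\<close>
  have "adj e * (F (adj x * x) - adj (F x) * F x) * e + adj (?y - e * ?y) * (?y - e * ?y)
     = e * F (adj x * x) * e - adj (e * F x * e) * (e * F x * e)"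
    by (simp add: algebra_simps e ee)
  with pos_add[OF 1 pos_adj_times[of "?y - e * ?y"]]
  show "pos (e * F (adj x * x) * e - adj (e * F x * e) * (e * F x * e))" by simp
qed

text \<open>Polarisation with \<open>u + w\<close> and \<open>u + \<i> \<star> w\<close> makes the
  whole sesquilinear form vanish; it is then evaluated at \<open>x\<close> itself.\<close>

lemma form_zero:
  assumes "\<And>v. tr (adj v * x * v) = 0" shows "x = 0"
proof -
  have 0: "tr (adj u * x * w) = 0" for u w
  proof -
    have "tr (adj (u + w) * x * (u + w)) = 0" "tr (adj (u + \<i> \<star> w) * x * (u + \<i> \<star> w)) = 0" by (rule assms)+
    then have "tr (adj u * x * w) + tr (adj w * x * u) = 0" "\<i> * tr (adj u * x * w) - \<i> * tr (adj w * x * u) = 0"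
      using assms[of u] assms[of w] by (simp_all add: algebra_simps)
    then show ?thesis by (simp add: right_diff_distrib[symmetric] del: right_diff_distrib)
  qed
  obtain d where d: "x \<in> corner (idm d)" using ex_corner_idm by blast
  have "tr (adj (x * idm d) * (x * idm d)) = 0" using 0[of "x * idm d" "idm d"] by (simp add: mult.assoc)
  then have "x * idm d = 0" using tr_adj_times(3) by blast
  then show ?thesis using d by (simp add: corner_def)
qed

text \<open>The form \<open>D x y = F (adj x * y) - adj (F x) * F y\<close> is positive semidefinite, so \<open>D a a = 0\<close> forces \<open>D a b = 0\<close>.\<close>

lemma schw_mult:
  assumes F: "schw F" and a: "F (adj a * a) = adj (F a) * F a"
  shows "F (adj a * b) = adj (F a) * F b"
proof -
  note l = lin_simps[OF schwD(1)[OF F]]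
  define D where "D = (\<lambda>x y. F (adj x * y) - adj (F x) * F y)"
  have "tr (adj v * D a b * v) = 0" for v
  proof -
    define c where "c = tr (adj v * D a b * v)"
    define k where "k = Re (tr (adj v * D b b * v))"
    have k: "k \<ge> 0" using schwD(3)[OF F, of b] by (simp add: k_def D_def pos_def)
    have "D b a = adj (D a b)" by (simp add: D_def schwD(2)[OF F, symmetric])
    then have "adj v * D b a * v = adj (adj v * D a b * v)" by (simp add: mult.assoc)
    then have c': "tr (adj v * D b a * v) = cnj c" by (metis c_def tr_simps(6))
    have "0 \<le> 2 * Re (z * c) + (cmod z)\<^sup>2 * k" for z
    proof -
      have "D (a + z \<star> b) (a + z \<star> b) = D a a + z \<star> D a b + cnj z \<star> D b a + (z * cnj z) \<star> D b b"
        by (simp add: D_def l algebra_simps)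
      then have "D (a + z \<star> b) (a + z \<star> b) = z \<star> D a b + cnj z \<star> D b a + (z * cnj z) \<star> D b b"
        using a by (simp add: D_def)
      then have "tr (adj v * D (a + z \<star> b) (a + z \<star> b) * v) = z * c + cnj (z * c) + (z * cnj z) * tr (adj v * D b b * v)"
        by (simp add: distrib_left distrib_right c' c_def[symmetric])
      moreover have "Re (tr (adj v * D (a + z \<star> b) (a + z \<star> b) * v)) \<ge> 0"
        using schwD(3)[OF F, of "a + z \<star> b"] unfolding D_def pos_def by blast
      ultimately show ?thesis by (simp add: k_def complex_mult_cnj cmod_power2 mult_ac)
    qed
    note D_ge = this
    \<comment> \<open>In the inequality at \<open>a + z \<star> b\<close> the choice
      \<open>z = - t * cnj c\<close> makes the linear term negative. The optimal \<open>t\<close>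
      would be \<open>1 / k\<close>; the added 1 covers \<open>k = 0\<close>.\<close>
    define t where "t = 1 / (k + 1)"
    have "- complex_of_real t * cnj c * c = of_real (- t * (cmod c)\<^sup>2)"
      by (simp add: complex_norm_square[unfolded of_real_power] mult_ac)
    then have "Re (- complex_of_real t * cnj c * c) = - t * (cmod c)\<^sup>2" by (metis Re_complex_of_real)
    moreover have "cmod (- complex_of_real t * cnj c) = t * cmod c" using k by (simp add: norm_mult) (simp add: t_def)
    ultimately have "0 \<le> 2 * (- t * (cmod c)\<^sup>2) + (t * cmod c)\<^sup>2 * k"
      using D_ge[of "- complex_of_real t * cnj c"] by simp
    then have *: "0 \<le> - 2 * (cmod c)\<^sup>2 / (k+1) + (cmod c)\<^sup>2 * k / (k+1)\<^sup>2"
      by (simp add: t_def power_divide)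
    have "(cmod c)\<^sup>2 * k / (k+1)\<^sup>2 \<le> (cmod c)\<^sup>2 / (k+1)"
      using k by (simp add: divide_simps power2_eq_square mult_left_mono)
    with * have "(cmod c)\<^sup>2 / (k+1) \<le> 0" by (simp add: field_simps)
    then have "cmod c = 0" using k by (simp add: divide_le_0_iff)
    then show ?thesis by (simp add: c_def)
  qed
  then have "D a b = 0" by (rule form_zero)
  then show ?thesis by (simp add: D_def)
qed

section \<open>Entrywise limits\<close>

definition flim :: "(nat \<Rightarrow> fmat) \<Rightarrow> fmat \<Rightarrow> bool" where
  "flim X x \<longleftrightarrow> (\<forall>i j. (\<lambda>n. ent (X n) i j) \<longlonglongrightarrow> ent x i j)"

lemma flim_unique: "flim X x \<Longrightarrow> flim X y \<Longrightarrow> x = y"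
  unfolding flim_def by (intro fmat_eqI) (metis LIMSEQ_unique)

lemma flim_subseq: "flim X x \<Longrightarrow> strict_mono r \<Longrightarrow> flim (\<lambda>n. X (r n)) x"
  unfolding flim_def
proof (intro allI)
  fix i j assume "\<forall>i j. (\<lambda>n. ent (X n) i j) \<longlonglongrightarrow> ent x i j" "strict_mono r"
  then show "(\<lambda>n. ent (X (r n)) i j) \<longlonglongrightarrow> ent x i j"
    using LIMSEQ_subseq_LIMSEQ[of "\<lambda>n. ent (X n) i j" "ent x i j" r] by (simp add: o_def)
qed

lemma flim_const: "flim (\<lambda>n. x) x" by (simp add: flim_def)

lemma flim_intros:
  assumes "flim X x"
  shows "flim Y y \<Longrightarrow> flim (\<lambda>n. X n + Y n) (x + y)" "flim Y y \<Longrightarrow> flim (\<lambda>n. X n - Y n) (x - y)"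
    "flim (\<lambda>n. c \<star> X n) (c \<star> x)" "flim (\<lambda>n. adj (X n)) (adj x)"
  using assms by (auto simp: flim_def intro!: tendsto_intros)

lemma flim_corner: "flim X x \<Longrightarrow> (\<And>n. X n \<in> corner (idm d)) \<Longrightarrow> x \<in> corner (idm d)"
  unfolding flim_def corner_idm
proof (intro allI impI)
  fix i j assume l: "\<forall>i j. (\<lambda>n. ent (X n) i j) \<longlonglongrightarrow> ent x i j"
    and X: "\<And>n. \<forall>i j. d \<le> i \<or> d \<le> j \<longrightarrow> ent (X n) i j = 0" and ij: "d \<le> i \<or> d \<le> j"
  have "(\<lambda>n. ent (X n) i j) \<longlonglongrightarrow> ent x i j" using l by blast
  moreover have "(\<lambda>n. ent (X n) i j) = (\<lambda>n. 0)" using X ij by auto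
  ultimately show "ent x i j = 0" by (simp add: LIMSEQ_const_iff)
qed

text \<open>Entrywise convergence does not control the support; a common corner bounds the number of
  terms in every entry of the product.\<close>

lemma flim_times:
  assumes "flim X x" "flim Y y" "\<And>n. X n \<in> corner (idm d)"
  shows "flim (\<lambda>n. X n * Y n) (x * y)"
proof -
  have x: "x \<in> corner (idm d)" by (rule flim_corner) fact+
  have "ent (X n * Y n) i j = (\<Sum>k<d. ent (X n) i k * ent (Y n) k j)" for n i j
    by (rule ent_times) (use assms(3) in \<open>auto simp: corner_idm\<close>)
  moreover have "ent (x * y) i j = (\<Sum>k<d. ent x i k * ent y k j)" for i j
    by (rule ent_times) (use x in \<open>auto simp: corner_idm\<close>)
  ultimately show ?thesis using assms(1,2) by (auto simp: flim_def intro!: tendsto_intros)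
qed

lemma tr_times_corner:
  assumes "x \<in> corner (idm d)" shows "tr (x * w) = (\<Sum>i<d. \<Sum>j<d. ent x i j * ent w j i)"
  by (subst eu_expand[OF assms]) (simp add: sum_distrib_right tr_eu_times)

lemma flim_tr:
  assumes "flim X x" "\<And>n. X n \<in> corner (idm d)" shows "(\<lambda>n. tr (X n * w)) \<longlonglongrightarrow> tr (x * w)"
  unfolding tr_times_corner[OF assms(2)] tr_times_corner[OF flim_corner[OF assms]]
  using assms(1) by (auto simp: flim_def intro!: tendsto_intros)

lemma flim_tr_right:
  assumes "flim X x" "\<And>n. X n \<in> corner (idm d)" shows "(\<lambda>n. tr (w * X n)) \<longlonglongrightarrow> tr (w * x)"
  using flim_tr[OF assms, of w] by (simp add: tr_commute)

lemma flim_pos: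
  assumes "flim X x" "\<And>n. X n \<in> corner (idm d)" "\<And>n. pos (X n)" shows "pos x"
  unfolding pos_def
proof (intro conjI allI)
  have "flim (\<lambda>n. X n) (adj x)" using flim_intros(4)[OF assms(1)] assms(3) by (simp add: pos_def)
  then show "adj x = x" using assms(1) flim_unique by blast
  fix v
  have "(\<lambda>n. Re (tr (X n * (v * adj v)))) \<longlonglongrightarrow> Re (tr (x * (v * adj v)))"
    by (intro tendsto_Re flim_tr[OF assms(1,2)])
  moreover have "tr (adj v * y * v) = tr (y * (v * adj v))" for y by (metis mult.assoc tr_commute)
  moreover have "0 \<le> Re (tr (adj v * X n * v))" for n using assms(3) unfolding pos_def by blast
  ultimately show "0 \<le> Re (tr (adj v * x * v))"
    by (intro LIMSEQ_le_const[of "\<lambda>n. Re (tr (X n * (v * adj v)))"]) auto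
qed

text \<open>Unital Schwarz maps on the algebra of \<open>d \<times> d\<close> matrices, extended by \<open>F x = F (idm d * x * idm d)\<close>.\<close>

definition uschw :: "nat \<Rightarrow> (fmat \<Rightarrow> fmat) \<Rightarrow> bool" where
  "uschw d F \<longleftrightarrow> schw F \<and> F (idm d) = idm d \<and> (\<forall>x. F (idm d * x * idm d) = F x \<and> F x \<in> corner (idm d))"

lemma uschwD: "uschw d F \<Longrightarrow> schw F" "uschw d F \<Longrightarrow> F (idm d) = idm d" "uschw d F \<Longrightarrow> F (idm d * x * idm d) = F x"
  "uschw d F \<Longrightarrow> F x \<in> corner (idm d)" "uschw d F \<Longrightarrow> lin F"
  by (auto simp: uschw_def schw_def)

lemma uschw_comp: "uschw d F \<Longrightarrow> uschw d G \<Longrightarrow> uschw d (\<lambda>x. F (G x))"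
  by (simp add: uschw_def schw_comp)

lemma sandwich_idm_corner: "idm d * x * idm d \<in> corner (idm d)"
  by (auto simp: corner_idm ent_idm_times ent_times_idm)

text \<open>A map that sees only the \<open>d\<close> by \<open>d\<close> block is determined by its
  values on the \<open>eu i j\<close>. Pointwise limits of such maps are thereby finite sums of
  limits, which gives joint continuity in \<open>flim_apply\<close>.\<close>

lemma map_expand:
  assumes "lin F" "\<And>x. F (idm d * x * idm d) = F x"
  shows "F x = (\<Sum>i<d. \<Sum>j<d. ent x i j \<star> F (eu i j))"
proof -
  have "F x = F (idm d * x * idm d)" by (simp add: assms)
  also have "\<dots> = (\<Sum>i<d. \<Sum>j<d. ent (idm d * x * idm d) i j \<star> F (eu i j))"
    by (subst eu_expand[OF sandwich_idm_corner]) (simp add: lin_simps[OF assms(1)])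
  also have "\<dots> = (\<Sum>i<d. \<Sum>j<d. ent x i j \<star> F (eu i j))"
    by (intro sum.cong) (auto simp: ent_idm_times ent_times_idm)
  finally show ?thesis .
qed

lemma flim_apply:
  assumes F: "\<And>n. uschw d (F n)" "\<And>x. flim (\<lambda>n. F n x) (G x)" "lin G" "\<And>x. G (idm d * x * idm d) = G x" and X: "flim X x"
  shows "flim (\<lambda>n. F n (X n)) (G x)"
  unfolding map_expand[OF uschwD(5)[OF F(1)] uschwD(3)[OF F(1)], of _ "X _"] map_expand[OF F(3,4), of x]
  using F(2) X by (auto simp: flim_def intro!: tendsto_intros)

text \<open>For \<open>y = F (eu i j)\<close> the Schwarz inequality gives
  \<open>adj y * y \<le> F (eu j j) \<le> idm d\<close>, so every column of \<open>y\<close> has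
  norm at most 1.\<close>

lemma uschw_entry_le_1:
  assumes F: "uschw d F" and ij: "i < d" "j < d"
  shows "cmod (ent (F (eu i j)) k l) \<le> 1"
proof (cases "k < d \<and> l < d")
  case True
  define y where "y = F (eu i j)"
  have yc: "y \<in> corner (idm d)" using uschwD(4)[OF F] by (simp add: y_def)
  have "proj (idm d - eu j j)"
    by (rule proj_diff(1)) (use ij eu_corner[of j d j] in \<open>auto simp: corner_def proj_def eu_mult intro!: fmat_eqI simp: ent_idm_times ent_idm\<close>)
  then have "pos (F (idm d - eu j j))" using schw_pos[OF uschwD(1)[OF F]] proj_pos by blast
  then have "pos (idm d - F (eu j j))" using uschwD[OF F] by (simp add: lin_simps)
  moreover have "pos (F (adj (eu i j) * eu i j) - adj y * y)" unfolding y_def using schwD(3) uschwD(1)[OF F] by blast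
  ultimately have "pos (idm d - F (eu j j) + (F (eu j j) - adj y * y))" by (intro pos_add) (simp_all add: eu_mult)
  then have "pos (idm d - adj y * y)" by simp
  then have "0 \<le> Re (tr (adj (eu l 0) * (idm d - adj y * y) * eu l 0))" unfolding pos_def by blast
  also have "tr (adj (eu l 0) * (idm d - adj y * y) * eu l 0) = ent (idm d - adj y * y) l l"
    by (subst tr_rotate) (simp add: tr_rotate(1)[of "eu 0 l"] mult.assoc eu_mult tr_times_eu del: ent_minus ent_plus)
  also have "\<dots> = 1 - of_real (\<Sum>m<d. (cmod (ent y m l))\<^sup>2)"
  proof -
    have "ent (adj y * y) l l = (\<Sum>m<d. ent (adj y) l m * ent y m l)"
      by (rule ent_times) (use yc in \<open>auto simp: corner_idm\<close>)
    then show ?thesis using True by (simp add: ent_idm complex_norm_square[unfolded of_real_power] mult.commute)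
  qed
  finally have "(\<Sum>m<d. (cmod (ent y m l))\<^sup>2) \<le> 1" by simp
  moreover have "(cmod (ent y k l))\<^sup>2 \<le> (\<Sum>m<d. (cmod (ent y m l))\<^sup>2)" using True by (intro member_le_sum) auto
  ultimately have "(cmod (ent y k l))\<^sup>2 \<le> 1\<^sup>2" by simp
  then show ?thesis unfolding y_def by (rule power2_le_imp_le) simp
qed (use uschwD(4)[OF F, of "eu i j"] in \<open>auto simp: corner_idm\<close>)

lemma bounded_complex_subseq:
  fixes z :: "nat \<Rightarrow> complex"
  assumes "\<And>n. cmod (z n) \<le> 1"
  shows "\<exists>r l. strict_mono (r :: nat \<Rightarrow> nat) \<and> (\<lambda>n. z (r n)) \<longlonglongrightarrow> l"
proof -
  have real: "\<exists>r l. strict_mono (r :: nat \<Rightarrow> nat) \<and> (\<lambda>n. x (r n)) \<longlonglongrightarrow> l" if "\<And>n. \<bar>x n\<bar> \<le> 1" for x :: "nat \<Rightarrow> real"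
  proof -
    obtain r :: "nat \<Rightarrow> nat" where r: "strict_mono r" "monoseq (\<lambda>n. x (r n))" using seq_monosub[of x] by blast
    moreover have "Bseq (\<lambda>n. x (r n))" by (rule BseqI'[of _ 1]) (use that in simp)
    ultimately show ?thesis using Bseq_monoseq_convergent convergent_def by metis
  qed
  have "\<bar>Re (z n)\<bar> \<le> 1" for n using assms[of n] abs_Re_le_cmod[of "z n"] by linarith
  from real[of "\<lambda>n. Re (z n)", OF this] obtain r a where r: "strict_mono (r :: nat \<Rightarrow> nat)" "(\<lambda>n. Re (z (r n))) \<longlonglongrightarrow> a" by blast
  have "\<bar>Im (z (r n))\<bar> \<le> 1" for n using assms[of "r n"] abs_Im_le_cmod[of "z (r n)"] by linarith
  from real[of "\<lambda>n. Im (z (r n))", OF this] obtain s b where s: "strict_mono (s :: nat \<Rightarrow> nat)" "(\<lambda>n. Im (z (r (s n)))) \<longlonglongrightarrow> b" by blast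
  have "(\<lambda>n. Re (z (r (s n)))) \<longlonglongrightarrow> a" using LIMSEQ_subseq_LIMSEQ[OF r(2) s(1)] by (simp add: o_def)
  then have "(\<lambda>n. z (r (s n))) \<longlonglongrightarrow> Complex a b" using s(2) by (intro tendsto_complex_iff[THEN iffD2]) simp
  moreover have "strict_mono (r \<circ> s)" using r s strict_mono_o by blast
  ultimately show ?thesis by (intro exI[of _ "r \<circ> s"]) auto
qed

lemma finite_family_subseq:
  fixes b :: "nat \<Rightarrow> 'i \<Rightarrow> complex"
  assumes "finite I" "\<And>n i. i \<in> I \<Longrightarrow> cmod (b n i) \<le> 1"
  shows "\<exists>r l. strict_mono (r :: nat \<Rightarrow> nat) \<and> (\<forall>i\<in>I. (\<lambda>n. b (r n) i) \<longlonglongrightarrow> l i)"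
  using assms
proof (induction I rule: finite_induct)
  case empty
  show ?case by (intro exI[of _ id]) (auto simp: strict_mono_def)
next
  case (insert a I)
  then obtain r l where r: "strict_mono (r :: nat \<Rightarrow> nat)" "\<forall>i\<in>I. (\<lambda>n. b (r n) i) \<longlonglongrightarrow> l i" by auto
  have "cmod (b (r n) a) \<le> 1" for n using insert(4) by simp
  from bounded_complex_subseq[of "\<lambda>n. b (r n) a", OF this]
  obtain s c where s: "strict_mono (s :: nat \<Rightarrow> nat)" "(\<lambda>n. b (r (s n)) a) \<longlonglongrightarrow> c" by blast
  show ?case
  proof (intro exI[of _ "r \<circ> s"] exI[of _ "l (a := c)"] conjI ballI)
    show "strict_mono (r \<circ> s)" using r s strict_mono_o by blast
    fix i assume "i \<in> insert a I"
    then show "(\<lambda>n. b ((r \<circ> s) n) i) \<longlonglongrightarrow> (l (a := c)) i"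
      using r(2) s LIMSEQ_subseq_LIMSEQ[of "\<lambda>n. b (r n) i" "l i" s] by (auto simp: o_def)
  qed
qed

lemma corner_minus: "x \<in> corner s \<Longrightarrow> y \<in> corner s \<Longrightarrow> x - y \<in> corner s"
  by (simp add: corner_def algebra_simps)

lemma uschw_limit:
  assumes F: "\<And>n. uschw d (F n)" and G: "\<And>x. flim (\<lambda>n. F n x) (G x)"
  shows "uschw d G"
proof -
  have l: "lin G" unfolding lin_def
  proof (intro conjI allI)
    fix x y c
    have "flim (\<lambda>n. F n (x + y)) (G x + G y)"
      using flim_intros(1)[OF G G, of x y] by (simp add: lin_simps(1)[OF uschwD(5)[OF F]])
    then show "G (x + y) = G x + G y" by (rule flim_unique[OF G])
    have "flim (\<lambda>n. F n (c \<star> x)) (c \<star> G x)"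
      using flim_intros(3)[OF G, of c x] by (simp add: lin_simps(2)[OF uschwD(5)[OF F]])
    then show "G (c \<star> x) = c \<star> G x" by (rule flim_unique[OF G])
  qed
  moreover have ad: "G (adj x) = adj (G x)" for x
  proof -
    have "flim (\<lambda>n. F n (adj x)) (adj (G x))"
      using flim_intros(4)[OF G, of x] by (simp add: schwD(2)[OF uschwD(1)[OF F]])
    then show ?thesis by (rule flim_unique[OF G])
  qed
  moreover have "pos (G (adj x * x) - adj (G x) * G x)" for x
  proof (rule flim_pos)
    have c: "F n (adj x) \<in> corner (idm d)" for n using F uschwD(4) by blast
    have "flim (\<lambda>n. F n (adj x) * F n x) (G (adj x) * G x)" by (rule flim_times[OF G G c])
    then show "flim (\<lambda>n. F n (adj x * x) - adj (F n x) * F n x) (G (adj x * x) - adj (G x) * G x)"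
      using flim_intros(2)[OF G[of "adj x * x"]] by (simp add: ad schwD(2)[OF uschwD(1)[OF F]])
    show "F n (adj x * x) - adj (F n x) * F n x \<in> corner (idm d)" for n
      using corner_minus[OF uschwD(4)[OF F, of n "adj x * x"] corner_times[OF c uschwD(4)[OF F, of n x]]]
      by (simp add: schwD(2)[OF uschwD(1)[OF F]])
    show "pos (F n (adj x * x) - adj (F n x) * F n x)" for n using F schwD(3) uschwD(1) by blast
  qed
  moreover have "G (idm d) = idm d" using flim_unique[OF G[of "idm d"], of "idm d"] flim_const[of "idm d"] by (simp add: uschwD(2)[OF F])
  moreover have "G (idm d * x * idm d) = G x" for x using flim_unique[OF G[of "idm d * x * idm d"], of "G x"] G[of x] by (simp add: uschwD(3)[OF F])
  moreover have "G x \<in> corner (idm d)" for x by (rule flim_corner[OF G uschwD(4)[OF F]])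
  ultimately show ?thesis by (simp add: uschw_def schw_def)
qed

text \<open>One subsequence makes all d^4 entries of the values on the elementary matrices converge;
  linearity extends this to every argument.\<close>

lemma uschw_subseq:
  assumes F: "\<And>n. uschw d (F n)"
  shows "\<exists>r G. strict_mono (r :: nat \<Rightarrow> nat) \<and> uschw d G \<and> (\<forall>x. flim (\<lambda>n. F (r n) x) (G x))"
proof -
  let ?I = "{..<d} \<times> {..<d} \<times> {..<d} \<times> {..<d}"
  let ?b = "\<lambda>n (i,j,k,m). ent (F n (eu i j)) k m"
  have "cmod (?b n t) \<le> 1" if "t \<in> ?I" for n t using that uschw_entry_le_1[OF F] by (auto split: prod.split)
  from finite_family_subseq[of ?I ?b, OF _ this]
  obtain r l where r: "strict_mono (r :: nat \<Rightarrow> nat)" and l: "\<forall>t\<in>?I. (\<lambda>n. ?b (r n) t) \<longlonglongrightarrow> l t"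
    by auto
  define g where "g = (\<lambda>i j. \<Sum>k<d. \<Sum>m<d. l (i,j,k,m) \<star> eu k m)"
  have eg: "ent (g i j) k m = (if k < d \<and> m < d then l (i,j,k,m) else 0)" for i j k m
  proof -
    have "ent (g i j) k m = (\<Sum>a<d. \<Sum>b<d. if b = m \<and> a = k then l (i,j,k,m) else 0)"
      unfolding g_def ent_sum by (intro sum.cong) (auto simp: ent_eu)
    then show ?thesis by (auto simp: sum_delta2)
  qed
  have fg: "flim (\<lambda>n. F (r n) (eu i j)) (g i j)" if "i < d" "j < d" for i j
    unfolding flim_def
  proof (intro allI)
    fix k m
    show "(\<lambda>n. ent (F (r n) (eu i j)) k m) \<longlonglongrightarrow> ent (g i j) k m"
    proof (cases "k < d \<and> m < d")
      case True
      then show ?thesis using bspec[OF l, of "(i,j,k,m)"] that by (simp add: eg)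
    next
      case False
      then have "ent (F (r n) (eu i j)) k m = 0" for n using uschwD(4)[OF F, of "r n" "eu i j"] by (auto simp: corner_idm)
      moreover have "ent (g i j) k m = 0" using False by (auto simp: eg)
      ultimately show ?thesis by simp
    qed
  qed
  define G where "G = (\<lambda>x. \<Sum>i<d. \<Sum>j<d. ent x i j \<star> g i j)"
  have "flim (\<lambda>n. F (r n) x) (G x)" for x
    unfolding G_def map_expand[OF uschwD(5)[OF F] uschwD(3)[OF F], of _ x]
    using fg by (auto simp: flim_def intro!: tendsto_intros)
  then show ?thesis using r uschw_limit[of d "\<lambda>n. F (r n)" G] F by blast
qed

text \<open>The zeroth power is the compression to \<open>d \<times> d\<close> matrices.\<close>

definition pw :: "nat \<Rightarrow> (fmat \<Rightarrow> fmat) \<Rightarrow> nat \<Rightarrow> fmat \<Rightarrow> fmat" where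
  "pw d S n x = (S ^^ n) (idm d * x * idm d)"

lemma uschw_id: "uschw d (\<lambda>x. idm d * x * idm d)"
proof -
  have i: "idm d * idm d = idm d" "adj (idm d) = idm d" using proj_idm[of d] by (auto simp: proj_def)
  have "schw (\<lambda>x. x)" by (simp add: schw_def lin_def)
  from schw_compress[OF this proj_idm] show ?thesis
    by (simp add: uschw_def sandwich_idm_corner i) (metis i(1) mult.assoc)
qed

lemma uschw_pw: "uschw d S \<Longrightarrow> uschw d (pw d S n)"
proof (induction n)
  case 0
  then show ?case using uschw_id by (simp add: pw_def[abs_def])
next
  case (Suc n)
  from uschw_comp[OF Suc(2) Suc(1)[OF Suc(2)]] show ?case by (simp add: pw_def[abs_def])
qed

lemma pw_add: "uschw d S \<Longrightarrow> pw d S (m + n) x = pw d S m (pw d S n x)"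
proof -
  assume S: "uschw d S"
  have "pw d S n x \<in> corner (idm d)" using uschwD(4)[OF uschw_pw[OF S]] .
  then have "idm d * pw d S n x * idm d = pw d S n x" by (simp add: corner_def)
  then show ?thesis by (simp add: pw_def funpow_add)
qed

lemma pw_1: "uschw d S \<Longrightarrow> pw d S (Suc 0) x = S x" by (simp add: pw_def uschwD(3))

text \<open>With \<open>L = lim S\<^bsup>r n\<^esup>\<close> and \<open>M = lim S\<^bsup>r (k n) - 2 r n\<^esup>\<close> one has \<open>M \<circ> L \<circ> L = L\<close>, so \<open>M \<circ> L\<close> is idempotent.\<close>

lemma idempotent_limit:
  assumes S: "uschw d S"
  obtains Q N q where "uschw d Q" "uschw d N" "\<And>x. Q (Q x) = Q x" "\<And>x. S (Q x) = Q (S x)" "\<And>x. N (Q x) = Q (N x)"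
    "\<And>x. S (N x) = Q x" "\<And>x. N (S x) = Q x" "\<And>m. m \<le> q m" "\<And>x. flim (\<lambda>m. pw d S (q m) x) (Q x)"
proof -
  let ?p = "pw d S"
  note up = uschw_pw[OF S]
  obtain r L where r: "strict_mono (r :: nat \<Rightarrow> nat)" and L: "uschw d L" "\<And>x. flim (\<lambda>n. ?p (r n) x) (L x)"
    using uschw_subseq[of d ?p] up by blast
  \<comment> \<open>The exponent \<open>r (k n)\<close> must exceed \<open>2 * r n\<close> by at
    least \<open>n + 1\<close>; this keeps the difference \<open>m n\<close> a genuine subtraction
    and makes it tend to infinity.\<close>
  define k where "k = (\<lambda>n. 2 * r n + n + 1)"
  define m where "m = (\<lambda>n. r (k n) - 2 * r n)"
  have rge: "n \<le> r n" for n using r seq_suble by blast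
  have m: "n + 1 \<le> m n" "r (k n) = m n + (r n + r n)" for n
    using rge[of "k n"] by (auto simp: m_def k_def)
  have ksm: "strict_mono k" using r by (auto simp: strict_mono_def k_def add_less_mono)
  obtain u M where u: "strict_mono (u :: nat \<Rightarrow> nat)" and M: "uschw d M" "\<And>x. flim (\<lambda>n. ?p (m (u n)) x) (M x)"
    using uschw_subseq[of d "\<lambda>n. ?p (m n)"] up by blast
  note Lu = flim_subseq[OF L(2) u]
  note ap = flim_apply[OF up]
  note L1 = ap[OF Lu uschwD(5)[OF L(1)] uschwD(3)[OF L(1)]] and M1 = ap[OF M(2) uschwD(5)[OF M(1)] uschwD(3)[OF M(1)]]
  have LLM: "M (L (L x)) = L x" for x
  proof (rule flim_unique)
    show "flim (\<lambda>n. ?p (m (u n)) (?p (r (u n)) (?p (r (u n)) x))) (M (L (L x)))"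
      by (rule M1[OF L1[OF Lu]])
    have "?p (m (u n)) (?p (r (u n)) (?p (r (u n)) x)) = ?p (r (k (u n))) x" for n
      by (simp add: m(2) pw_add[OF S])
    then show "flim (\<lambda>n. ?p (m (u n)) (?p (r (u n)) (?p (r (u n)) x))) (L x)"
      using flim_subseq[OF flim_subseq[OF L(2) ksm] u] by simp
  qed
  have q: "flim (\<lambda>n. ?p (m (u n) + r (u n)) x) (M (L x))" for x
    using M1[OF Lu] by (simp add: pw_add[OF S])
  have "?p (m (u n) + r (u n)) x = ?p (r (u n)) (?p (m (u n)) x)" for n x
    using pw_add[OF S, of "r (u n)" "m (u n)" x] by (simp add: add.commute)
  then have "flim (\<lambda>n. ?p (m (u n) + r (u n)) x) (L (M x))" for x
    using L1[OF M(2)] by simp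
  then have LM: "M (L x) = L (M x)" for x by (rule flim_unique[OF q])
  define Q where "Q = (\<lambda>x. M (L x))"
  define q where "q = (\<lambda>n. m (u n) + r (u n))"
  have qge: "n + 1 \<le> q n" for n using m(1)[of "u n"] seq_suble[OF u, of n] by (simp add: q_def)
  have Q: "uschw d Q" unfolding Q_def using uschw_comp L(1) M(1) by blast
  have QQ: "Q (Q x) = Q x" for x unfolding Q_def by (metis LM LLM)
  have Qlim: "flim (\<lambda>n. ?p (q n) x) (Q x)" for x using q by (simp add: Q_def q_def)
  \<comment> \<open>One power short of \<open>Q\<close>: composing the limit with \<open>S\<close>
    on either side gives \<open>Q\<close>. The bound \<open>q n \<ge> n + 1\<close> makes the
    predecessor harmless.\<close>
  obtain s N where s: "strict_mono (s :: nat \<Rightarrow> nat)" and N: "uschw d N" "\<And>x. flim (\<lambda>n. ?p (q (s n) - 1) x) (N x)"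
    using uschw_subseq[of d "\<lambda>n. ?p (q n - 1)"] up by blast
  have Sc: "flim (\<lambda>n. S (X n)) (S x)" if "flim X x" for X x
    by (rule flim_apply[OF S flim_const uschwD(5)[OF S] uschwD(3)[OF S] that])
  have Qc: "flim (\<lambda>n. Q (X n)) (Q x)" if "flim X x" for X x
    by (rule flim_apply[OF Q flim_const uschwD(5)[OF Q] uschwD(3)[OF Q] that])
  have Sp: "S (?p n x) = ?p (Suc n) x" "?p n (S x) = ?p (Suc n) x" for n x
    using pw_add[OF S, of 1 n] pw_add[OF S, of n 1] by (simp_all add: pw_1[OF S])
  have SQ: "S (Q x) = Q (S x)" for x
    using flim_unique[OF Sc[OF Qlim, of x]] Qlim[of "S x"] by (simp add: Sp)
  have pQ: "?p n (Q x) = Q (?p n x)" for n x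
  proof (induction n)
    case 0
    have "Q x \<in> corner (idm d)" using uschwD(4)[OF Q] .
    then show ?case using uschwD(3)[OF Q] by (simp add: pw_def corner_def)
  next
    case (Suc n)
    then show ?case by (simp add: Sp(1)[symmetric] SQ)
  qed
  have s1: "Suc (q (s n) - 1) = q (s n)" for n using qge[of "s n"] by simp
  show ?thesis
  proof (rule that[OF Q N(1) QQ SQ _ _ _ _ Qlim])
    show "N (Q x) = Q (N x)" for x
      using flim_unique[OF N(2)[of "Q x"]] Qc[OF N(2), of x] by (simp add: pQ)
    show "S (N x) = Q x" for x
      using flim_unique[OF Sc[OF N(2), of x]] flim_subseq[OF Qlim s, of x] by (simp only: Sp s1)
    show "N (S x) = Q x" for x
      using flim_unique[OF N(2)[of "S x"]] flim_subseq[OF Qlim s, of x] by (simp only: Sp s1)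
    show "m \<le> q m" for m using qge[of m] by simp
  qed
qed

lemma dual_exists:
  assumes "uschw d F"
  obtains G where "lin G" "\<And>x y. tr (G x * y) = tr (x * F y)" "\<And>x. G x \<in> corner (idm d)"
proof -
  \<comment> \<open>Pairing \<open>G x\<close> with \<open>eu i j\<close> reads off its entry
    \<open>(j, i)\<close>, so these coefficients are forced.\<close>
  define G where "G = (\<lambda>x. \<Sum>i<d. \<Sum>j<d. tr (x * F (eu i j)) \<star> eu j i)"
  have G: "tr (G x * y) = tr (x * F y)" for x y
    by (subst map_expand[OF uschwD(5)[OF assms] uschwD(3)[OF assms], of y])
       (simp add: G_def sum_distrib_left sum_distrib_right tr_eu_times mult.commute)
  have "lin G" unfolding lin_def
    by (intro conjI allI; rule tr_nondeg) (simp_all add: G algebra_simps)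
  moreover have "G x \<in> corner (idm d)" for x
    using eu_corner by (auto simp: corner_idm G_def ent_eu intro!: sum.neutral)
  ultimately show ?thesis using G that by blast
qed

section \<open>The asymptotic projection\<close>

text \<open>Here \<open>S\<close> is the adjoint of \<open>T\<close>, \<open>Q\<close> is the limit of \<open>S\<^bsup>q m\<^esup>\<close>, \<open>N\<close> inverts \<open>S\<close> on the range of \<open>Q\<close>,
  and \<open>P\<close> is the adjoint of \<open>Q\<close>.\<close>

locale asymptotic =
  fixes d :: nat and S T Q N P :: "fmat \<Rightarrow> fmat" and q :: "nat \<Rightarrow> nat"
  assumes S: "uschw d S" and T: "lin T" "\<And>x y. tr (T x * y) = tr (x * S y)" "\<And>x. T x \<in> corner (idm d)"
    and Q: "uschw d Q" "\<And>x. Q (Q x) = Q x" "\<And>x. S (Q x) = Q (S x)"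
    and N: "uschw d N" "\<And>x. N (Q x) = Q (N x)" "\<And>x. S (N x) = Q x" "\<And>x. N (S x) = Q x"
    and q: "\<And>m. m \<le> q m" "\<And>x. flim (\<lambda>m. pw d S (q m) x) (Q x)"
    and P: "lin P" "\<And>x y. tr (P x * y) = tr (x * Q y)" "\<And>x. P x \<in> corner (idm d)"
begin

lemma P_P: "P (P x) = P x"
  by (rule tr_nondeg) (simp add: P(2) Q(2))

lemma T_P: "T (P x) = P (T x)"
  by (rule tr_nondeg) (simp add: P(2) T(2) Q(3))

lemma P_adj: "P (adj x) = adj (P x)"
proof (rule tr_nondeg)
  fix y
  have "tr (adj (P x) * y) = cnj (tr (P x * adj y))" by (subst tr_simps(6)[symmetric]) (simp add: tr_commute)
  also have "\<dots> = tr (adj x * Q y)"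
    unfolding P(2) schwD(2)[OF uschwD(1)[OF Q(1)]] by (subst tr_simps(6)[symmetric]) (simp add: tr_commute)
  finally show "tr (P (adj x) * y) = tr (adj (P x) * y)" by (simp add: P(2))
qed

text \<open>\<open>P (idm d)\<close> is the density of the functional
  \<open>x \<mapsto> tr (Q x)\<close>; a positive \<open>x\<close> is null for it exactly when
  \<open>Q x = 0\<close>.\<close>

lemma tr_PI: "tr (P (idm d) * x) = tr (Q x)"
proof -
  have "Q x \<in> corner (idm d)" using uschwD(4)[OF Q(1)] .
  then show ?thesis by (simp add: P(2) corner_def)
qed

text \<open>At \<open>g\<close> the Schwarz inequality is the equality \<open>0 = 0\<close>, so
  \<open>schw_mult\<close> makes \<open>Q\<close> vanish on all multiples of \<open>g\<close>; the
  statements on \<open>P\<close> are dual.\<close>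

lemma Q_null_proj:
  assumes g: "proj g" "Q g = 0"
  shows "Q (g * b) = 0" "Q (b * g) = 0" "P y * g = 0" "g * P y = 0"
proof -
  have gg: "adj g = g" "g * g = g" using g by (auto simp: proj_def)
  have 1: "Q (g * b) = 0" for b
    using schw_mult[OF uschwD(1)[OF Q(1)], of g b] by (simp add: gg g)
  then show "Q (g * b) = 0" .
  have 2: "Q (b * g) = 0" for b
    using arg_cong[OF 1[of "adj b"], of adj] by (simp add: schwD(2)[OF uschwD(1)[OF Q(1)], symmetric] gg)
  then show "Q (b * g) = 0" .
  show "P y * g = 0" by (rule tr_nondeg) (simp add: mult.assoc P(2) 1)
  show "g * P y = 0"
  proof (rule tr_nondeg)
    fix b show "tr (g * P y * b) = tr (0 * b)"
      by (subst mult.assoc, subst tr_rotate(2)) (simp add: P(2) 2)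
  qed
qed

text \<open>Take \<open>e\<close> of least rank among the projections with
  \<open>P (idm d) * e = P (idm d)\<close>. If a nonzero positive \<open>b\<close> under
  \<open>e\<close> were null, so would be a spectral projection \<open>h\<close> of it, and
  \<open>e - h\<close> would contradict minimality.\<close>

lemma support_projection:
  obtains e where "proj e" "e \<in> corner (idm d)" "\<And>y. e * P y = P y" "\<And>y. P y * e = P y" "Q (idm d - e) = 0"
    "\<And>b. pos b \<Longrightarrow> b \<in> corner e \<Longrightarrow> tr (P (idm d) * b) = 0 \<Longrightarrow> b = 0"
proof -
  let ?I = "idm d"
  have PI: "P x * ?I = P x" "?I * P x = P x" for x using P(3)[of x] by (auto simp: corner_def)
  have II: "?I * ?I = ?I" "adj ?I = ?I" using proj_idm[of d] by (auto simp: proj_def)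
  let ?E = "\<lambda>e. proj e \<and> e \<in> corner ?I \<and> P ?I * e = P ?I"
  have "?E ?I" by (simp add: PI II corner_def)
  then obtain e where e: "?E e" and min: "\<And>f. ?E f \<Longrightarrow> rk e \<le> rk f"
    using ex_has_least_nat[of ?E _ rk] by blast
  define g where "g = ?I - e"
  have g: "proj g" unfolding g_def by (rule proj_diff) (use e in \<open>auto simp: corner_def\<close>)
  have "pos (Q g)" using schw_pos[OF uschwD(1)[OF Q(1)] proj_pos[OF g]] .
  moreover have "tr (Q g) = 0" unfolding tr_PI[symmetric] g_def using e by (simp add: right_diff_distrib PI)
  ultimately have Qg: "Q g = 0" using pos_tr(2) by simp
  note null = Q_null_proj[OF g Qg]
  show ?thesis
  proof (rule that[of e])
    show "proj e" "e \<in> corner ?I" using e by auto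
    show "e * P y = P y" "P y * e = P y" for y
      using null(3,4)[of y] PI[of y] by (simp_all add: g_def algebra_simps)
    show "Q (?I - e) = 0" using Qg by (simp add: g_def)
    fix b assume b: "pos b" "b \<in> corner e" "tr (P ?I * b) = 0"
    show "b = 0"
    proof (rule ccontr)
      assume "b \<noteq> 0"
      from pos_spectral_projection[OF b(1) this] obtain h and l :: real where
        h: "proj h" "h \<noteq> 0" "l > 0" "b * h = complex_of_real l \<star> h" "h * b = complex_of_real l \<star> h"
           "pos (b - complex_of_real l \<star> h)" by blast
      have "e * b = b" using b by (simp add: corner_def)
      then have "complex_of_real l \<star> (e * h) = complex_of_real l \<star> h"
        using h(4) by (metis csc_mult(2) mult.assoc)
      then have eh: "e * h = h" using h(3) by simp
      note pd = proj_diff[OF conjunct1[OF e] h(1) eh]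
      have "0 \<le> Re (tr (Q (b - complex_of_real l \<star> h)))" "0 \<le> Re (tr (Q h))"
        using pos_tr(1) schw_pos[OF uschwD(1)[OF Q(1)]] h(6) proj_pos[OF h(1)] by blast+
      moreover have "tr (Q b) = 0" using b(3) by (simp add: tr_PI)
      ultimately have "Re (tr (Q h)) = 0" using h(3)
        by (simp add: lin_simps[OF uschwD(5)[OF Q(1)]] mult_le_0_iff)
      then have Qh: "Q h = 0" using pos_tr(2) schw_pos[OF uschwD(1)[OF Q(1)] proj_pos[OF h(1)]] by blast
      have "P ?I * h = 0" by (rule Q_null_proj(3)[OF h(1) Qh])
      then have "?E (e - h)" using e pd eh by (auto simp: corner_def algebra_simps) (metis mult.assoc)+
      from min[OF this] rk_less[OF conjunct1[OF e] h(1) eh h(2)] show False by simp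
    qed
  qed
qed

section \<open>The peripheral spectrum of the map \<open>T\<close>\<close>

lemma T_funpow_corner: "x \<in> corner (idm d) \<Longrightarrow> (T ^^ n) x \<in> corner (idm d)"
  by (cases n) (auto simp: T(3))

lemma tr_T_funpow: "tr ((T ^^ n) x * y) = tr (x * (S ^^ n) y)"
  by (induction n arbitrary: y) (simp_all add: T(2) funpow_swap1[of S])

lemma tr_T_funpow_pw:
  assumes "x \<in> corner (idm d)" shows "tr ((T ^^ n) x * y) = tr (x * pw d S n y)"
proof -
  have c: "idm d * (T ^^ n) x = (T ^^ n) x" "(T ^^ n) x * idm d = (T ^^ n) x" using T_funpow_corner[OF assms] by (auto simp: corner_def)
  have "tr (x * pw d S n y) = tr ((T ^^ n) x * (idm d * y * idm d))" by (simp add: pw_def tr_T_funpow)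
  also have "\<dots> = tr ((T ^^ n) x * idm d * y * idm d)" by (simp add: mult.assoc)
  also have "\<dots> = tr (idm d * (T ^^ n) x * idm d * y)" by (metis mult.assoc tr_commute)
  finally show ?thesis by (simp add: c)
qed

lemma T_limit:
  assumes "x \<in> corner (idm d)" shows "(\<lambda>m. tr ((T ^^ q m) x * y)) \<longlonglongrightarrow> tr (P x * y)"
  unfolding tr_T_funpow_pw[OF assms] P(2) by (rule flim_tr_right[OF q(2) uschwD(4)[OF uschw_pw[OF S]]])

lemma T_funpow_eigen: "T x = l \<star> x \<Longrightarrow> (T ^^ n) x = (l ^ n) \<star> x"
  by (induction n) (auto simp: lin_simps[OF T(1)] mult.commute)

text \<open>The powers \<open>l ^ q m\<close> converge to some \<open>c\<close> of modulus 1 with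
  \<open>P x = c \<star> x\<close>, and idempotence of \<open>P\<close> leaves only
  \<open>c = 1\<close>.\<close>

lemma peripheral_eigen_fixed:
  assumes "x \<in> corner (idm d)" "T x = l \<star> x" "cmod l = 1"
  shows "P x = x"
proof (cases "x = 0")
  case True
  then show ?thesis by (simp add: lin_simps[OF P(1)])
next
  case False
  then have t: "tr (x * adj x) \<noteq> 0" using tr_adj_times(3)[of x] by (simp add: tr_commute)
  have lim: "(\<lambda>m. l ^ q m * tr (x * y)) \<longlonglongrightarrow> tr (P x * y)" for y
    using T_limit[OF assms(1), of y] by (simp add: T_funpow_eigen[OF assms(2)])
  define c where "c = tr (P x * adj x) / tr (x * adj x)"
  have c: "(\<lambda>m. l ^ q m) \<longlonglongrightarrow> c" using tendsto_divide[OF lim[of "adj x"] tendsto_const t] t by (simp add: c_def)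
  have "cmod c = 1" using tendsto_norm[OF c] assms(3) by (simp add: norm_power LIMSEQ_const_iff)
  have "tr (P x * y) = tr ((c \<star> x) * y)" for y
    using tendsto_mult[OF c tendsto_const[of "tr (x * y)"]] lim[of y] LIMSEQ_unique by simp blast
  then have Px: "P x = c \<star> x" by (rule tr_nondeg)
  then have "(c * c) \<star> x = c \<star> x" using P_P[of x] by (simp add: lin_simps[OF P(1)])
  then have "c * c = c" using False by simp
  then have "c = 1" using \<open>cmod c = 1\<close> by auto
  then show ?thesis using Px by simp
qed

lemma fixed_corner: "P x = x \<Longrightarrow> x \<in> corner (idm d)"
  using P(3)[of x] by simp

text \<open>Here \<open>l ^ q m\<close> tends to 1, while \<open>q m \<ge> m\<close> would drive it
  to 0 or keep its modulus at least that of \<open>l > 1\<close>, according to the modulus of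
  \<open>l\<close>.\<close>

lemma fixed_eigen_peripheral:
  assumes "P w = w" "T w = l \<star> w" "w \<noteq> 0"
  shows "cmod l = 1"
proof -
  have t: "tr (w * adj w) \<noteq> 0" using tr_adj_times(3)[of w] assms by (simp add: tr_commute)
  have "(\<lambda>m. l ^ q m * tr (w * adj w)) \<longlonglongrightarrow> tr (w * adj w)"
    using T_limit[OF fixed_corner[OF assms(1)], of "adj w"] by (simp add: T_funpow_eigen[OF assms(2)] assms(1))
  from tendsto_divide[OF this tendsto_const t] have "(\<lambda>m. l ^ q m) \<longlonglongrightarrow> 1" using t by simp
  from tendsto_norm[OF this] have lim: "(\<lambda>m. cmod l ^ q m) \<longlonglongrightarrow> 1" by (simp add: norm_power)
  show ?thesis
  proof (rule ccontr)
    assume "cmod l \<noteq> 1"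
    then consider "cmod l < 1" | "cmod l > 1" by linarith
    then show False
    proof cases
      case 1
      have "(\<lambda>m. cmod l ^ q m) \<longlonglongrightarrow> 0"
        by (rule tendsto_sandwich[OF _ _ tendsto_const LIMSEQ_power_zero[of "cmod l"]])
           (use 1 q(1) in \<open>auto intro!: always_eventually power_decreasing\<close>)
      then show False using lim LIMSEQ_unique by fastforce
    next
      case 2
      then have "cmod l ^ q m \<ge> cmod l" if "m \<ge> 1" for m
        using q(1)[of m] that power_increasing[of 1 "q m" "cmod l"] by simp
      then have "1 \<ge> cmod l" by (intro LIMSEQ_le_const[OF lim]) blast
      then show False using 2 by simp
    qed
  qed
qed

text \<open>Along the exponents \<open>q m\<close> the powers of \<open>T\<close> at
  \<open>v\<close> converge when paired with \<open>adj w\<close>, yet a Jordan block contributes a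
  term growing linearly in \<open>q m\<close>.\<close>

lemma no_jordan_block:
  assumes v: "P v = v" "T v = l \<star> v + w" and w: "P w = w" "T w = l \<star> w"
  shows "w = 0"
proof (rule ccontr)
  assume w0: "w \<noteq> 0"
  have l: "cmod l = 1" by (rule fixed_eigen_peripheral[OF w w0])
  \<comment> \<open>The factor \<open>l\<close> on the left avoids the exponent
    \<open>n - 1\<close>.\<close>
  have Tn: "l \<star> (T ^^ n) v = (l ^ Suc n) \<star> v + (of_nat n * l ^ n) \<star> w" for n
  proof (induction n)
    case (Suc n)
    have "l \<star> (T ^^ Suc n) v = T (l \<star> (T ^^ n) v)" by (simp add: lin_simps[OF T(1)])
    also have "\<dots> = (l ^ Suc (Suc n)) \<star> v + (of_nat (Suc n) * l ^ Suc n) \<star> w"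
      unfolding Suc by (simp add: lin_simps[OF T(1)] v(2) w(2) fmat.scale_left_distrib algebra_simps)
    finally show ?case .
  qed simp
  define s where "s = Re (tr (adj w * w))"
  have s: "tr (w * adj w) = of_real s" using tr_adj_times(2)[of w] by (simp add: s_def tr_commute)
  have s0: "s > 0" unfolding s_def using w0 tr_adj_times(1,4)[of w] by (simp add: less_le)
  have "convergent (\<lambda>m. tr ((T ^^ q m) v * adj w))" using T_limit[OF fixed_corner[OF v(1)]] convergent_def by blast
  then have "Bseq (\<lambda>m. tr ((T ^^ q m) v * adj w))" by (rule convergent_imp_Bseq)
  then obtain C where C: "\<And>m. cmod (tr ((T ^^ q m) v * adj w)) \<le> C" by (auto simp: Bseq_def)
  have "of_nat m * s \<le> C + cmod (tr (v * adj w))" for m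
  proof -
    have "l * tr ((T ^^ q m) v * adj w) = l ^ Suc (q m) * tr (v * adj w) + of_nat (q m) * l ^ q m * tr (w * adj w)"
      using arg_cong[OF Tn[of "q m"], of "\<lambda>u. tr (u * adj w)"] by (simp add: distrib_right)
    then have "of_nat (q m) * l ^ q m * of_real s = l * tr ((T ^^ q m) v * adj w) - l ^ Suc (q m) * tr (v * adj w)"
      by (simp add: s)
    from arg_cong[OF this, of cmod]
    have "of_nat (q m) * s = cmod (l * tr ((T ^^ q m) v * adj w) - l ^ Suc (q m) * tr (v * adj w))"
      using s0 l by (simp add: norm_mult norm_power)
    also have "\<dots> \<le> C + cmod (tr (v * adj w))"
      by (rule order_trans[OF norm_triangle_ineq4]) (use C[of m] l in \<open>simp add: norm_mult norm_power\<close>)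
    finally have "of_nat (q m) * s \<le> C + cmod (tr (v * adj w))" .
    moreover have "real m * s \<le> of_nat (q m) * s" using q(1)[of m] s0 by simp
    ultimately show ?thesis by linarith
  qed
  moreover obtain m where "real m > (C + cmod (tr (v * adj w))) / s" using reals_Archimedean2 by blast
  ultimately show False using s0 by (simp add: field_simps) (metis not_le)
qed

definition periph_sum :: "fmat \<Rightarrow> bool" where
  "periph_sum x \<longleftrightarrow> (\<exists>ws. x = sum_list ws \<and> (\<forall>w\<in>set ws. P w = w \<and> (\<exists>l. cmod l = 1 \<and> T w = l \<star> w)))"

text \<open>By induction \<open>T v - l \<star> v\<close> is a sum of peripheral eigenvectors. The
  equation is solved for the eigenvalues other than \<open>l\<close>; after subtracting the
  solution, the part with eigenvalue \<open>l\<close> would form a Jordan block with the rest of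
  \<open>v\<close>, so it is zero.\<close>

lemma periph_sum_killp:
  assumes "killp T ls v = 0" "P v = v"
  shows "periph_sum v"
  using assms
proof (induction ls arbitrary: v)
  case Nil
  then show ?case unfolding periph_sum_def by (intro exI[of _ "[]"]) auto
next
  case (Cons l ls)
  note lP = lin_simps[OF P(1)] and lT = lin_simps[OF T(1)]
  have "P (T v - l \<star> v) = T v - l \<star> v" using Cons(3) T_P[of v] by (simp add: lP)
  from Cons(1)[OF _ this] Cons(2) obtain ws where ws: "T v - l \<star> v = sum_list ws"
    "\<forall>w\<in>set ws. P w = w \<and> (\<exists>l. cmod l = 1 \<and> T w = l \<star> w)" by (auto simp: periph_sum_def)
  then obtain m where m: "\<And>w. w \<in> set ws \<Longrightarrow> cmod (m w) = 1 \<and> T w = m w \<star> w" by metis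
  let ?A = "filter (\<lambda>w. m w = l) ws" and ?B = "filter (\<lambda>w. m w \<noteq> l) ws"
  \<comment> \<open>On an eigenvector with eigenvalue \<open>m w\<close> the operator
    \<open>T - l\<close> acts as \<open>m w - l\<close>, and is inverted by division.\<close>
  define zs where "zs = map (\<lambda>w. (1 / (m w - l)) \<star> w) ?B"
  have sum_split: "sum_list xs = sum_list (filter (\<lambda>w. m w = l) xs) + sum_list (filter (\<lambda>w. m w \<noteq> l) xs)"
    for xs by (induction xs) (auto simp: algebra_simps)
  have zs: "\<forall>w\<in>set zs. P w = w \<and> (\<exists>l. cmod l = 1 \<and> T w = l \<star> w)"
    using ws(2) m by (auto simp: zs_def lP lT fmat.scale_left_commute)
  have sumP: "P (sum_list xs) = sum_list xs" if "\<forall>w\<in>set xs. P w = w" for xs using that by (induction xs) (auto simp: lP)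
  have Tz: "T (sum_list zs) - l \<star> sum_list zs = sum_list ?B"
  proof -
    have "T (sum_list (map (\<lambda>w. (1 / (m w - l)) \<star> w) xs)) - l \<star> sum_list (map (\<lambda>w. (1 / (m w - l)) \<star> w) xs) = sum_list xs"
      if "\<forall>w\<in>set xs. T w = m w \<star> w \<and> m w \<noteq> l" for xs using that
    proof (induction xs)
      case (Cons w xs)
      have "m w / (m w - l) - l / (m w - l) = 1" using Cons(2) by (simp add: diff_divide_distrib[symmetric])
      then have "(m w / (m w - l)) \<star> w - (l / (m w - l)) \<star> w = w"
        by (simp add: fmat.scale_left_diff_distrib[symmetric])
      then show ?case using Cons by (simp add: lT fmat.scale_right_distrib algebra_simps)
    qed (simp add: lT)
    from this[of ?B] show ?thesis using m by (simp add: zs_def)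
  qed
  define v' where "v' = v - sum_list zs"
  have Pv': "P v' = v'" using sumP[of zs] zs Cons(3) by (simp add: v'_def lP)
  have Tv': "T v' = l \<star> v' + sum_list ?A"
    using Tz ws(1) sum_split[of ws] by (simp add: v'_def lT fmat.scale_right_diff_distrib algebra_simps)
  have "T (sum_list xs) = l \<star> sum_list xs" if "\<forall>w\<in>set xs. T w = l \<star> w" for xs
    using that by (induction xs) (auto simp: lT fmat.scale_right_distrib)
  then have "T (sum_list ?A) = l \<star> sum_list ?A" using m by auto
  moreover have "P (sum_list ?A) = sum_list ?A" using ws(2) by (intro sumP) auto
  ultimately have "sum_list ?A = 0" using no_jordan_block[OF Pv' Tv'] by blast
  then have Tv: "T v' = l \<star> v'" using Tv' by simp
  show ?case
  proof (cases "v' = 0")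
    case True
    then show ?thesis unfolding periph_sum_def using zs by (intro exI[of _ zs]) (auto simp: v'_def)
  next
    case False
    from fixed_eigen_peripheral[OF Pv' Tv False]
    show ?thesis unfolding periph_sum_def using zs Pv' Tv by (intro exI[of _ "v' # zs"]) (auto simp: v'_def)
  qed
qed

lemma fixed_periph_sum:
  assumes "P v = v" shows "periph_sum v"
proof -
  have "\<exists>ls. killp T ls v = 0" by (rule annihilate[OF T(1) T_funpow_corner]) (rule fixed_corner[OF assms])
  then show ?thesis using periph_sum_killp assms by blast
qed

end

text \<open>The direct sum of the \<open>x k \<otimes> \<rho> k\<close> in coordinates:
  \<open>c k i j\<close> are the entries of \<open>x k\<close>, the index of \<open>v k i\<close>
  stands for the first tensor factor, and \<open>r k\<close> carries the second.\<close>

definition block_elem :: "nat \<Rightarrow> (nat \<Rightarrow> nat) \<Rightarrow> (nat \<Rightarrow> nat \<Rightarrow> fmat) \<Rightarrow> (nat \<Rightarrow> fmat) \<Rightarrow> (nat \<Rightarrow> nat \<Rightarrow> nat \<Rightarrow> complex) \<Rightarrow> fmat" where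
  "block_elem K n v r c = (\<Sum>k<K. \<Sum>i<n k. \<Sum>j<n k. c k i j \<star> (v k i * r k * adj (v k j)))"

section \<open>The fixed-point algebra on the support\<close>

locale asymptotic_support = asymptotic +
  fixes e :: fmat
  assumes e: "proj e" "e \<in> corner (idm d)" "\<And>y. e * P y = P y" "\<And>y. P y * e = P y" "Q (idm d - e) = 0"
    and faithful: "\<And>b. pos b \<Longrightarrow> b \<in> corner e \<Longrightarrow> tr (P (idm d) * b) = 0 \<Longrightarrow> b = 0"
begin

abbreviation "I \<equiv> idm d"

lemma II: "I * I = I" "adj I = I" using proj_idm[of d] by (auto simp: proj_def)
lemma ee: "e * e = e" "adj e = e" "e * (e * x) = e * x" "I * e = e" "e * I = e"
  using e by (auto simp: proj_def corner_def mult.assoc[symmetric])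

lemma proj_g: "proj (I - e)" using e by (intro proj_diff(1)) (auto simp: corner_def)

lemma map_I: assumes "uschw d F" shows "F (I * b) = F b" "F (b * I) = F b"
proof -
  have "F (I * b) = F (I * (I * b) * I)" "F (b * I) = F (I * (b * I) * I)" by (simp_all add: uschwD(3)[OF assms])
  moreover have "I * (I * b) * I = I * b * I" "I * (b * I) * I = I * b * I" by (simp_all add: II mult.assoc) (simp add: II mult.assoc[symmetric])
  ultimately show "F (I * b) = F b" "F (b * I) = F b" by (simp_all add: uschwD(3)[OF assms])
qed

lemma Q_e: "Q (e * b) = Q b" "Q (b * e) = Q b"
proof -
  note l = lin_simps[OF uschwD(5)[OF Q(1)]]
  have "Q ((I - e) * b) = 0" "Q (b * (I - e)) = 0" using Q_null_proj[OF proj_g e(5)] by auto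
  then show "Q (e * b) = Q b" "Q (b * e) = Q b" by (simp_all add: algebra_simps l map_I[OF Q(1)])
qed

definition cmpr :: "(fmat \<Rightarrow> fmat) \<Rightarrow> fmat \<Rightarrow> fmat" where "cmpr F x = e * F x * e"

abbreviation "R \<equiv> cmpr Q"

lemma comp_schw: "uschw d F \<Longrightarrow> schw (cmpr F)"
  using schw_compress[OF uschwD(1) e(1)] by (simp add: cmpr_def[abs_def])

lemma comp_corner: "cmpr F x \<in> corner e" "e * cmpr F x = cmpr F x" "cmpr F x * e = cmpr F x"
  by (auto simp: cmpr_def corner_def ee mult.assoc)

lemma R_R: "R (R x) = R x" by (simp add: cmpr_def mult.assoc Q_e Q(2))

lemma R_I: "R I = e" by (simp add: cmpr_def uschwD(2)[OF Q(1)] ee)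

text \<open>\<open>P I\<close> lies in the corner of \<open>e\<close>, so compression by
  \<open>e\<close> is invisible to it.\<close>

lemma tr_PI_comp: "tr (P I * cmpr F x) = tr (P I * F x)"
proof -
  have "tr (P I * cmpr F x) = tr (e * P I * e * F x)" unfolding cmpr_def by (metis mult.assoc tr_commute)
  then show ?thesis by (simp add: e)
qed

lemma tr_PI_R: "tr (P I * R x) = tr (P I * x)"
  unfolding tr_PI_comp P(2)[symmetric] by (simp add: P_P)

definition Alg :: "fmat set" where "Alg = {x. R x = x}"

lemma Alg_iff: "x \<in> Alg \<longleftrightarrow> R x = x" by (simp add: Alg_def)

lemma Alg_unit: "a \<in> Alg \<Longrightarrow> e * a = a" "a \<in> Alg \<Longrightarrow> a * e = a"
  unfolding Alg_iff by (metis comp_corner)+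

lemma R_bimodule:
  assumes "a \<in> Alg" shows "R (a * b) = a * R b" "R (b * a) = R b * a"
proof -
  note s = comp_schw[OF Q(1)] and l = lin_simps[OF schwD(1)[OF comp_schw[OF Q(1)]]]
  have left: "R (adj a * b) = adj a * R b" if a: "a \<in> Alg" for a b
  proof -
    have Ra: "R a = a" using a by (simp add: Alg_iff)
    let ?D = "R (adj a * a) - adj a * a"
    have "pos ?D" using schwD(3)[OF s, of a] by (simp add: Ra)
    moreover have "?D \<in> corner e"
    proof (rule corner_minus[OF comp_corner(1) corner_times])
      have "adj a * e = adj a" "e * adj a = adj a" using Alg_unit[OF a] ee(2) by (metis adj_mult)+
      then show "a \<in> corner e" "adj a \<in> corner e" using Alg_unit[OF a] by (simp_all add: corner_def)
    qed
    moreover have "tr (P I * ?D) = 0" by (simp add: right_diff_distrib tr_PI_R)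
    ultimately have "?D = 0" by (rule faithful)
    then have "R (adj a * a) = adj (R a) * R a" by (simp add: Ra)
    from schw_mult[OF s this] show ?thesis by (simp add: Ra)
  qed
  have adjA: "adj a \<in> Alg" using assms schwD(2)[OF s, of a] by (simp add: Alg_iff)
  show 1: "R (a * b) = a * R b" using left[OF adjA] by simp
  have "adj (R (adj a * adj b)) = adj (adj a * R (adj b))" using left[OF assms] by simp
  then show "R (b * a) = R b * a" by (simp add: schwD(2)[OF s, symmetric])
qed

lemma star_alg_Alg: "star_alg Alg"
proof -
  note s = comp_schw[OF Q(1)] and l = lin_simps[OF schwD(1)[OF comp_schw[OF Q(1)]]]
  show ?thesis unfolding star_alg_def
    using schwD(2)[OF s] R_bimodule(1) by (auto simp: Alg_iff l)
qed

lemma e_Alg: "e \<in> Alg" using R_R[of I] by (simp add: Alg_iff R_I)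

lemma Alg_corner: "Alg \<subseteq> corner I"
  using Alg_unit e(2) by (auto simp: corner_def) (metis mult.assoc)+

text \<open>Tested against \<open>P I\<close>, the image of \<open>I - e\<close> is the trace of
  \<open>Q (F (I - e)) = F (Q (I - e)) = 0\<close>, so by faithfulness \<open>cmpr F\<close> kills
  \<open>I - e\<close>, and by \<open>schw_mult\<close> all its multiples. Hence the inner
  compression contained in \<open>R x\<close> may be dropped, and what remains is \<open>F\<close>
  commuting with \<open>Q\<close>.\<close>

lemma comp_R:
  assumes F: "uschw d F" and FQ: "\<And>x. F (Q x) = Q (F x)"
  shows "cmpr F (R x) = R (F x)"
proof -
  note s = comp_schw[OF F] and l = lin_simps[OF schwD(1)[OF comp_schw[OF F]]]
  let ?g = "I - e"
  have gg: "adj ?g * ?g = ?g" "adj ?g = ?g" using proj_g by (auto simp: proj_def)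
  have "tr (P I * cmpr F ?g) = tr (Q (F ?g))" by (rule trans[OF tr_PI_comp tr_PI])
  also have "\<dots> = 0" using FQ[of ?g] e(5) lin_simps[OF uschwD(5)[OF F]] by simp
  finally have g0: "cmpr F ?g = 0"
    by (intro faithful comp_corner(1) schw_pos[OF s] proj_pos proj_g)
  have gb: "cmpr F (?g * b) = 0" for b
  proof -
    have "cmpr F (adj ?g * ?g) = adj (cmpr F ?g) * cmpr F ?g" by (simp only: gg(1) g0) simp
    from schw_mult[OF s this, of b] show ?thesis by (simp only: gg(2) g0) simp
  qed
  have bg: "cmpr F (b * ?g) = 0" for b
    using arg_cong[OF gb[of "adj b"], of adj] by (simp only: schwD(2)[OF s, symmetric] adj_mult gg adj_simps(1)) simp
  have "cmpr F (I * b) = cmpr F b" "cmpr F (b * I) = cmpr F b" for b by (simp_all add: cmpr_def map_I[OF F])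
  then have eb: "cmpr F (e * b) = cmpr F b" "cmpr F (b * e) = cmpr F b" for b
    using gb[of b] bg[of b] by (simp_all add: left_diff_distrib right_diff_distrib l)
  have "cmpr F (R x) = cmpr F (Q x)" by (subst cmpr_def[of Q]) (simp add: eb mult.assoc)
  then show ?thesis by (simp add: cmpr_def FQ)
qed

section \<open>The automorphism induced by \<open>S\<close>\<close>

abbreviation "\<alpha> \<equiv> cmpr S"
abbreviation "\<beta> \<equiv> cmpr N"

lemma comp_Alg: "uschw d F \<Longrightarrow> (\<And>x. F (Q x) = Q (F x)) \<Longrightarrow> a \<in> Alg \<Longrightarrow> cmpr F a \<in> Alg"
  unfolding Alg_iff by (metis R_R comp_R)

text \<open>For \<open>a = R a\<close>, two uses of \<open>comp_R\<close> turn the composition into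
  \<open>R\<close> applied to \<open>S (N a)\<close> or \<open>N (S a)\<close>; both are
  \<open>Q a\<close>, and \<open>R (Q a) = R a\<close>.\<close>

lemma \<alpha>_\<beta>: "a \<in> Alg \<Longrightarrow> \<alpha> (\<beta> a) = a" "a \<in> Alg \<Longrightarrow> \<beta> (\<alpha> a) = a"
proof -
  assume "a \<in> Alg"
  then have a: "a = R a" by (simp add: Alg_iff)
  have RQ: "R (Q x) = R x" for x by (simp add: cmpr_def Q(2))
  show "\<alpha> (\<beta> a) = a" by (subst a, subst comp_R[OF N(1,2)], subst comp_R[OF S Q(3)]) (simp add: N(3) RQ a[symmetric])
  show "\<beta> (\<alpha> a) = a" by (subst a, subst comp_R[OF S Q(3)], subst comp_R[OF N(1,2)]) (simp add: N(4) RQ a[symmetric])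
qed

text \<open>The defect \<open>D\<close> in the Schwarz inequality of \<open>\<alpha>\<close> is
  positive, hence so is \<open>\<beta> D\<close>. The Schwarz inequality of \<open>\<beta>\<close>
  at \<open>\<alpha> a\<close> says that \<open>\<beta> D\<close> is also negative. So
  \<open>D = 0\<close>, and \<open>schw_mult\<close> applies.\<close>

lemma \<alpha>_mult:
  assumes "a \<in> Alg" "b \<in> Alg" shows "\<alpha> (a * b) = \<alpha> a * \<alpha> b"
proof -
  note sS = comp_schw[OF S] and sN = comp_schw[OF N(1)]
  note sA = star_alg_simps[OF star_alg_Alg]
  have *: "\<alpha> (adj a * b) = adj (\<alpha> a) * \<alpha> b" if a: "a \<in> Alg" for a
  proof -
    let ?D = "\<alpha> (adj a * a) - adj (\<alpha> a) * \<alpha> a"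
    have aa: "\<alpha> a \<in> Alg" "adj a * a \<in> Alg" using comp_Alg[OF S Q(3)] a by (auto simp: sA)
    have D: "?D \<in> Alg" using aa comp_Alg[OF S Q(3)] by (simp add: sA)
    have "pos (\<beta> ?D)" by (rule schw_pos[OF sN schwD(3)[OF sS]])
    moreover have "\<beta> ?D = adj a * a - \<beta> (adj (\<alpha> a) * \<alpha> a)"
      using aa by (simp add: lin_simps[OF schwD(1)[OF sN]] \<alpha>_\<beta>)
    moreover have "pos (\<beta> (adj (\<alpha> a) * \<alpha> a) - adj a * a)" using schwD(3)[OF sN, of "\<alpha> a"] a by (simp add: \<alpha>_\<beta>)
    ultimately have "\<beta> ?D = 0" using pos_antisym[of "\<beta> ?D"] by simp
    then have "?D = 0" using \<alpha>_\<beta>(1)[OF D] lin_simps(3)[OF schwD(1)[OF sS]] by simp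
    then have "\<alpha> (adj a * a) = adj (\<alpha> a) * \<alpha> a" by (simp only: right_minus_eq)
    then show ?thesis by (rule schw_mult[OF sS])
  qed
  have "adj a \<in> Alg" using assms by (simp add: sA)
  from *[OF this] show ?thesis by (simp add: schwD(2)[OF sS])
qed

text \<open>The transpose of \<open>R_bimodule\<close> under the trace pairing; against elements of
  the corner of \<open>e\<close>, \<open>R\<close> and \<open>Q\<close> have the same
  pairing.\<close>

lemma P_bimodule:
  assumes "a \<in> Alg" "x \<in> corner e" shows "P (a * x) = a * P x" "P (x * a) = P x * a"
proof -
  have x: "x * e = x" "e * x = x" using assms(2) by (auto simp: corner_def)
  note a = Alg_unit[OF assms(1)]
  have R: "tr (z * R y) = tr (z * Q y)" if "e * z = z" "z * e = z" for z y
    using that unfolding cmpr_def by (metis mult.assoc tr_commute)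
  show "P (a * x) = a * P x"
  proof (rule tr_nondeg)
    fix b
    have ax: "e * (a * x) = a * x" "a * x * e = a * x" using a x by (metis mult.assoc)+
    have "tr (P (a * x) * b) = tr (a * x * R b)" by (simp add: P(2) R[OF ax])
    also have "\<dots> = tr (x * (R b * a))" by (metis mult.assoc tr_commute)
    also have "\<dots> = tr (P x * (b * a))" by (simp add: R_bimodule(2)[OF assms(1), symmetric] R[OF x(2,1)] P(2))
    also have "\<dots> = tr (a * P x * b)" by (metis mult.assoc tr_commute)
    finally show "tr (P (a * x) * b) = tr (a * P x * b)" .
  qed
  show "P (x * a) = P x * a"
  proof (rule tr_nondeg)
    fix b
    have xa: "e * (x * a) = x * a" "x * a * e = x * a" using a x by (metis mult.assoc)+
    have "tr (P (x * a) * b) = tr (x * (a * R b))" unfolding P(2) R[OF xa, symmetric] by (simp add: mult.assoc)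
    also have "\<dots> = tr (P x * (a * b))" by (simp add: R_bimodule(1)[OF assms(1), symmetric] R[OF x(2,1)] P(2))
    finally show "tr (P (x * a) * b) = tr (P x * a * b)" by (simp add: mult.assoc)
  qed
qed

lemma \<alpha>_dual: "e * x = x \<Longrightarrow> x * e = x \<Longrightarrow> tr (T x * y) = tr (x * \<alpha> y)"
  unfolding T(2) cmpr_def by (metis mult.assoc tr_commute)

section \<open>The range of \<open>P\<close> in matrix units\<close>

context
  fixes K n p v
  assumes mu: "mat_units Alg e K n p v"
begin

interpretation mu: matrix_units Alg e K n p v
  by unfold_locales (use star_alg_Alg Alg_unit e e_Alg mu in auto)

text \<open>The normalisation gives trace 1, because \<open>P\<close> preserves the trace of
  \<open>p k\<close>.\<close>

definition r :: "nat \<Rightarrow> fmat" where "r k = (1 / tr (p k)) \<star> P (p k)"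

lemma p_corner: "k < K \<Longrightarrow> p k \<in> corner e" using Alg_unit mu.units_simps(2) by (auto simp: corner_def)

lemma tr_p: "k < K \<Longrightarrow> tr (p k) \<noteq> 0" "k < K \<Longrightarrow> tr (P (p k)) = tr (p k)"
proof -
  assume k: "k < K"
  show "tr (p k) \<noteq> 0" using proj_tr(3) mu.units_simps(3,4) k by blast
  have "P (p k) * I = P (p k)" using P(3)[of "p k"] by (simp add: corner_def)
  then have "tr (P (p k)) = tr (P (p k) * I)" by simp
  also have "\<dots> = tr (p k * I)" by (simp add: P(2) uschwD(2)[OF Q(1)])
  also have "p k * I = p k" using Alg_corner mu.units_simps(2)[OF k] by (auto simp: corner_def)
  finally show "tr (P (p k)) = tr (p k)" .
qed

lemma P_p_p: "k < K \<Longrightarrow> P (p k) * p k = P (p k)" "k < K \<Longrightarrow> p k * P (p k) = P (p k)"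
  using P_bimodule[OF mu.units_simps(2) p_corner] mu.p_idem(1) by metis+

lemma r_p: "k < K \<Longrightarrow> r k * p k = r k" "k < K \<Longrightarrow> p k * r k = r k"
  by (simp_all add: r_def P_p_p)

lemma tr_r: "k < K \<Longrightarrow> tr (r k) = 1" by (simp add: r_def tr_p)

lemma r_adj: "k < K \<Longrightarrow> adj (r k) = r k"
proof -
  assume k: "k < K"
  then have "cnj (tr (p k)) = tr (p k)" using mu.p_idem(2)[OF k] by (metis tr_simps(6))
  then show ?thesis using k mu.p_idem(2) by (simp add: r_def P_adj[symmetric])
qed

text \<open>With \<open>b = f * adj f\<close> the trace equals \<open>tr (R b) / tr (p k)\<close>.
  As \<open>R\<close> preserves the invariant functional, \<open>R b = 0\<close> would make
  \<open>b\<close> null for it, against faithfulness.\<close>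

lemma r_pos_def:
  assumes k: "k < K" and f: "p k * f = f" "f \<noteq> 0"
  shows "Re (tr (adj f * r k * f)) > 0"
proof -
  have fp: "adj f * p k = adj f" using arg_cong[OF f(1), of adj] mu.p_idem(2)[OF k] by simp
  define b where "b = f * adj f"
  have b: "pos b" using pos_adj_times[of "adj f"] by (simp add: b_def)
  have bp: "p k * b = b" "b * p k = b" by (simp_all add: b_def f mult.assoc[symmetric]) (simp add: mult.assoc fp)
  have pe: "e * p k = p k" "p k * e = p k" using p_corner[OF k] by (auto simp: corner_def)
  have bc: "b \<in> corner e" using bp pe unfolding corner_def by simp (metis mult.assoc)
  have "P (p k) = P e * p k"
    using P_bimodule(2)[OF mu.units_simps(2)[OF k], of e] ee pe by (simp add: corner_def)
  then have "tr (P (p k) * b) = tr (P e * b)" by (simp add: mult.assoc bp)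
  also have "\<dots> = tr (e * e * Q b)" by (simp add: P(2) ee)
  also have "\<dots> = tr (R b)" unfolding cmpr_def by (metis mult.assoc tr_commute)
  finally have Pb: "tr (P (p k) * b) = tr (R b)" .
  have Rb: "pos (R b)" by (rule schw_pos[OF comp_schw[OF Q(1)] b])
  have "R b \<noteq> 0"
  proof
    assume "R b = 0"
    then have "tr (P I * b) = 0" using tr_PI_R[of b] by simp
    then have "b = 0" by (rule faithful[OF b bc])
    then show False using f times_adj_eq_0 by (auto simp: b_def)
  qed
  then have gt: "Re (tr (R b)) > 0" using pos_tr[OF Rb] by (metis less_le)
  have tp: "tr (p k) = of_real (Re (tr (p k)))" "Re (tr (p k)) > 0"
    using proj_tr[OF mu.units_simps(3)[OF k]] proj_tr_ge_1[OF mu.units_simps(3)[OF k] mu.units_simps(4)[OF k]] by auto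
  have "tr (adj f * r k * f) = tr (r k * b)" unfolding b_def by (metis mult.assoc tr_commute)
  also have "\<dots> = tr (R b) / of_real (Re (tr (p k)))" using Pb tp(1) by (simp add: r_def)
  finally show ?thesis using gt tp(2) by simp
qed

lemma v_corner: "k < K \<Longrightarrow> i < n k \<Longrightarrow> e * v k i = v k i" "k < K \<Longrightarrow> i < n k \<Longrightarrow> v k i * e = v k i"
  using Alg_unit mu.units_simps(5) by auto

abbreviation "X \<equiv> block_elem K n v r"

lemma P_vrv:
  assumes "k < K" "i < n k" "j < n k" shows "P (v k i * r k * adj (v k j)) = v k i * r k * adj (v k j)"
proof -
  note sA = star_alg_simps[OF star_alg_Alg]
  have "P (p k) \<in> corner e" using e by (simp add: corner_def)
  then have rc: "r k \<in> corner e" by (simp add: r_def corner_def)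
  have va: "v k i \<in> Alg" "adj (v k j) \<in> Alg" using mu.units_simps(5) assms by (auto simp: sA)
  have "v k i * r k \<in> corner e" using rc v_corner assms by (simp add: corner_def mult.assoc) (simp add: mult.assoc[symmetric])
  then have "P (v k i * r k * adj (v k j)) = v k i * P (r k) * adj (v k j)"
    using P_bimodule(2)[OF va(2)] P_bimodule(1)[OF va(1) rc] by simp
  then show ?thesis by (simp add: r_def lin_simps[OF P(1)] P_P)
qed

lemma P_block_elem: "P (X c) = X c"
  unfolding block_elem_def by (simp add: lin_simps[OF P(1)] P_vrv)

lemma block_elem_corner: "e * X c = X c" "X c * e = X c"
  using e(3,4)[of "X c"] by (simp_all add: P_block_elem)

text \<open>Paired with \<open>b\<close>, the left side becomes the trace of \<open>y\<close>
  against \<open>p l * R b * p k\<close>. Since \<open>R b\<close> lies in the algebra, this factor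
  is 0 for \<open>k \<noteq> l\<close> and a multiple of \<open>p k\<close> otherwise; the constant
  is \<open>tr (y * p k)\<close>.\<close>

lemma P_pyp:
  assumes "k < K" "l < K" "y \<in> corner e"
  shows "\<exists>c. P (p k * y * p l) = (if k = l then c \<star> r k else 0)"
proof -
  have R: "tr (z * R y) = tr (z * Q y)" if "e * z = z" "z * e = z" for z y
    using that unfolding cmpr_def by (metis mult.assoc tr_commute)
  have pe: "e * p k = p k" "p k * e = p k" if "k < K" for k using p_corner[OF that] by (auto simp: corner_def)
  have z: "e * (p k * y * p l) = p k * y * p l" "p k * y * p l * e = p k * y * p l"
    using pe[OF assms(1)] pe[OF assms(2)] by (metis mult.assoc)+
  have RA: "R b \<in> Alg" for b by (simp add: Alg_iff R_R)
  have 1: "tr (P (p k * y * p l) * b) = tr (y * (p l * R b * p k))" for b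
  proof -
    have "tr (P (p k * y * p l) * b) = tr (p k * y * p l * R b)" by (simp add: P(2) R[OF z])
    also have "\<dots> = tr (y * (p l * R b * p k))" by (metis mult.assoc tr_commute)
    finally show ?thesis .
  qed
  show ?thesis
  proof (cases "k = l")
    case False
    have "P (p k * y * p l) = 0"
      by (rule tr_nondeg) (simp only: 1 mu.p_A_p(2)[OF assms(2,1) RA False[symmetric]], simp)
    then show ?thesis using False by simp
  next
    case True
    have "P (p k * y * p k) = tr (y * p k) \<star> r k"
    proof (rule tr_nondeg)
      fix b
      obtain c where c: "p k * R b * p k = c \<star> p k" using mu.p_A_p(1)[OF assms(1) RA] by blast
      have "tr (P (p k) * b) = tr (p k * p k * R b)" by (simp add: P(2) R[OF pe[OF assms(1)]] mu.p_idem assms)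
      also have "\<dots> = tr (p k * R b * p k)" by (metis mult.assoc tr_commute)
      finally have "tr (P (p k) * b) = c * tr (p k)" by (simp add: c)
      then have "tr (r k * b) = c" using tr_p(1)[OF assms(1)] by (simp add: r_def)
      moreover have "tr (P (p k * y * p k) * b) = tr (y * (p k * R b * p k))" using 1 True by simp
      ultimately show "tr (P (p k * y * p k) * b) = tr ((tr (y * p k) \<star> r k) * b)" by (simp add: c)
    qed
    then show ?thesis using True by auto
  qed
qed

text \<open>By the bimodule property the pieces \<open>adj (v k i) * x * v l j\<close> are fixed by
  \<open>P\<close>, and they lie between \<open>p k\<close> and \<open>p l\<close>, so
  \<open>P_pyp\<close> evaluates them. Inserting the resolution of \<open>e\<close> on both sides of
  \<open>x\<close> reassembles \<open>x\<close> from these pieces.\<close>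

lemma fixed_block_elem:
  assumes "P x = x" shows "\<exists>c. x = X c"
proof -
  note sA = star_alg_simps[OF star_alg_Alg]
  have xe: "e * x = x" "x * e = x" using e(3,4)[of x] assms by auto
  have ex: "\<exists>c. adj (v k i) * x * v l j = (if k = l then c \<star> r k else 0)"
    if "k < K" "l < K" "i < n k" "j < n l" for k l i j
  proof -
    have va: "adj (v k i) \<in> Alg" "v l j \<in> Alg" using mu.units_simps(5) that by (auto simp: sA)
    have xc: "x \<in> corner e" using xe by (simp add: corner_def)
    have ax: "adj (v k i) * x \<in> corner e" "adj (v k i) * x * v l j \<in> corner e"
      using xe Alg_unit[OF va(1)] Alg_unit[OF va(2)] unfolding corner_def by (simp_all, (metis mult.assoc)+)
    have "P (adj (v k i) * x * v l j) = adj (v k i) * x * v l j"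
      using P_bimodule(2)[OF va(2) ax(1)] P_bimodule(1)[OF va(1) xc] assms by simp
    moreover have "p k * (adj (v k i) * x * v l j) * p l = adj (v k i) * x * v l j"
      using mu.v_p that by (simp add: mult.assoc) (simp add: mult.assoc[symmetric])
    ultimately show ?thesis using P_pyp[OF that(1,2) ax(2)] by metis
  qed
  define c where "c = (\<lambda>k i j. SOME c. adj (v k i) * x * v k j = c \<star> r k)"
  have c: "adj (v k i) * x * v k j = c k i j \<star> r k" if "k < K" "i < n k" "j < n k" for k i j
  proof -
    have "\<exists>c. adj (v k i) * x * v k j = c \<star> r k" using ex[OF that(1,1) that(2,3)] by simp
    then show ?thesis unfolding c_def by (rule someI_ex)
  qed
  have c0: "adj (v k i) * x * v l j = 0" if "k < K" "l < K" "i < n k" "j < n l" "k \<noteq> l" for k l i j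
    using ex[OF that(1-4)] that(5) by simp
  have right: "y = (\<Sum>l<K. \<Sum>j<n l. y * v l j * adj (v l j))" if "y * e = y" for y
    by (subst that[symmetric], subst mu.units_simps(7)[symmetric]) (simp add: sum_distrib_left mult.assoc)
  have row: "adj (v k i) * x = (\<Sum>j<n k. c k i j \<star> (r k * adj (v k j)))" if "k < K" "i < n k" for k i
  proof -
    have "adj (v k i) * x = (\<Sum>l<K. \<Sum>j<n l. adj (v k i) * x * v l j * adj (v l j))"
      by (rule right) (simp add: mult.assoc xe)
    also have "\<dots> = (\<Sum>l<K. if l = k then (\<Sum>j<n k. c k i j \<star> (r k * adj (v k j))) else 0)"
      using that by (intro sum.cong) (auto simp: c c0)
    finally show ?thesis using that by simp
  qed
  have "x = (\<Sum>k<K. \<Sum>i<n k. v k i * (adj (v k i) * x))" by (rule mu.expand_left[OF xe(1)])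
  also have "\<dots> = X c" unfolding block_elem_def
    by (intro sum.cong) (auto simp: row sum_distrib_left mult.assoc)
  finally show ?thesis by blast
qed

text \<open>The matrix units are dual to the elements \<open>v k i * r k * adj (v k j)\<close>, with
  the two indices interchanged; this reads off coefficients.\<close>

lemma tr_block_elem:
  assumes "l < K" "a < n l" "b < n l" shows "tr (X c * (v l a * adj (v l b))) = c l b a"
proof -
  have 1: "tr (v k i * r k * adj (v k j) * (v l a * adj (v l b))) = (if k = l then (if j = a then (if i = b then 1 else 0) else 0) else 0)"
    if "k < K" "i < n k" "j < n k" for k i j
  proof -
    have "tr (v k i * r k * adj (v k j) * (v l a * adj (v l b))) = tr (r k * (adj (v k j) * v l a) * (adj (v l b) * v k i))"
      by (metis mult.assoc tr_commute)
    then show ?thesis using that assms by (auto simp: mu.units_simps(6) r_p tr_r)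
  qed
  have "tr (X c * (v l a * adj (v l b))) = (\<Sum>k<K. \<Sum>i<n k. \<Sum>j<n k. c k i j * tr (v k i * r k * adj (v k j) * (v l a * adj (v l b))))"
    by (simp add: block_elem_def sum_distrib_right)
  also have "\<dots> = (\<Sum>k<K. if k = l then c l b a else 0)"
  proof (intro sum.cong refl)
    fix k assume k: "k \<in> {..<K}"
    have "(\<Sum>i<n k. \<Sum>j<n k. c k i j * tr (v k i * r k * adj (v k j) * (v l a * adj (v l b))))
      = (\<Sum>i<n k. \<Sum>j<n k. if j = a \<and> i = b then (if k = l then c l b a else 0) else 0)"
      using 1 k by (intro sum.cong refl) auto
    then show "(\<Sum>i<n k. \<Sum>j<n k. c k i j * tr (v k i * r k * adj (v k j) * (v l a * adj (v l b)))) = (if k = l then c l b a else 0)"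
      using assms by (auto simp: sum_delta2)
  qed
  finally show ?thesis using assms by simp
qed

lemma block_elem_cong: "(\<And>k i j. k < K \<Longrightarrow> i < n k \<Longrightarrow> j < n k \<Longrightarrow> c k i j = c' k i j) \<Longrightarrow> X c = X c'"
  by (auto simp: block_elem_def intro!: sum.cong)

text \<open>Coefficient \<open>(i, j)\<close> of block \<open>k\<close> of \<open>T (X c)\<close> is
  its trace against \<open>v k j * adj (v k i)\<close>, and duality replaces \<open>T\<close> by
  \<open>\<alpha>\<close> acting on that unit. As \<open>\<alpha>\<close> carries block
  \<open>k\<close> to block \<open>\<tau> k\<close>, block \<open>k\<close> of the image is fed by
  block \<open>\<tau> k\<close> of the argument.\<close>

lemma T_block_elem:
  "\<exists>\<tau> U. \<tau> permutes {..<K} \<and> (\<forall>k<K. n (\<tau> k) = n k \<and> unitary_coeffs (n k) (U k)) \<and>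
    (\<forall>c. T (X c) = X (\<lambda>k i j. \<Sum>a<n k. \<Sum>b<n k. cnj (U k b i) * c (\<tau> k) b a * U k a j))"
proof -
  note sA = star_alg_simps[OF star_alg_Alg] and sS = comp_schw[OF S]
  have "\<exists>\<tau> U. \<tau> permutes {..<K} \<and> (\<forall>k<K. n (\<tau> k) = n k \<and> unitary_coeffs (n k) (U k) \<and>
      (\<forall>i<n k. \<forall>j<n k. \<alpha> (v k i * adj (v k j)) = (\<Sum>a<n k. \<Sum>b<n k. (U k a i * cnj (U k b j)) \<star> (v (\<tau> k) a * adj (v (\<tau> k) b)))))"
  proof (rule mu.automorphism_form)
    show "lin \<alpha>" by (rule schwD(1)[OF sS])
    show "\<alpha> a \<in> Alg" if "a \<in> Alg" for a using comp_Alg[OF S Q(3) that] .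
    show "\<alpha> (a * b) = \<alpha> a * \<alpha> b" if "a \<in> Alg" "b \<in> Alg" for a b using \<alpha>_mult[OF that] .
    show "\<alpha> (adj a) = adj (\<alpha> a)" for a by (rule schwD(2)[OF sS])
    show "\<alpha> e = e" using comp_R[OF S Q(3), of I] by (simp add: R_I uschwD(2)[OF S])
    show "a = 0" if "a \<in> Alg" "\<alpha> a = 0" for a
      using \<alpha>_\<beta>(2)[OF that(1)] that(2) lin_simps(3)[OF schwD(1)[OF comp_schw[OF N(1)]]] by simp
    show "\<exists>a\<in>Alg. b = \<alpha> a" if "b \<in> Alg" for b
      using \<alpha>_\<beta>(1)[OF that] comp_Alg[OF N(1,2) that] by metis
  qed
  then obtain \<tau> U where \<tau>: "\<tau> permutes {..<K}"
    and U: "\<And>k. k < K \<Longrightarrow> n (\<tau> k) = n k" "\<And>k. k < K \<Longrightarrow> unitary_coeffs (n k) (U k)"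
    and \<alpha>: "\<And>k i j. k < K \<Longrightarrow> i < n k \<Longrightarrow> j < n k \<Longrightarrow>
       \<alpha> (v k i * adj (v k j)) = (\<Sum>a<n k. \<Sum>b<n k. (U k a i * cnj (U k b j)) \<star> (v (\<tau> k) a * adj (v (\<tau> k) b)))"
    by (elim exE conjE) (rule that, auto)
  have \<tau>K: "\<tau> k < K" if "k < K" for k using permutes_in_image[OF \<tau>, of k] that by simp
  have "T (X c) = X (\<lambda>k i j. \<Sum>a<n k. \<Sum>b<n k. cnj (U k b i) * c (\<tau> k) b a * U k a j)" for c
  proof -
    have "P (T (X c)) = T (X c)" using T_P[of "X c"] by (simp add: P_block_elem)
    then obtain c' where c': "T (X c) = X c'" using fixed_block_elem by blast
    have "c' k i j = (\<Sum>a<n k. \<Sum>b<n k. cnj (U k b i) * c (\<tau> k) b a * U k a j)" if k: "k < K" "i < n k" "j < n k" for k i j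
    proof -
      have "c' k i j = tr (T (X c) * (v k j * adj (v k i)))" using tr_block_elem[OF k(1,3,2), of c'] by (simp add: c')
      also have "\<dots> = tr (X c * \<alpha> (v k j * adj (v k i)))" by (rule \<alpha>_dual) (rule block_elem_corner)+
      also have "\<dots> = (\<Sum>a<n k. \<Sum>b<n k. (U k a j * cnj (U k b i)) * tr (X c * (v (\<tau> k) a * adj (v (\<tau> k) b))))"
        by (simp add: \<alpha>[OF k(1,3,2)] sum_distrib_left)
      also have "\<dots> = (\<Sum>a<n k. \<Sum>b<n k. cnj (U k b i) * c (\<tau> k) b a * U k a j)"
        using U(1)[OF k(1)] \<tau>K[OF k(1)] by (intro sum.cong) (auto simp: tr_block_elem mult_ac)
      finally show ?thesis .
    qed
    then show ?thesis unfolding c' by (rule block_elem_cong)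
  qed
  then show ?thesis using \<tau> U by (intro exI[of _ \<tau>] exI[of _ U]) auto
qed

end

end

section \<open>Transfer from matrices\<close>

definition emb :: "complex mat \<Rightarrow> fmat" where
  "emb A = Abs_fmat (\<lambda>i j. if i < dim_row A \<and> j < dim_col A then A $$ (i, j) else 0)"

lemma ent_emb: "ent (emb A) i j = (if i < dim_row A \<and> j < dim_col A then A $$ (i, j) else 0)"
proof -
  have "\<exists>N. \<forall>i j. N \<le> i \<or> N \<le> j \<longrightarrow> (if i < dim_row A \<and> j < dim_col A then A $$ (i, j) else 0) = 0"
    by (rule exI[of _ "max (dim_row A) (dim_col A)"]) auto
  then show ?thesis unfolding emb_def by (subst Abs_fmat_inverse) auto
qed

definition tom :: "nat \<Rightarrow> fmat \<Rightarrow> complex mat" where "tom d x = mat d d (\<lambda>(i, j). ent x i j)"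

lemma tom_carrier [simp]: "tom d x \<in> carrier_mat d d" by (simp add: tom_def)

lemma emb_tom: "emb (tom d x) = idm d * x * idm d"
  by (rule fmat_eqI) (auto simp: ent_emb tom_def ent_idm_times ent_times_idm)

lemma emb_tom_corner: "x \<in> corner (idm d) \<Longrightarrow> emb (tom d x) = x"
  by (simp add: emb_tom corner_def)

lemma tom_emb: "A \<in> carrier_mat d d \<Longrightarrow> tom d (emb A) = A"
  by (rule eq_matI) (auto simp: tom_def ent_emb)

lemma emb_inject: "A \<in> carrier_mat d d \<Longrightarrow> B \<in> carrier_mat d d \<Longrightarrow> emb A = emb B \<Longrightarrow> A = B"
  by (metis tom_emb)

lemma emb_corner: "A \<in> carrier_mat d d \<Longrightarrow> emb A \<in> corner (idm d)"
  by (auto simp: corner_idm ent_emb)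

lemma tom_simps: "tom d (x + y) = tom d x + tom d y" "tom d (c \<star> x) = c \<cdot>\<^sub>m tom d x"
  "tom d (idm d * x * idm d) = tom d x"
  by (rule eq_matI; auto simp: tom_def ent_idm_times ent_times_idm)+

lemma emb_simps:
  "A \<in> carrier_mat d d \<Longrightarrow> B \<in> carrier_mat d d \<Longrightarrow> emb (A + B) = emb A + emb B"
  "A \<in> carrier_mat d d \<Longrightarrow> B \<in> carrier_mat d d \<Longrightarrow> emb (A - B) = emb A - emb B"
  "emb (c \<cdot>\<^sub>m A) = c \<star> emb A" "emb (1\<^sub>m d) = idm d" "emb (0\<^sub>m d d) = 0"
  by (rule fmat_eqI; auto simp: ent_emb ent_idm)+

lemma emb_mult: "dim_col A = dim_row B \<Longrightarrow> emb (A * B) = emb A * emb B"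
proof (rule fmat_eqI)
  fix i j assume d: "dim_col A = dim_row B"
  have "ent (emb A * emb B) i j = (\<Sum>k<dim_col A. ent (emb A) i k * ent (emb B) k j)"
    by (rule ent_times) (simp add: ent_emb)
  then show "ent (emb (A * B)) i j = ent (emb A * emb B) i j"
    using d by (auto simp: ent_emb scalar_prod_def atLeast0LessThan intro!: sum.neutral sum.cong)
qed

lemma mat_adjoint_dims [simp]: "dim_row (mat_adjoint A) = dim_col A" "dim_col (mat_adjoint A) = dim_row A"
  by (simp_all add: mat_adjoint_def)

lemma mat_adjoint_carrier: "A \<in> carrier_mat n m \<Longrightarrow> mat_adjoint A \<in> carrier_mat m n"
  by (rule carrier_matI) simp_all

lemma mat_adjoint_index: "i < dim_col A \<Longrightarrow> j < dim_row A \<Longrightarrow> mat_adjoint A $$ (i, j) = conjugate (A $$ (j, i))"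
  by (simp add: mat_adjoint_def mat_of_rows_index)

lemma emb_adjoint: "emb (mat_adjoint A) = adj (emb A)"
  by (rule fmat_eqI) (auto simp: ent_emb mat_adjoint_index)

lemma mtrace_emb: "A \<in> carrier_mat d d \<Longrightarrow> mtrace A = tr (emb A)"
  by (subst tr_eq[of d]) (auto simp: ent_emb mtrace_def)

lemma quadratic_form:
  assumes "A \<in> carrier_mat d d" "w \<in> carrier_vec d"
  shows "(A *\<^sub>v w) \<bullet>c w = (\<Sum>i<d. \<Sum>j<d. cnj (w $ i) * A $$ (i, j) * w $ j)"
  using assms by (auto simp: scalar_prod_def atLeast0LessThan sum_distrib_right sum_distrib_left intro!: sum.cong)

lemma ent_form:
  assumes "A \<in> carrier_mat d d"
  shows "ent (adj v * emb A * v) k k = (A *\<^sub>v vec d (\<lambda>i. ent v i k)) \<bullet>c vec d (\<lambda>i. ent v i k)"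
proof -
  have c: "emb A * idm d = emb A" "idm d * emb A = emb A" using emb_corner[OF assms] by (auto simp: corner_def)
  have Av: "ent (emb A * v) i k = (\<Sum>j<d. ent (emb A) i j * ent v j k)" for i
    by (rule ent_times) (use assms in \<open>auto simp: ent_emb\<close>)
  have "adj v * emb A * v = adj v * idm d * (emb A * v)" by (metis c(2) mult.assoc)
  then have "ent (adj v * emb A * v) k k = (\<Sum>i<d. ent (adj v * idm d) k i * ent (emb A * v) i k)"
    by (simp only:) (rule ent_times, simp add: ent_times_idm)
  also have "\<dots> = (\<Sum>i<d. \<Sum>j<d. cnj (ent v i k) * A $$ (i, j) * ent v j k)"
    using assms by (auto simp: Av ent_times_idm ent_emb sum_distrib_left mult.assoc intro!: sum.cong)
  finally show ?thesis by (simp add: quadratic_form[OF assms])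
qed

text \<open>The diagonal of \<open>adj v * emb A * v\<close> consists of the quadratic forms at the
  columns of \<open>v\<close>; conversely a vector is tested as a matrix with one column.\<close>

lemma psd_mat_pos: "psd_mat d A \<longleftrightarrow> A \<in> carrier_mat d d \<and> pos (emb A)"
proof safe
  assume A: "psd_mat d A"
  then show c: "A \<in> carrier_mat d d" by (simp add: psd_mat_def hermitian_mat_def)
  have h: "adj (emb A) = emb A" using A by (simp add: psd_mat_def hermitian_mat_def emb_adjoint[symmetric])
  show "pos (emb A)" unfolding pos_def
  proof (intro conjI allI h)
    fix v
    obtain N where N: "\<And>k. k \<ge> N \<Longrightarrow> ent (adj v * emb A * v) k k = 0" using ent_bound by metis
    have "0 \<le> Re (ent (adj v * emb A * v) k k)" for k
      using A unfolding ent_form[OF c] psd_mat_def by simp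
    then show "0 \<le> Re (tr (adj v * emb A * v))"
      by (subst tr_eq[OF N]) (auto intro!: sum_nonneg)
  qed
next
  assume c: "A \<in> carrier_mat d d" and p: "pos (emb A)"
  have "emb (mat_adjoint A) = emb A" using p by (simp add: emb_adjoint pos_def)
  then have "mat_adjoint A = A" using c by (intro emb_inject[of _ d]) auto
  moreover have "0 \<le> Re ((A *\<^sub>v w) \<bullet>c w)" if w: "w \<in> carrier_vec d" for w
  proof -
    define v where "v = emb (mat d 1 (\<lambda>(i,_). w $ i))"
    have "0 \<le> Re (tr (adj v * emb A * v))" using p unfolding pos_def by blast
    also have "tr (adj v * emb A * v) = (\<Sum>k<1. ent (adj v * emb A * v) k k)"
    proof (rule tr_eq)
      fix k :: nat assume "1 \<le> k"
      then have "vec d (\<lambda>i. ent v i k) = 0\<^sub>v d" by (intro eq_vecI) (auto simp: v_def ent_emb)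
      then show "ent (adj v * emb A * v) k k = 0" using c by (simp add: ent_form[OF c] scalar_prod_def)
    qed
    also have "vec d (\<lambda>i. ent v i 0) = w" using w by (intro eq_vecI) (auto simp: v_def ent_emb)
    then have "(\<Sum>k<1. ent (adj v * emb A * v) k k) = (A *\<^sub>v w) \<bullet>c w" by (simp add: ent_form[OF c])
    finally show ?thesis .
  qed
  ultimately show "psd_mat d A" using c by (simp add: psd_mat_def hermitian_mat_def)
qed

text \<open>Since \<open>tom\<close> truncates, the lifted map ignores everything outside the
  \<open>d\<close> by \<open>d\<close> block.\<close>

definition emap :: "nat \<Rightarrow> (complex mat \<Rightarrow> complex mat) \<Rightarrow> fmat \<Rightarrow> fmat" where
  "emap d T x = emb (T (tom d x))"

lemma emap_emb: "A \<in> carrier_mat d d \<Longrightarrow> emap d T (emb A) = emb (T A)"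
  by (simp add: emap_def tom_emb)

text \<open>The adjoint is given only by the trace identity and the Schwarz inequality.
  Nondegeneracy of the trace makes it linear, trace preservation of \<open>T\<close> makes it
  unital, and positivity of \<open>T\<close> makes both maps compatible with adjoints.\<close>

lemma schwarz_map_emap:
  assumes "schwarz_map d T"
  obtains S where "uschw d S" "lin (emap d T)" "\<And>x y. tr (emap d T x * y) = tr (x * S y)" "\<And>x. emap d T x \<in> corner (idm d)"
proof -
  have T: "linear_map_mat d T" "positive_map d T" "trace_preserving d T" using assms by (auto simp: schwarz_map_def)
  obtain S0 where S0: "is_adjoint_map d T S0"
    "\<And>A. A \<in> carrier_mat d d \<Longrightarrow> loewner_ge d (S0 (mat_adjoint A * A)) (S0 (mat_adjoint A) * S0 A)"
    using assms by (auto simp: schwarz_map_def)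
  let ?I = "idm d" and ?T = "emap d T" and ?S = "emap d S0"
  have II: "?I * ?I = ?I" "adj ?I = ?I" using proj_idm[of d] by (auto simp: proj_def)
  have Tc: "T A \<in> carrier_mat d d" if "A \<in> carrier_mat d d" for A using T(1) that by (simp add: linear_map_mat_def)
  have Sc: "S0 A \<in> carrier_mat d d" if "A \<in> carrier_mat d d" for A using S0(1) that by (simp add: is_adjoint_map_def)
  have c: "?T x \<in> corner ?I" "?S x \<in> corner ?I" for x by (simp_all add: emap_def emb_corner Tc Sc)
  have I: "?T (?I * x * ?I) = ?T x" "?S (?I * x * ?I) = ?S x" for x by (simp_all add: emap_def tom_simps)
  have lT: "lin ?T" unfolding lin_def
  proof (intro conjI allI)
    show "?T (x + y) = ?T x + ?T y" for x y using T(1)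
      by (simp add: emap_def tom_simps linear_map_mat_def emb_simps(1)[OF Tc[OF tom_carrier] Tc[OF tom_carrier]])
    show "?T (c \<star> x) = c \<star> ?T x" for c x using T(1) by (simp add: emap_def tom_simps linear_map_mat_def emb_simps)
  qed
  note lT' = lin_simps[OF lT]
  have sand: "tr (x * (?I * y * ?I)) = tr (x * y)" "tr (?I * y * ?I * x) = tr (y * x)" if "x \<in> corner ?I" for x y
  proof -
    have x: "?I * x = x" "x * ?I = x" using that by (auto simp: corner_def)
    show "tr (x * (?I * y * ?I)) = tr (x * y)" using x by (metis mult.assoc tr_commute)
    then show "tr (?I * y * ?I * x) = tr (y * x)" by (simp add: tr_commute)
  qed
  have dual: "tr (?T x * y) = tr (x * ?S y)" for x y
  proof -
    note dims = carrier_matD[OF Tc[OF tom_carrier, of x]] carrier_matD[OF Sc[OF tom_carrier, of y]]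
      carrier_matD[OF tom_carrier[of d x]] carrier_matD[OF tom_carrier[of d y]]
    have e: "emb (T (tom d x) * tom d y) = emb (T (tom d x)) * emb (tom d y)"
      "emb (tom d x * S0 (tom d y)) = emb (tom d x) * emb (S0 (tom d y))"
      by (rule emb_mult, simp only: dims)+
    have "tr (?T x * y) = tr (emb (T (tom d x)) * emb (tom d y))" using sand(1)[OF c(1)] by (simp add: emb_tom emap_def)
    also have "\<dots> = mtrace (T (tom d x) * tom d y)"
      unfolding e(1)[symmetric] by (rule mtrace_emb[symmetric]) (rule mult_carrier_mat[OF Tc[OF tom_carrier] tom_carrier])
    also have "\<dots> = mtrace (tom d x * S0 (tom d y))" using S0(1) by (simp add: is_adjoint_map_def)
    also have "\<dots> = tr (emb (tom d x) * ?S y)"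
      unfolding emap_def e(2)[symmetric] by (rule mtrace_emb) (rule mult_carrier_mat[OF tom_carrier Sc[OF tom_carrier]])
    also have "\<dots> = tr (x * ?S y)" using sand(2)[OF c(2)] by (simp add: emb_tom)
    finally show ?thesis .
  qed
  have nd: "x = y" if "\<And>z. tr (z * x) = tr (z * y)" for x y using tr_nondeg[of x y] that by (simp add: tr_commute)
  have lS: "lin ?S" unfolding lin_def
    by (intro conjI allI; rule nd) (simp_all add: dual[symmetric] distrib_left)
  note lS' = lin_simps[OF lS]
  have SI: "?S ?I = ?I"
  proof (rule nd)
    fix z
    have "?T z * ?I = ?T z" using c(1) by (simp add: corner_def)
    then have "tr (z * ?S ?I) = tr (?T z)" by (simp add: dual[symmetric])
    also have "\<dots> = mtrace (T (tom d z))" by (simp add: emap_def mtrace_emb[of _ d] Tc)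
    also have "\<dots> = mtrace (tom d z)" using T(3) by (simp add: trace_preserving_def)
    also have "\<dots> = tr (?I * z * ?I)" by (simp add: mtrace_emb[of _ d] emb_tom)
    also have "\<dots> = tr (z * ?I)" by (metis II(1) mult.assoc tr_commute)
    finally show "tr (z * ?S ?I) = tr (z * ?I)" .
  qed
  have Tpos: "pos (?T x)" if "pos x" for x
  proof -
    have "pos (emb (tom d x))" using pos_conj[OF that, of ?I] by (simp add: emb_tom)
    then have "psd_mat d (T (tom d x))" using T(2) by (simp add: positive_map_def psd_mat_pos)
    then show ?thesis by (simp add: psd_mat_pos emap_def)
  qed
  have Th: "adj (?T h) = ?T h" if h: "adj h = h" "h \<in> corner ?I" for h
  proof -
    \<comment> \<open>A Hermitian \<open>h\<close> is a difference of two squares, so positivity of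
      \<open>T\<close> already determines that its image is Hermitian.\<close>
    have "(1/4) \<star> (adj (h + ?I) * (h + ?I) - adj (h - ?I) * (h - ?I)) = (1/4) \<star> (h + h + h + h)"
      using h by (simp add: II corner_def algebra_simps)
    also have "\<dots> = h" by (rule fmat_eqI) simp
    finally have "?T h = (1/4) \<star> (?T (adj (h + ?I) * (h + ?I)) - ?T (adj (h - ?I) * (h - ?I)))"
      by (metis lT'(2,5))
    moreover have "adj (?T (adj y * y)) = ?T (adj y * y)" for y using Tpos[OF pos_adj_times[of y]] by (simp add: pos_def)
    ultimately show ?thesis by (metis (no_types) adj_simps(3,6) complex_cnj_divide complex_cnj_numeral complex_cnj_one)
  qed
  have Tadj: "?T (adj x) = adj (?T x)" for x
  proof -
    define y where "y = ?I * x * ?I"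
    have y: "y \<in> corner ?I" unfolding y_def by (rule sandwich_idm_corner)
    have ya: "adj y \<in> corner ?I" using y by (auto simp: corner_idm)
    define h k where "h = (1/2) \<star> (y + adj y)" and "k = (- \<i>/2) \<star> (y - adj y)"
    have hk: "adj h = h" "adj k = k" "h \<in> corner ?I" "k \<in> corner ?I"
      using y ya by (auto simp: h_def k_def corner_def algebra_simps intro!: fmat_eqI)
    have yhk: "y = h + \<i> \<star> k" "adj y = h - \<i> \<star> k" by (rule fmat_eqI, simp add: h_def k_def algebra_simps)+
    have "?T (adj y) = adj (?T y)" unfolding yhk(2) by (subst yhk(1)) (simp add: lT' Th hk)
    moreover have "adj y = ?I * adj x * ?I" by (simp add: y_def II mult.assoc)
    ultimately show ?thesis by (metis I(1) y_def)
  qed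
  have Sadj: "?S (adj y) = adj (?S y)" for y
  proof (rule nd)
    fix z
    have "tr (z * adj (?S y)) = cnj (tr (?S y * adj z))" by (subst tr_simps(6)[symmetric]) simp
    also have "\<dots> = cnj (tr (?T (adj z) * y))" by (simp add: dual tr_commute[of "?S y"])
    also have "\<dots> = tr (adj y * ?T z)" by (subst tr_simps(6)[symmetric]) (simp add: Tadj)
    finally show "tr (z * ?S (adj y)) = tr (z * adj (?S y))" by (simp add: dual[symmetric] tr_commute)
  qed
  have sch: "pos (?S (adj y * y) - adj (?S y) * ?S y)" if y: "y \<in> corner ?I" for y
  proof -
    let ?A = "tom d y"
    have "mat_adjoint ?A \<in> carrier_mat d d" by (rule mat_adjoint_carrier[OF tom_carrier])
    then have AA: "mat_adjoint ?A * ?A \<in> carrier_mat d d" "mat_adjoint ?A \<in> carrier_mat d d"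
      using mult_carrier_mat[OF _ tom_carrier] by blast+
    have eA: "emb ?A = y" by (rule emb_tom_corner[OF y])
    have eAA: "emb (mat_adjoint ?A * ?A) = adj y * y" "emb (mat_adjoint ?A) = adj y"
      using eA by (simp_all add: emb_mult emb_adjoint tom_def[of d y])
    have sc: "S0 (mat_adjoint ?A * ?A) \<in> carrier_mat d d" "S0 (mat_adjoint ?A) \<in> carrier_mat d d" "S0 ?A \<in> carrier_mat d d"
      using Sc AA by auto
    have "pos (emb (S0 (mat_adjoint ?A * ?A) - S0 (mat_adjoint ?A) * S0 ?A))"
      using S0(2)[OF tom_carrier] by (simp add: loewner_ge_def psd_mat_pos)
    also have "emb (S0 (mat_adjoint ?A * ?A) - S0 (mat_adjoint ?A) * S0 ?A) =
        emb (S0 (mat_adjoint ?A * ?A)) - emb (S0 (mat_adjoint ?A)) * emb (S0 ?A)"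
      using sc by (subst emb_simps(2)[of _ d]) (auto simp: emb_mult)
    also have "\<dots> = ?S (adj y * y) - ?S (adj y) * ?S y"
      using emap_emb[OF AA(1), where T = S0] emap_emb[OF AA(2), where T = S0] emap_emb[OF tom_carrier[of d y], where T = S0] by (simp only: eAA eA)
    finally show ?thesis by (simp add: Sadj)
  qed
  have Spos: "pos (?S y)" if y: "pos y" "y \<in> corner ?I" for y
  proof -
    obtain c where c: "c \<in> corner ?I" "y = adj c * c" using pos_sqrt_corner[OF y proj_idm] by blast
    from pos_add[OF sch[OF c(1)] pos_adj_times[of "?S c"]] show ?thesis by (simp add: c)
  qed
  have "pos (?S (adj x * x) - adj (?S x) * ?S x)" for x
  proof -
    let ?y = "?I * x * ?I"
    \<comment> \<open>The rows of \<open>x * ?I\<close> beyond \<open>d\<close>. Truncating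
      \<open>x\<close> loses exactly \<open>adj ?z * ?z\<close> from the compressed square, and
      \<open>?S\<close> maps that to a positive element, so the inequality for \<open>?y\<close>
      implies the one for \<open>x\<close>.\<close>
    let ?z = "x * ?I - ?I * x * ?I"
    have IIx: "?I * (?I * u) = ?I * u" for u by (simp add: II mult.assoc[symmetric])
    have z: "adj ?z * ?z = ?I * (adj x * x) * ?I - adj ?y * ?y" by (simp add: algebra_simps II IIx)
    have "?I * (adj x * x) * ?I - adj ?y * ?y \<in> corner ?I" by (simp add: corner_def algebra_simps II IIx)
    then have "pos (?S (adj ?z * ?z))" by (intro Spos pos_adj_times) (simp only: z)
    then have 1: "pos (?S (adj x * x) - ?S (adj ?y * ?y))" by (simp only: z lS' I)
    have "pos (?S (adj ?y * ?y) - adj (?S x) * ?S x)" using sch[OF sandwich_idm_corner[of d x]] by (simp only: I)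
    from pos_add[OF 1 this] show ?thesis by simp
  qed
  then have "uschw d ?S" using lS Sadj SI I c by (simp add: uschw_def schw_def)
  then show ?thesis using that lT dual c by blast
qed

section \<open>Block diagonal matrices\<close>

text \<open>This is \<open>W * M * mat_adjoint W\<close> expressed by the columns \<open>w a\<close>
  of \<open>W\<close>, see \<open>frame_sum_emb\<close>; block and tensor structure of
  \<open>M\<close> become ways of splitting a double sum.\<close>

definition frame_sum :: "complex mat \<Rightarrow> (nat \<Rightarrow> fmat) \<Rightarrow> fmat" where
  "frame_sum M w = (\<Sum>a<dim_row M. \<Sum>b<dim_col M. M $$ (a, b) \<star> (w a * adj (w b)))"

lemma sum_lessThan_add: "(\<Sum>a<n + m. g a) = (\<Sum>a<n. g a) + (\<Sum>a<(m::nat). g (n + a))"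
  for g :: "nat \<Rightarrow> 'a :: comm_monoid_add"
  by (induction m) (auto simp: add.assoc)

lemma sum_div_mod: "(\<Sum>t<n * m. g (t div m) (t mod m)) = (\<Sum>i<n. \<Sum>a<(m::nat). g i a)"
  for g :: "nat \<Rightarrow> nat \<Rightarrow> 'a :: comm_monoid_add"
proof (cases "m = 0")
  case False
  then show ?thesis
  proof (induction n)
    case (Suc n)
    have "(\<Sum>t<Suc n * m. g (t div m) (t mod m)) = (\<Sum>t<n * m + m. g (t div m) (t mod m))" by (simp add: add.commute)
    also have "\<dots> = (\<Sum>i<n. \<Sum>a<m. g i a) + (\<Sum>a<m. g ((n * m + a) div m) ((n * m + a) mod m))"
      using Suc by (simp add: sum_lessThan_add)
    also have "(\<Sum>a<m. g ((n * m + a) div m) ((n * m + a) mod m)) = (\<Sum>a<m. g n a)"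
      by (intro sum.cong) auto
    finally show ?case by simp
  qed simp
qed simp

lemma frame_sum_cong: "(\<And>a. a < dim_row M \<or> a < dim_col M \<Longrightarrow> w a = w' a) \<Longrightarrow> frame_sum M w = frame_sum M w'"
  unfolding frame_sum_def by (intro sum.cong refl) auto

lemma frame_sum_four_block:
  assumes "A \<in> carrier_mat n n" "B \<in> carrier_mat m m"
  shows "frame_sum (four_block_mat A (0\<^sub>m n m) (0\<^sub>m m n) B) w = frame_sum A w + frame_sum B (\<lambda>a. w (n + a))"
proof -
  let ?M = "four_block_mat A (0\<^sub>m n m) (0\<^sub>m m n) B"
  have 1: "(\<Sum>b<n + m. ?M $$ (a, b) \<star> (w a * adj (w b))) = (\<Sum>b<n. A $$ (a, b) \<star> (w a * adj (w b)))" if "a < n" for a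
    using that assms by (simp add: sum_lessThan_add)
  have 2: "(\<Sum>b<n + m. ?M $$ (n + a, b) \<star> (w (n + a) * adj (w b))) = (\<Sum>b<m. B $$ (a, b) \<star> (w (n + a) * adj (w (n + b))))" if "a < m" for a
    using that assms by (simp add: sum_lessThan_add)
  have "frame_sum ?M w = (\<Sum>a<n + m. \<Sum>b<n + m. ?M $$ (a, b) \<star> (w a * adj (w b)))"
    using assms by (simp add: frame_sum_def)
  also have "\<dots> = (\<Sum>a<n. \<Sum>b<n. A $$ (a, b) \<star> (w a * adj (w b))) + (\<Sum>a<m. \<Sum>b<m. B $$ (a, b) \<star> (w (n + a) * adj (w (n + b))))"
    unfolding sum_lessThan_add[of _ n m] using 1 2 by (simp add: sum_lessThan_add)
  finally show ?thesis using assms by (simp add: frame_sum_def)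
qed

lemma block_diag_carrier:
  "\<forall>A\<in>set As. dim_row A = dim_col A \<Longrightarrow> block_diag As \<in> carrier_mat (sum_list (map dim_row As)) (sum_list (map dim_row As))"
proof (induction As)
  case (Cons A As)
  have "dim_col A = dim_row A" using Cons(2) by auto
  then have A: "A \<in> carrier_mat (dim_row A) (dim_row A)" by (rule carrier_matI[OF refl])
  have B: "block_diag As \<in> carrier_mat (sum_list (map dim_row As)) (sum_list (map dim_row As))"
    by (rule Cons(1)) (use Cons(2) in auto)
  show ?case using four_block_carrier_mat[OF A B] by (simp add: Let_def)
qed simp

text \<open>The list of columns is cut into one sublist per diagonal block, and off-diagonal blocks
  contribute nothing.\<close>

lemma frame_sum_block_diag:
  assumes "list_all2 (\<lambda>A c. A \<in> carrier_mat (length c) (length c)) As cs"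
  shows "frame_sum (block_diag As) (nth (concat cs)) = sum_list (map2 (\<lambda>A c. frame_sum A (nth c)) As cs)"
  using assms
proof (induction As cs rule: list_all2_induct)
  case Nil
  then show ?case by (simp add: frame_sum_def)
next
  case (Cons A As c cs)
  have "\<forall>A\<in>set As. dim_row A = dim_col A" using Cons(2) by (induction rule: list_all2_induct) auto
  note B = block_diag_carrier[OF this]
  let ?m = "sum_list (map dim_row As)" and ?n = "length c"
  have "frame_sum (block_diag (A # As)) (nth (concat (c # cs))) = frame_sum A (nth (c @ concat cs)) + frame_sum (block_diag As) (\<lambda>a. (c @ concat cs) ! (?n + a))"
    using frame_sum_four_block[OF Cons(1) B] Cons(1) B by (simp add: Let_def)
  also have "frame_sum A (nth (c @ concat cs)) = frame_sum A (nth c)" using Cons(1) by (intro frame_sum_cong) (auto simp: nth_append)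
  also have "frame_sum (block_diag As) (\<lambda>a. (c @ concat cs) ! (?n + a)) = frame_sum (block_diag As) (nth (concat cs))"
    by (intro frame_sum_cong) (auto simp: nth_append)
  finally show ?case using Cons(3) by simp
qed

lemma frame_sum_kron:
  assumes "A \<in> carrier_mat n n" "B \<in> carrier_mat m m"
  shows "frame_sum (kron_mat A B) (\<lambda>t. u (t div m) (t mod m)) =
    (\<Sum>i<n. \<Sum>a<m. \<Sum>j<n. \<Sum>b<m. (A $$ (i, j) * B $$ (a, b)) \<star> (u i a * adj (u j b)))"
proof -
  have "frame_sum (kron_mat A B) (\<lambda>t. u (t div m) (t mod m)) = (\<Sum>s<n*m. \<Sum>t<n*m.
     (A $$ (s div m, t div m) * B $$ (s mod m, t mod m)) \<star> (u (s div m) (s mod m) * adj (u (t div m) (t mod m))))"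
    using assms by (simp add: frame_sum_def kron_mat_def)
  also have "\<dots> = (\<Sum>s<n*m. \<Sum>j<n. \<Sum>b<m.
     (A $$ (s div m, j) * B $$ (s mod m, b)) \<star> (u (s div m) (s mod m) * adj (u j b)))"
    by (rule sum.cong[OF refl], rule sum_div_mod[where g = "\<lambda>j b. (A $$ (_ div m, j) * B $$ (_ mod m, b)) \<star> (u (_ div m) (_ mod m) * adj (u j b))"])
  also have "\<dots> = (\<Sum>i<n. \<Sum>a<m. \<Sum>j<n. \<Sum>b<m. (A $$ (i, j) * B $$ (a, b)) \<star> (u i a * adj (u j b)))"
    by (rule sum_div_mod)
  finally show ?thesis .
qed

lemma frame_sum_emb:
  assumes M: "M \<in> carrier_mat d d" and w: "\<And>a. a < d \<Longrightarrow> idm d * w a = w a" "\<And>a. a < d \<Longrightarrow> w a * eu 0 0 = w a"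
  defines "W \<equiv> mat d d (\<lambda>(i, a). ent (w a) i 0)"
  shows "emb (W * M * mat_adjoint W) = frame_sum M w"
proof -
  \<comment> \<open>Vectors occupy column 0, so \<open>eu a 0\<close> extracts column
    \<open>a\<close> of \<open>W\<close> in the form of a vector.\<close>
  have col: "emb W * eu a 0 = w a" if "a < d" for a
  proof (rule fmat_eqI)
    fix i j
    have z: "ent (w a) i j = 0" if "i \<ge> d \<or> j \<noteq> 0"
    proof -
      have "ent (idm d * w a * eu 0 0) i j = 0"
      proof (cases "i \<ge> d")
        case True
        then show ?thesis by (simp add: mult.assoc ent_idm_times)
      next
        case False
        have "ent (w a * eu 0 0) i j = tr (w a * (eu 0 0 * eu j i))" by (simp add: tr_times_eu[symmetric] mult.assoc)
        then show ?thesis using that False w \<open>a < d\<close> by (simp add: eu_mult)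
      qed
      then show ?thesis using w \<open>a < d\<close> by simp
    qed
    have "ent (emb W * eu a 0) i j = (\<Sum>k<d. ent (emb W) i k * ent (eu a 0) k j)"
      by (rule ent_times) (simp add: W_def ent_emb)
    also have "\<dots> = (\<Sum>k<d. if k = a then (if j = 0 then ent (emb W) i a else 0) else 0)"
      by (intro sum.cong) (auto simp: ent_eu)
    also have "\<dots> = ent (w a) i j" using that z by (auto simp: W_def ent_emb not_less)
    finally show "ent (emb W * eu a 0) i j = ent (w a) i j" .
  qed
  have e: "emb W * eu a b * adj (emb W) = w a * adj (w b)" if "a < d" "b < d" for a b
  proof -
    have "emb W * eu a b * adj (emb W) = (emb W * eu a 0) * adj (emb W * eu b 0)"
      by (simp add: mult.assoc) (simp add: mult.assoc[symmetric] eu_mult)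
    then show ?thesis using col that by simp
  qed
  have "emb (W * M * mat_adjoint W) = emb W * emb M * adj (emb W)"
    using M by (simp add: emb_mult W_def emb_adjoint[symmetric])
  also have "\<dots> = (\<Sum>a<d. \<Sum>b<d. ent (emb M) a b \<star> (emb W * eu a b * adj (emb W)))"
    by (subst eu_expand[OF emb_corner[OF M]]) (simp add: sum_distrib_left sum_distrib_right)
  also have "\<dots> = frame_sum M w" using M by (auto simp: frame_sum_def e ent_emb intro!: sum.cong)
  finally show ?thesis .
qed

section \<open>Density matrices in orthonormal bases\<close>

definition gram_mat :: "nat \<Rightarrow> (nat \<Rightarrow> fmat) \<Rightarrow> fmat \<Rightarrow> complex mat" where
  "gram_mat m f r = mat m m (\<lambda>(a, b). ent (adj (f a) * r * f b) 0 0)"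

lemma gram_mat_eu:
  assumes "onb p m f" "a < m" "b < m"
  shows "adj (f a) * r * f b = gram_mat m f r $$ (a, b) \<star> eu 0 0"
proof -
  have "adj (f a) * r * f b = adj (f a * eu 0 0) * r * (f b * eu 0 0)" using onbD(2)[OF assms(1)] assms by simp
  also have "\<dots> = eu 0 0 * (adj (f a) * r * f b) * eu 0 0" by (simp add: mult.assoc)
  finally show ?thesis using assms by (simp add: eu00_sandwich gram_mat_def)
qed

lemma gram_mat_expand:
  assumes f: "onb p m f" and r: "r * p = r" "p * r = r"
  shows "r = (\<Sum>a<m. \<Sum>b<m. gram_mat m f r $$ (a, b) \<star> (f a * adj (f b)))"
proof -
  have "r = p * r * p" using r by simp
  also have "\<dots> = (\<Sum>a<m. \<Sum>b<m. f a * (adj (f a) * r * f b) * adj (f b))"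
    unfolding onbD(4)[OF f, symmetric] by (simp add: sum_distrib_left sum_distrib_right mult.assoc) (rule sum.swap)
  also have "\<dots> = (\<Sum>a<m. \<Sum>b<m. gram_mat m f r $$ (a, b) \<star> (f a * adj (f b)))"
    by (intro sum.cong refl) (simp add: gram_mat_eu[OF f] onbD(2)[OF f])
  finally show ?thesis .
qed

text \<open>The quadratic form at \<open>w\<close> is that of \<open>r\<close> at \<open>F\<close>,
  the combination of the basis vectors with coefficients \<open>w\<close>; orthonormality makes
  \<open>F\<close> nonzero. The trace is that of \<open>r * p\<close>.\<close>

lemma gram_mat_pd_density:
  assumes f: "onb p m f" and r: "r * p = r" "p * r = r" "adj r = r" "tr r = 1"
    and pd: "\<And>f. p * f = f \<Longrightarrow> f \<noteq> 0 \<Longrightarrow> 0 < Re (tr (adj f * r * f))"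
  shows "pd_density m (gram_mat m f r)"
proof -
  let ?G = "gram_mat m f r"
  have c: "?G \<in> carrier_mat m m" by (simp add: gram_mat_def)
  have sym: "?G $$ (b, a) = cnj (?G $$ (a, b))" if "a < m" "b < m" for a b
  proof -
    have "adj (f b) * r * f a = adj (adj (f a) * r * f b)" by (simp add: r mult.assoc)
    then have "ent (adj (f b) * r * f a) 0 0 = cnj (ent (adj (f a) * r * f b) 0 0)" by (simp only: ent_adj)
    then show ?thesis using that by (simp add: gram_mat_def)
  qed
  have "mat_adjoint ?G = ?G"
  proof (rule eq_matI)
    fix i j assume "i < dim_row ?G" "j < dim_col ?G"
    then have ij: "i < m" "j < m" using c by auto
    then have "mat_adjoint ?G $$ (i, j) = cnj (?G $$ (j, i))" using c by (simp add: mat_adjoint_index)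
    then show "mat_adjoint ?G $$ (i, j) = ?G $$ (i, j)" using sym[OF ij(2,1)] by simp
  qed (use c in auto)
  moreover have "Re ((?G *\<^sub>v w) \<bullet>c w) > 0" if w: "w \<in> carrier_vec m" "w \<noteq> 0\<^sub>v m" for w
  proof -
    define F where "F = (\<Sum>b<m. w $ b \<star> f b)"
    have "p * F = F" by (simp add: F_def sum_distrib_left onbD(1)[OF f])
    moreover have "F \<noteq> 0"
    proof
      assume F0: "F = 0"
      have "w $ a = 0" if a: "a < m" for a
      proof -
        have "adj (f a) * F = (\<Sum>b<m. if b = a then w $ a \<star> eu 0 0 else 0)"
          unfolding F_def sum_distrib_left using a by (intro sum.cong) (auto simp: onbD(3)[OF f])
        then have "w $ a \<star> eu 0 0 = 0" using F0 a by simp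
        then show ?thesis using arg_cong[of _ _ tr] by fastforce
      qed
      then have "w = 0\<^sub>v m" using w(1) by (intro eq_vecI) auto
      then show False using w by simp
    qed
    ultimately have "0 < Re (tr (adj F * r * F))" by (rule pd)
    also have "adj F * r * F = (\<Sum>a<m. \<Sum>b<m. (cnj (w $ a) * w $ b) \<star> (adj (f a) * r * f b))"
      by (simp add: F_def sum_distrib_left sum_distrib_right fmat.scale_sum_right mult.commute) (rule sum.swap)
    also have "\<dots> = (\<Sum>a<m. \<Sum>b<m. (cnj (w $ a) * ?G $$ (a, b) * w $ b) \<star> eu 0 0)"
      by (intro sum.cong refl, subst gram_mat_eu[OF f]) (auto simp: mult_ac)
    finally show ?thesis by (simp add: quadratic_form[OF c w(1)])
  qed
  moreover have "mtrace ?G = 1"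
  proof -
    have "mtrace ?G = (\<Sum>a<m. tr (adj (f a) * r * f a))"
      using c by (auto simp: mtrace_def gram_mat_eu[OF f] intro!: sum.cong)
    also have "\<dots> = tr (r * p)" unfolding onbD(4)[OF f, symmetric]
      by (simp add: sum_distrib_left) (metis mult.assoc tr_commute)
    finally show ?thesis using r by simp
  qed
  ultimately show ?thesis using c by (simp add: pd_density_def pd_mat_def hermitian_mat_def)
qed

lemma sum_list_upt: "sum_list (map h [0..<n]) = (\<Sum>i<n. h i)" for h :: "nat \<Rightarrow> 'a :: comm_monoid_add"
  by (induction n) (auto simp: add.commute)

lemma map2_same: "map2 h (map a xs) (map b xs) = map (\<lambda>x. h (a x) (b x)) xs"
  by (induction xs) auto

lemma sum_list_map_concat: "sum_list (map h (concat xs)) = sum_list (map (\<lambda>x. sum_list (map h x)) xs)"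
  for h :: "'b \<Rightarrow> 'a :: comm_monoid_add"
  by (induction xs) (auto simp: add.assoc)

text \<open>A unitary with columns \<open>g i\<close>, spanning the complement of \<open>e\<close>, and \<open>v k i * f k a\<close> turns block diagonal
  matrices into elements \<open>block_elem\<close>.\<close>

lemma decomp_embed_exists:
  assumes vv: "\<And>k i. k < K \<Longrightarrow> i < n k \<Longrightarrow> adj (v k i) * v k i = p k"
    "\<And>k i. k < K \<Longrightarrow> i < n k \<Longrightarrow> v k i * p k = v k i" "\<And>k i. k < K \<Longrightarrow> i < n k \<Longrightarrow> idm d * v k i = v k i"
    and e: "(\<Sum>k<K. \<Sum>i<n k. v k i * adj (v k i)) = e" "e \<in> corner (idm d)" "proj e"
    and p: "\<And>k. k < K \<Longrightarrow> proj (p k)"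
    and f: "\<And>k. k < K \<Longrightarrow> onb (p k) (m k) (f k)"
    and r: "\<And>k. k < K \<Longrightarrow> r k * p k = r k" "\<And>k. k < K \<Longrightarrow> p k * r k = r k"
  defines "\<rho> \<equiv> \<lambda>k. gram_mat (m k) (f k) (r k)"
  shows "\<exists>W n0. unitary_mat d W \<and> n0 + (\<Sum>k<K. n k * m k) = d \<and>
    (\<forall>x. (\<forall>k<K. x k \<in> carrier_mat (n k) (n k)) \<longrightarrow> decomp_embed W n0 K \<rho> x \<in> carrier_mat d d \<and>
       emb (decomp_embed W n0 K \<rho> x) = block_elem K n v r (\<lambda>k i j. x k $$ (i, j)))"
proof -
  have "proj (idm d - e)" by (rule proj_diff(1)) (use e in \<open>auto simp: corner_def\<close>)
  from orthonormal_basis[OF this] obtain n0 g where g: "onb (idm d - e) n0 g" by blast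
  define u where "u = (\<lambda>k i a. v k i * f k a)"
  \<comment> \<open>Within block \<open>k\<close> the columns are ordered with
    \<open>t div m k\<close> indexing the first tensor factor, as in
    \<open>kron_mat\<close>.\<close>
  define c where "c = (\<lambda>k. map (\<lambda>t. u k (t div m k) (t mod m k)) [0..<n k * m k])"
  define c0 where "c0 = map g [0..<n0]"
  define cols where "cols = concat (c0 # map c [0..<K])"
  have frame: "idm d * w = w \<and> w * eu 0 0 = w \<and> adj w * w = eu 0 0" if w: "w \<in> set cols" for w
  proof -
    consider i where "i < n0" "w = g i" | k i a where "k < K" "i < n k" "a < m k" "w = u k i a"
    proof -
      from w have "w \<in> set c0 \<or> (\<exists>k<K. w \<in> set (c k))" by (auto simp: cols_def)
      then show ?thesis
      proof
        assume "w \<in> set c0" then show ?thesis using that(1) by (auto simp: c0_def)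
      next
        assume "\<exists>k<K. w \<in> set (c k)"
        then obtain k t where k: "k < K" "t < n k * m k" "w = u k (t div m k) (t mod m k)" by (auto simp: c_def)
        then have "m k > 0" by (cases "m k") auto
        then have "t div m k < n k" "t mod m k < m k" using k(2) by (auto simp: less_mult_imp_div_less)
        then show ?thesis using that(2) k by blast
      qed
    qed
    then show ?thesis
    proof cases
      case 1
      have "(idm d - e) * g i = g i" using onbD(1)[OF g] 1 by simp
      moreover have "idm d * (idm d - e) = idm d - e"
        using e(2) proj_idm[of d] by (simp add: corner_def proj_def algebra_simps)
      ultimately have "idm d * g i = g i" by (metis mult.assoc)
      then show ?thesis using 1 onbD[OF g] by simp
    next
      case 2
      have fk: "f k a * eu 0 0 = f k a" "p k * f k a = f k a" "adj (f k a) * f k a = eu 0 0" using onbD[OF f[OF 2(1)]] 2(3) by auto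
      have "adj w * w = adj (f k a) * (adj (v k i) * v k i) * f k a" by (simp add: 2 u_def mult.assoc)
      also have "\<dots> = eu 0 0" using vv(1) 2 fk by (simp add: mult.assoc)
      finally have "adj w * w = eu 0 0" .
      moreover have "idm d * w = w" using vv(3)[OF 2(1,2)] by (simp add: 2(4) u_def mult.assoc[symmetric])
      moreover have "w * eu 0 0 = w" using fk by (simp add: 2(4) u_def mult.assoc)
      ultimately show ?thesis by simp
    qed
  qed
  have vfv: "(\<Sum>a<m k. u k i a * adj (u k i a)) = v k i * adj (v k i)" if "k < K" "i < n k" for k i
  proof -
    have "(\<Sum>a<m k. u k i a * adj (u k i a)) = v k i * (\<Sum>a<m k. f k a * adj (f k a)) * adj (v k i)"
      by (simp add: u_def sum_distrib_left sum_distrib_right mult.assoc)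
    then show ?thesis using onbD(4)[OF f] vv(2) that by simp
  qed
  have "sum_list (map (\<lambda>w. w * adj w) cols) = (\<Sum>i<n0. g i * adj (g i))
      + (\<Sum>k<K. \<Sum>t<n k * m k. u k (t div m k) (t mod m k) * adj (u k (t div m k) (t mod m k)))"
    by (simp add: cols_def sum_list_map_concat c0_def c_def o_def sum_list_upt)
  also have "\<dots> = (idm d - e) + (\<Sum>k<K. \<Sum>i<n k. \<Sum>a<m k. u k i a * adj (u k i a))"
    unfolding onbD(4)[OF g] by (simp add: sum_div_mod[where g = "\<lambda>i a. u _ i a * adj (u _ i a)"])
  also have "\<dots> = idm d" using e(1) vfv by simp
  finally have sumI: "sum_list (map (\<lambda>w. w * adj w) cols) = idm d" .
  \<comment> \<open>Every column has norm 1, so the trace of the resolution of the identity counts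
    the columns.\<close>
  have len: "length cols = d"
  proof -
    have "tr (sum_list (map (\<lambda>w. w * adj w) ws)) = of_nat (length ws)" if "\<forall>w\<in>set ws. adj w * w = eu 0 0" for ws
      using that
    proof (induction ws)
      case (Cons w ws)
      then show ?case by (simp add: tr_commute[of w "adj w"])
    qed simp
    then have "tr (idm d) = of_nat (length cols)" using frame sumI by metis
    moreover have "tr (idm d) = of_nat d" by (simp add: idm_eq)
    ultimately show ?thesis by (metis of_nat_eq_iff)
  qed
  have len': "length cols = n0 + (\<Sum>k<K. n k * m k)"
    by (simp add: cols_def c0_def c_def length_concat o_def sum_list_upt)
  define W where "W = mat d d (\<lambda>(i, a). ent (cols ! a) i 0)"
  have W: "W \<in> carrier_mat d d" by (simp add: W_def)
  have fse: "emb (W * M * mat_adjoint W) = frame_sum M (nth cols)" if "M \<in> carrier_mat d d" for M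
    unfolding W_def by (rule frame_sum_emb[OF that]) (use frame len in auto)
  have Wa: "mat_adjoint W \<in> carrier_mat d d" by (rule mat_adjoint_carrier[OF W])
  have "frame_sum (1\<^sub>m d) (nth cols) = (\<Sum>a<d. \<Sum>b<d. if b = a then cols ! a * adj (cols ! a) else 0)"
    unfolding frame_sum_def index_one_mat(2,3) by (intro sum.cong refl) auto
  also have "\<dots> = sum_list (map (\<lambda>w. w * adj w) cols)" using len by (simp add: sum_list_sum_nth atLeast0LessThan)
  finally have "emb (W * mat_adjoint W) = emb (1\<^sub>m d)" using fse[of "1\<^sub>m d"] W by (simp add: sumI emb_simps)
  then have WW: "W * mat_adjoint W = 1\<^sub>m d" using W Wa by (intro emb_inject[of _ d]) auto
  then have "unitary_mat d W" using mat_mult_left_right_inverse[OF W Wa WW] W by (simp add: unitary_mat_def)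
  moreover have "decomp_embed W n0 K \<rho> x \<in> carrier_mat d d \<and>
       emb (decomp_embed W n0 K \<rho> x) = block_elem K n v r (\<lambda>k i j. x k $$ (i, j))"
    if x: "\<forall>k<K. x k \<in> carrier_mat (n k) (n k)" for x
  proof -
    let ?As = "0\<^sub>m n0 n0 # map (\<lambda>k. kron_mat (x k) (\<rho> k)) [0..<K]"
    let ?cs = "c0 # map c [0..<K]"
    have \<rho>: "\<rho> k \<in> carrier_mat (m k) (m k)" for k by (simp add: \<rho>_def gram_mat_def)
    have kc: "kron_mat (x k) (\<rho> k) \<in> carrier_mat (n k * m k) (n k * m k)" if "k < K" for k
      using x \<rho>[of k] that by (auto simp: kron_mat_def)
    have la: "list_all2 (\<lambda>A c. A \<in> carrier_mat (length c) (length c)) ?As ?cs"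
      using kc by (auto simp: list_all2_conv_all_nth nth_Cons' c0_def c_def)
    note kd = carrier_matD[OF kc]
    have sq: "\<forall>A\<in>set ?As. dim_row A = dim_col A" using kd by auto
    have "sum_list (map dim_row ?As) = n0 + sum_list (map (\<lambda>k. n k * m k) [0..<K])"
      using kd by (simp add: o_def sum_list_upt)
    then have B: "block_diag ?As \<in> carrier_mat d d" using block_diag_carrier[OF sq] len len' by (simp add: sum_list_upt)
    have fr: "frame_sum (kron_mat (x k) (\<rho> k)) (nth (c k)) = (\<Sum>i<n k. \<Sum>j<n k. x k $$ (i, j) \<star> (v k i * r k * adj (v k j)))"
      if k: "k < K" for k
    proof -
      have "frame_sum (kron_mat (x k) (\<rho> k)) (nth (c k)) = frame_sum (kron_mat (x k) (\<rho> k)) (\<lambda>t. u k (t div m k) (t mod m k))"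
        by (rule frame_sum_cong) (use kd[OF k] in \<open>auto simp: c_def\<close>)
      also have "\<dots> = (\<Sum>i<n k. \<Sum>a<m k. \<Sum>j<n k. \<Sum>b<m k. (x k $$ (i, j) * \<rho> k $$ (a, b)) \<star> (u k i a * adj (u k j b)))"
        by (rule frame_sum_kron) (use x k \<rho> in auto)
      also have "\<dots> = (\<Sum>i<n k. \<Sum>j<n k. \<Sum>a<m k. \<Sum>b<m k. (x k $$ (i, j) * \<rho> k $$ (a, b)) \<star> (u k i a * adj (u k j b)))"
        by (rule sum.cong[OF refl]) (rule sum.swap)
      also have "\<dots> = (\<Sum>i<n k. \<Sum>j<n k. x k $$ (i, j) \<star> (v k i * r k * adj (v k j)))"
      proof (intro sum.cong refl)
        fix i j
        have "v k i * r k * adj (v k j) = (\<Sum>a<m k. \<Sum>b<m k. \<rho> k $$ (a, b) \<star> (u k i a * adj (u k j b)))"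
          by (subst gram_mat_expand[OF f[OF k] r(1)[OF k] r(2)[OF k]])
             (simp add: \<rho>_def u_def sum_distrib_left sum_distrib_right mult.assoc)
        then show "(\<Sum>a<m k. \<Sum>b<m k. (x k $$ (i, j) * \<rho> k $$ (a, b)) \<star> (u k i a * adj (u k j b))) = x k $$ (i, j) \<star> (v k i * r k * adj (v k j))"
          by (simp add: fmat.scale_sum_right)
      qed
      finally show ?thesis .
    qed
    have "emb (decomp_embed W n0 K \<rho> x) = frame_sum (block_diag ?As) (nth cols)"
      unfolding decomp_embed_def by (rule fse[OF B])
    also have "\<dots> = frame_sum (0\<^sub>m n0 n0) (nth c0) + (\<Sum>k<K. frame_sum (kron_mat (x k) (\<rho> k)) (nth (c k)))"
      unfolding cols_def frame_sum_block_diag[OF la]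
      by (simp del: map_map add: map2_same[where h = "\<lambda>A c. frame_sum A (nth c)"] sum_list_upt)
    also have "\<dots> = block_elem K n v r (\<lambda>k i j. x k $$ (i, j))"
      using fr by (simp add: block_elem_def) (simp add: frame_sum_def)
    finally show ?thesis using W B Wa by (simp add: decomp_embed_def)
  qed
  ultimately show ?thesis using len len' by (intro exI[of _ W] exI[of _ n0]) auto
qed

section \<open>The decomposition for complex matrices\<close>

lemma conj_index:
  assumes "A \<in> carrier_mat n n" "B \<in> carrier_mat n n" "i < n" "j < n"
  shows "(A * B * mat_adjoint A) $$ (i, j) = (\<Sum>a<n. \<Sum>b<n. A $$ (i, b) * B $$ (b, a) * cnj (A $$ (j, a)))"
  using assms by (auto simp: scalar_prod_def atLeast0LessThan mat_adjoint_index sum_distrib_right intro!: sum.cong)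

theorem theorem8:
  fixes d :: nat and T :: "complex mat \<Rightarrow> complex mat"
  assumes "schwarz_map d T"
  shows "\<exists>W d0 K (d1 :: nat \<Rightarrow> nat) (d2 :: nat \<Rightarrow> nat) \<rho>.
     unitary_mat d W \<and>
     d0 + (\<Sum>k<K. d1 k * d2 k) = d \<and>
     (\<forall>k<K. d1 k \<ge> 1 \<and> d2 k \<ge> 1 \<and> pd_density (d2 k) (\<rho> k)) \<and>
     peripheral_space d T =
       {decomp_embed W d0 K \<rho> x | x. \<forall>k<K. x k \<in> carrier_mat (d1 k) (d1 k)} \<and>
     (\<exists>U \<pi>. \<pi> permutes {..<K} \<and>
        (\<forall>k<K. d1 (\<pi> k) = d1 k \<and> unitary_mat (d1 k) (U k)) \<and>
        (\<forall>x. (\<forall>k<K. x k \<in> carrier_mat (d1 k) (d1 k)) \<longrightarrow>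
           T (decomp_embed W d0 K \<rho> x) =
             decomp_embed W d0 K \<rho> (\<lambda>k. U k * x (\<pi> k) * mat_adjoint (U k))))"
proof -
  obtain S where S: "uschw d S" and T: "lin (emap d T)" "\<And>x y. tr (emap d T x * y) = tr (x * S y)"
    "\<And>x. emap d T x \<in> corner (idm d)" using schwarz_map_emap[OF assms] by blast
  have TA: "T A \<in> carrier_mat d d" if "A \<in> carrier_mat d d" for A
    using assms that by (simp add: schwarz_map_def linear_map_mat_def)
  obtain Q N q where Q: "uschw d Q" "uschw d N" "\<And>x. Q (Q x) = Q x" "\<And>x. S (Q x) = Q (S x)" "\<And>x. N (Q x) = Q (N x)"
    "\<And>x. S (N x) = Q x" "\<And>x. N (S x) = Q x" "\<And>m. m \<le> q m" "\<And>x. flim (\<lambda>m. pw d S (q m) x) (Q x)"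
    by (rule idempotent_limit[OF S], rule that; assumption)
  obtain P where P: "lin P" "\<And>x y. tr (P x * y) = tr (x * Q y)" "\<And>x. P x \<in> corner (idm d)"
    by (rule dual_exists[OF Q(1)], rule that; assumption)
  interpret as: asymptotic d S "emap d T" Q N P q
    by unfold_locales (fact S T Q P)+
  obtain e where e: "proj e" "e \<in> corner (idm d)" "\<And>y. e * P y = P y" "\<And>y. P y * e = P y" "Q (idm d - e) = 0"
    "\<And>b. pos b \<Longrightarrow> b \<in> corner e \<Longrightarrow> tr (P (idm d) * b) = 0 \<Longrightarrow> b = 0"
    by (rule as.support_projection, rule that; assumption)
  interpret as: asymptotic_support d S "emap d T" Q N P q e
    by unfold_locales (fact e)+
  obtain K n p v where mu: "mat_units as.Alg e K n p v"
    using mat_units_exist[OF as.star_alg_Alg as.Alg_corner e(1) as.e_Alg] by blast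
  interpret mu: matrix_units as.Alg e K n p v
    by unfold_locales (use as.star_alg_Alg as.Alg_unit e as.e_Alg mu in auto)
  define r where "r = as.r p"
  let ?X = "block_elem K n v r"
  define m where "m = (\<lambda>k. SOME m. \<exists>f. onb (p k) m f)"
  define f where "f = (\<lambda>k. SOME f. onb (p k) (m k) f)"
  have f: "onb (p k) (m k) (f k)" if "k < K" for k
  proof -
    have "\<exists>m f. onb (p k) m f" using orthonormal_basis[OF mu.units_simps(3)[OF that]] .
    then have "\<exists>f. onb (p k) (m k) f" unfolding m_def by (rule someI_ex)
    then show ?thesis unfolding f_def by (rule someI_ex)
  qed
  have rp: "r k * p k = r k" "p k * r k = r k" if "k < K" for k using as.r_p[OF mu that] by (simp_all add: r_def)
  define \<rho> where "\<rho> = (\<lambda>k. gram_mat (m k) (f k) (r k))"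
  have dens: "n k \<ge> 1 \<and> m k \<ge> 1 \<and> pd_density (m k) (\<rho> k)" if k: "k < K" for k
  proof (intro conjI mu.units_simps(1)[OF k])
    show "m k \<ge> 1" using onbD(4)[OF f[OF k]] mu.units_simps(4)[OF k] by (cases "m k") auto
    show "pd_density (m k) (\<rho> k)" unfolding \<rho>_def
      by (rule gram_mat_pd_density[OF f[OF k] rp(1)[OF k] rp(2)[OF k]])
         (use as.r_adj[OF mu k] as.tr_r[OF mu k] as.r_pos_def[OF mu k] in \<open>simp_all add: r_def\<close>)
  qed
  have Iv: "idm d * v k i = v k i" if "k < K" "i < n k" for k i
    using as.Alg_corner mu.units_simps(5)[OF that] by (auto simp: corner_def)
  have vv: "adj (v k i) * v k i = p k" if "k < K" "i < n k" for k i using mu.units_simps(6)[OF that(1,1) that(2,2)] by simp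
  obtain W n0 where W: "unitary_mat d W" "n0 + (\<Sum>k<K. n k * m k) = d" and
    dec: "\<And>x. (\<forall>k<K. x k \<in> carrier_mat (n k) (n k)) \<Longrightarrow> decomp_embed W n0 K \<rho> x \<in> carrier_mat d d"
       "\<And>x. (\<forall>k<K. x k \<in> carrier_mat (n k) (n k)) \<Longrightarrow> emb (decomp_embed W n0 K \<rho> x) = ?X (\<lambda>k i j. x k $$ (i, j))"
    using decomp_embed_exists[of K n v p d e m f r, OF vv mu.v_p(1) Iv mu.units_simps(7) e(2,1) mu.units_simps(3) f rp]
    unfolding \<rho>_def by blast
  have fix_iff: "P (emb Y) = emb Y \<longleftrightarrow> (\<exists>x. Y = decomp_embed W n0 K \<rho> x \<and> (\<forall>k<K. x k \<in> carrier_mat (n k) (n k)))"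
    if Y: "Y \<in> carrier_mat d d" for Y
  proof
    assume "P (emb Y) = emb Y"
    then obtain c where c: "emb Y = ?X c" using as.fixed_block_elem[OF mu] unfolding r_def by blast
    let ?x = "\<lambda>k. mat (n k) (n k) (\<lambda>(i, j). c k i j)"
    have x: "\<forall>k<K. ?x k \<in> carrier_mat (n k) (n k)" by simp
    have "emb (decomp_embed W n0 K \<rho> ?x) = emb Y" unfolding dec(2)[OF x] c
      by (auto simp: block_elem_def intro!: sum.cong)
    then have "Y = decomp_embed W n0 K \<rho> ?x" using emb_inject[OF dec(1)[OF x] Y] by simp
    then show "\<exists>x. Y = decomp_embed W n0 K \<rho> x \<and> (\<forall>k<K. x k \<in> carrier_mat (n k) (n k))" using x by blast
  next
    assume "\<exists>x. Y = decomp_embed W n0 K \<rho> x \<and> (\<forall>k<K. x k \<in> carrier_mat (n k) (n k))"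
    then show "P (emb Y) = emb Y" using dec(2) as.P_block_elem[OF mu] unfolding r_def by auto
  qed
  let ?E = "{X \<in> carrier_mat d d. \<exists>\<phi>::real. T X = exp (\<i> * complex_of_real \<phi>) \<cdot>\<^sub>m X}"
  have peri: "peripheral_space d T = {Y \<in> carrier_mat d d. P (emb Y) = emb Y}"
  proof (intro equalityI subsetI)
    fix Y assume "Y \<in> peripheral_space d T"
    then obtain l where l: "Y = lincomb_mat d l" "\<forall>z\<in>set l. snd z \<in> ?E" unfolding peripheral_space_def span_mat_def by blast
    have "lincomb_mat d l \<in> carrier_mat d d \<and> P (emb (lincomb_mat d l)) = emb (lincomb_mat d l)" if "\<forall>z\<in>set l. snd z \<in> ?E" for l
      using that
    proof (induction l)
      case Nil
      then show ?case by (simp add: emb_simps lin_simps[OF P(1)])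
    next
      case (Cons z l)
      obtain c X where z: "z = (c, X)" by (cases z)
      then obtain \<phi> :: real where X: "X \<in> carrier_mat d d" "T X = exp (\<i> * complex_of_real \<phi>) \<cdot>\<^sub>m X" using Cons(2) by auto
      have "P (emb X) = emb X"
        by (rule as.peripheral_eigen_fixed[OF emb_corner[OF X(1)], of "exp (\<i> * complex_of_real \<phi>)"])
           (simp_all add: emap_emb[OF X(1)] X(2) emb_simps)
      moreover have l: "lincomb_mat d l \<in> carrier_mat d d" "P (emb (lincomb_mat d l)) = emb (lincomb_mat d l)" using Cons by auto
      ultimately show ?case using X(1)
        by (simp add: z emb_simps(1)[OF smult_carrier_mat[OF X(1)] l(1)] emb_simps(3) lin_simps[OF P(1)])
    qed
    then show "Y \<in> {Y \<in> carrier_mat d d. P (emb Y) = emb Y}" using l by simp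
  next
    fix Y assume "Y \<in> {Y \<in> carrier_mat d d. P (emb Y) = emb Y}"
    then have Y: "Y \<in> carrier_mat d d" "P (emb Y) = emb Y" by auto
    from as.fixed_periph_sum[OF Y(2)] obtain ws where ws: "emb Y = sum_list ws"
      "\<forall>w\<in>set ws. P w = w \<and> (\<exists>l. cmod l = 1 \<and> emap d T w = l \<star> w)" unfolding as.periph_sum_def by blast
    have wE: "tom d w \<in> ?E" if w: "w \<in> set ws" for w
    proof -
      obtain l where l: "P w = w" "cmod l = 1" "emap d T w = l \<star> w" using ws(2) w by blast
      have "w \<in> corner (idm d)" using as.fixed_corner[OF l(1)] .
      have "emb (T (tom d w)) = emb (l \<cdot>\<^sub>m tom d w)" using l(3) by (simp add: emap_def emb_simps emb_tom_corner[OF \<open>w \<in> corner (idm d)\<close>])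
      then have "T (tom d w) = l \<cdot>\<^sub>m tom d w" by (rule emb_inject[OF TA[OF tom_carrier], rotated]) simp
      moreover have "l = exp (\<i> * complex_of_real (Arg l))" using l(2) cis_Arg_unique
        by (metis cis_conv_exp mult_1 of_real_1 rcis_cmod_Arg rcis_def)
      ultimately have "T (tom d w) = exp (\<i> * complex_of_real (Arg l)) \<cdot>\<^sub>m tom d w" by metis
      then show ?thesis by auto
    qed
    let ?l = "map (\<lambda>w. (1, tom d w)) ws"
    have "lincomb_mat d (map (\<lambda>w. (1, tom d w)) xs) \<in> carrier_mat d d \<and> emb (lincomb_mat d (map (\<lambda>w. (1, tom d w)) xs)) = sum_list xs"
      if "set xs \<subseteq> corner (idm d)" for xs using that
      by (induction xs) (auto simp: emb_simps(1)[where d = d] emb_simps(3-5) emb_tom_corner)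
    moreover have "set ws \<subseteq> corner (idm d)" using ws(2) as.fixed_corner by blast
    ultimately have "lincomb_mat d ?l = Y" using ws(1) Y(1) emb_inject by metis
    moreover have "\<forall>z\<in>set ?l. snd z \<in> ?E" using wE by auto
    ultimately show "Y \<in> peripheral_space d T" unfolding peripheral_space_def span_mat_def by blast
  qed
  obtain \<tau> and U :: "nat \<Rightarrow> nat \<Rightarrow> nat \<Rightarrow> complex" where \<tau>U: "\<tau> permutes {..<K} \<and> (\<forall>k<K. n (\<tau> k) = n k \<and> unitary_coeffs (n k) (U k)) \<and>
    (\<forall>c. emap d T (?X c) = ?X (\<lambda>k i j. \<Sum>a<n k. \<Sum>b<n k. cnj (U k b i) * c (\<tau> k) b a * U k a j))"
    using as.T_block_elem[OF mu] unfolding r_def by blast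
  have \<tau>: "\<tau> permutes {..<K}" and U: "\<And>k. k < K \<Longrightarrow> n (\<tau> k) = n k" "\<And>k. k < K \<Longrightarrow> unitary_coeffs (n k) (U k)"
    and TX: "\<And>c. emap d T (?X c) = ?X (\<lambda>k i j. \<Sum>a<n k. \<Sum>b<n k. cnj (U k b i) * c (\<tau> k) b a * U k a j)"
    using \<tau>U by simp_all
  \<comment> \<open>The adjoint of the coefficient matrix of the automorphism, since
    \<open>T\<close> acts by trace duality.\<close>
  define V where "V = (\<lambda>k. mat (n k) (n k) (\<lambda>(i, b). cnj (U k b i)))"
  have V: "V k \<in> carrier_mat (n k) (n k)" for k by (simp add: V_def)
  have Vu: "unitary_mat (n k) (V k)" if k: "k < K" for k
  proof -
    have "mat_adjoint (V k) * V k = 1\<^sub>m (n k)"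
      by (rule eq_matI) (use U(2)[OF k] in \<open>auto simp: unitary_coeffs_def V_def scalar_prod_def mat_adjoint_index atLeast0LessThan\<close>)
    moreover have "V k * mat_adjoint (V k) = 1\<^sub>m (n k)"
      by (rule eq_matI) (use U(2)[OF k] in \<open>auto simp: unitary_coeffs_def V_def scalar_prod_def mat_adjoint_index atLeast0LessThan\<close>)
    ultimately show ?thesis using V by (simp add: unitary_mat_def)
  qed
  have \<tau>K: "\<tau> k < K" if "k < K" for k using permutes_in_image[OF \<tau>, of k] that by simp
  have act: "T (decomp_embed W n0 K \<rho> x) = decomp_embed W n0 K \<rho> (\<lambda>k. V k * x (\<tau> k) * mat_adjoint (V k))"
    if x: "\<forall>k<K. x k \<in> carrier_mat (n k) (n k)" for x
  proof -
    let ?y = "\<lambda>k. V k * x (\<tau> k) * mat_adjoint (V k)"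
    have xt: "x (\<tau> k) \<in> carrier_mat (n k) (n k)" if "k < K" for k using x \<tau>K[OF that] U(1)[OF that] by metis
    have y: "\<forall>k<K. ?y k \<in> carrier_mat (n k) (n k)" using mult_carrier_mat[OF mult_carrier_mat[OF V xt] mat_adjoint_carrier[OF V]] by blast
    have "emb (T (decomp_embed W n0 K \<rho> x)) = emap d T (?X (\<lambda>k i j. x k $$ (i, j)))"
      unfolding dec(2)[OF x, symmetric] by (rule emap_emb[OF dec(1)[OF x], symmetric])
    also have "\<dots> = ?X (\<lambda>k i j. ?y k $$ (i, j))" unfolding TX unfolding r_def
    proof (rule as.block_elem_cong[OF mu])
      fix k i j assume k: "k < K" "i < n k" "j < n k"
      show "(\<Sum>a<n k. \<Sum>b<n k. cnj (U k b i) * x (\<tau> k) $$ (b, a) * U k a j) = ?y k $$ (i, j)"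
        unfolding conj_index[OF V xt[OF k(1)] k(2,3)] by (intro sum.cong) (use k in \<open>auto simp: V_def\<close>)
    qed
    also have "\<dots> = emb (decomp_embed W n0 K \<rho> ?y)" by (rule dec(2)[OF y, symmetric])
    finally show ?thesis by (rule emb_inject[OF TA[OF dec(1)[OF x]] dec(1)[OF y]])
  qed
  have "peripheral_space d T = {decomp_embed W n0 K \<rho> x | x. \<forall>k<K. x k \<in> carrier_mat (n k) (n k)}"
    unfolding peri using fix_iff dec(1) by blast
  moreover have "\<exists>U \<pi>. \<pi> permutes {..<K} \<and> (\<forall>k<K. n (\<pi> k) = n k \<and> unitary_mat (n k) (U k)) \<and>
        (\<forall>x. (\<forall>k<K. x k \<in> carrier_mat (n k) (n k)) \<longrightarrow>
           T (decomp_embed W n0 K \<rho> x) = decomp_embed W n0 K \<rho> (\<lambda>k. U k * x (\<pi> k) * mat_adjoint (U k)))"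
    using \<tau> U(1) Vu act by (intro exI[of _ V] exI[of _ \<tau>]) auto
  ultimately show ?thesis using W dens
    by (intro exI[of _ W] exI[of _ n0] exI[of _ K] exI[of _ n] exI[of _ m] exI[of _ \<rho>]) auto
qed

end
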